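(* Let $(M,\varphi,\xi_\alpha,\eta^\alpha,g)$ be a Lorentzian $\mathcal{S}$-manifold with $\dim(M)=2n+s$, $s\geqslant2$, with $\xi_1$ timelike. Let $\tau\colon M\to M'$ be the projection of a principal $\mathbb{T}^{s-1}$-bundle over a Lorentz Sasakian manifold $M'$ of dimension $2n+1$ with structure $(\varphi',\xi',\eta',g')$, such that $\tau$ is a semi-Riemannian submersion with totally geodesic fibres, with vertical distribution $\ker d\tau=\mathrm{span}(\xi_2,\dots,\xi_s)$, $d\tau\circ\varphi=\varphi'\circ d\tau$ and $\tau_*\xi_1=\xi'$. Let $p\in M$, and suppose that, for every $x\in S_\varphi((\xi_1)_p)$, $\varphi x$ is an eigenvector of $R_x$. Then $M$ is $\varphi$-null Osserman with respect to $(\xi_1)_p$ if and only if $M'$ is null Osserman with respect to $\xi'_{p'}$, where $p'=\tau(p)$.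
   Context: All manifolds are connected; all tensor fields and maps are smooth. Curvature convention: $R(Z,W)Y=([\nabla_Z,\nabla_W]-\nabla_{[Z,W]})Y$, with $\nabla$ the Levi-Civita connection. **Lorentzian $\mathcal{S}$-manifolds.** A globally framed $f$-structure ($g.f.f$-structure) on a manifold $M$ of dimension $2n+s$ consists of a nonvanishing $(1,1)$-tensor field $\varphi$ of constant rank $2n$ with $\varphi^3+\varphi=0$, together with vector fields $\xi_1,\dots,\xi_s$ (characteristic vector fields) spanning $\ker\varphi$ and $1$-forms $\eta^1,\dots,\eta^s$ such that $\varphi^2=-I+\sum_\alpha\eta^\alpha\otimes\xi_\alpha$ and $\eta^\alpha(\xi_\beta)=\delta^\alpha_\beta$. It is normal if $[\varphi,\varphi]+2\sum_\alpha d\eta^\alpha\otimes\xi_\alpha=0$, where $[\varphi,\varphi]$ is the Nijenhuis torsion. A semi-Riemannian metric $g$ is compatible if $g(\varphi X,\varphi Y)=g(X,Y)-\sum_\alpha\varepsilon_\alpha\eta^\alpha(X)\eta^\alpha(Y)$, where $\varepsilon_\alpha=g(\xi_\alpha,\xi_\alpha)=\pm1$. Then $TM=\mathrm{Im}(\varphi)\oplus\ker(\varphi)$ orthogonally. An indefinite $\mathcal{S}$-manifold is a normal $g.f.f$-manifold with compatible metric such that $d\eta^\alpha=\Phi$ for all $\alpha$, where $\Phi(X,Y)=g(X,\varphi Y)$; here $2d\eta(X,Y)=X\eta(Y)-Y\eta(X)-\eta([X,Y])$, so that $\nabla_X\xi_\alpha=-\varepsilon_\alpha\varphi X$. It is a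 Lorentzian $\mathcal{S}$-manifold if $g$ is Lorentzian (signature with exactly one minus sign); then exactly one $\xi_\alpha$ is timelike, and it is labelled $\xi_1$ (so $\varepsilon_1=-1$, $\varepsilon_\alpha=1$ for $\alpha\ge2$). A Lorentz Sasakian manifold is a Lorentzian $\mathcal{S}$-manifold with $s=1$. **Submersions.** A semi-Riemannian submersion $f\colon(M,g)\to(B,g')$ is a surjective submersion whose fibres are semi-Riemannian submanifolds and such that $(df)_p$ restricted to the horizontal space $\mathcal{H}_p=(\ker (df)_p)^\bot$ is an isometry onto $T_{f(p)}B$. $\mathbb{T}^k$ is the $k$-dimensional torus. **Osserman conditions.** For a unit (spacelike or timelike) vector $z\in T_pM$, the Jacobi operator is $R_z\colon z^\bot\to z^\bot$, $R_z(y)=R_p(y,z)z$. On a Lorentzian manifold, for a null vector $u\ne0$ put $\bar u^\bot=u^\bot/\mathrm{span}(u)$ with projection $u^\bot\to\bar u^\bot$, $x\mapsto\bar x$, and positive definite inner product $\bar g(\bar x,\bar y)=g(x,y)$; define $\bar R_u\colon\bar u^\bot\to\bar u^\bot$ by $\bar R_u(\bar x)=\overline{R_p(x,u)u}$ (self-adjoint). For a unit timelike $z\in T_pM$ let $N(z)=\{u\in T_pM: g(u,u)=0,\ g(u,z)=-1\}$ (null congruence set) and $S(z)=\{x\in z^\bot: g(x,x)=1\}$; $\psi\colon N(z)\to S(z)$, $\psi(u)=u-z$, is a bijection. A Lorentzian manifold is null Osserman with respect to $z$ if the eigenvalues of $\bar R_u$ with multiplicities are independent of $u\in N(z)$. On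 a Lorentzian $g.f.f$-manifold put $S_\varphi((\xi_1)_p)=S((\xi_1)_p)\cap\mathrm{Im}(\varphi_p)$ and $N_\varphi((\xi_1)_p)=\psi^{-1}(S_\varphi((\xi_1)_p))$; the manifold is $\varphi$-null Osserman with respect to $(\xi_1)_p$ if the eigenvalues of $\bar R_u$ with multiplicities are independent of $u\in N_\varphi((\xi_1)_p)$. *)

theory Defs
  imports "HOL-Analysis.Analysis" "HOL-Library.Function_Algebras"
begin

text \<open>Tangent vectors will be derivations of an algebra of functions, hence elements of a function
  type; this instance provides \<open>span\<close>, \<open>dim\<close> etc. for them.\<close>

instantiation "fun" :: (type, real_vector) real_vector
begin

definition scaleR_fun :: "real \<Rightarrow> ('a \<Rightarrow> 'b) \<Rightarrow> 'a \<Rightarrow> 'b" where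
  "scaleR_fun c f = (\<lambda>x. c *\<^sub>R f x)"

instance
  by standard
    (auto simp: scaleR_fun_def plus_fun_def fun_eq_iff scaleR_add_right scaleR_add_left)

end

text \<open>\<open>Ck_on k S f\<close> is the usual class \<open>C\<^sup>k\<close> on an \<^emph>\<open>open\<close> set \<open>S\<close>, via iterated
  directional derivatives.\<close>

primrec Ck_on :: "nat \<Rightarrow> 'e::euclidean_space set \<Rightarrow> ('e \<Rightarrow> 'f::real_normed_vector) \<Rightarrow> bool" where
  "Ck_on 0 S f \<longleftrightarrow> continuous_on S f"
| "Ck_on (Suc k) S f \<longleftrightarrow>
     (\<forall>x\<in>S. f differentiable (at x)) \<and> (\<forall>v. Ck_on k S (\<lambda>x. frechet_derivative f (at x) v))"

definition smooth_on :: "'e::euclidean_space set \<Rightarrow> ('e \<Rightarrow> 'f::real_normed_vector) \<Rightarrow> bool" where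
  "smooth_on S f \<longleftrightarrow> (\<forall>k. Ck_on k S f)"

text \<open>A manifold is a topological type \<open>'a\<close> together with an atlas modelled on \<open>'e\<close>. The smooth
  structure is the one generated by the atlas, which need not be maximal.\<close>

type_synonym ('a, 'e) chart = "'a set \<times> ('a \<Rightarrow> 'e)"

abbreviation chart_inv :: "('a, 'e) chart \<Rightarrow> 'e \<Rightarrow> 'a" where
  "chart_inv c \<equiv> inv_into (fst c) (snd c)"

definition is_chart :: "('a::topological_space, 'e::euclidean_space) chart \<Rightarrow> bool" where
  "is_chart c \<longleftrightarrow> open (fst c) \<and> open (snd c ` fst c) \<and>
     homeomorphism (fst c) (snd c ` fst c) (snd c) (chart_inv c)"

definition is_atlas :: "('a::topological_space, 'e::euclidean_space) chart set \<Rightarrow> bool" where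
  "is_atlas A \<longleftrightarrow> (\<forall>c\<in>A. is_chart c) \<and> (\<Union>c\<in>A. fst c) = UNIV \<and>
     (\<forall>c\<in>A. \<forall>d\<in>A. smooth_on (snd c ` (fst c \<inter> fst d)) (snd d \<circ> chart_inv c))"

definition smooth_manifold ::
    "('a::{t2_space, second_countable_topology}, 'e::euclidean_space) chart set \<Rightarrow> bool" where
  "smooth_manifold A \<longleftrightarrow> is_atlas A \<and> connected (UNIV :: 'a set)"

definition smooth_map_on :: "'a::topological_space set \<Rightarrow> ('a, 'e::euclidean_space) chart set \<Rightarrow>
    ('b::topological_space, 'f::euclidean_space) chart set \<Rightarrow> ('a \<Rightarrow> 'b) \<Rightarrow> bool" where
  "smooth_map_on W A B F \<longleftrightarrow> continuous_on W F \<and>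
     (\<forall>c\<in>A. \<forall>d\<in>B. smooth_on (snd c ` (fst c \<inter> W \<inter> F -` fst d)) (snd d \<circ> F \<circ> chart_inv c))"

definition eucl :: "('e, 'e) chart set" where
  "eucl = {(UNIV, id)}"

definition prod_atlas :: "('a, 'e) chart set \<Rightarrow> ('b, 'f) chart set \<Rightarrow> ('a \<times> 'b, 'e \<times> 'f) chart set" where
  "prod_atlas A B = (\<lambda>(c, d). (fst c \<times> fst d, map_prod (snd c) (snd d))) ` (A \<times> B)"

definition smooth_fun :: "('a::topological_space, 'e::euclidean_space) chart set \<Rightarrow> ('a \<Rightarrow> real) \<Rightarrow> bool" where
  "smooth_fun A f \<longleftrightarrow> smooth_map_on UNIV A eucl f"

type_synonym 'a tvec = "('a \<Rightarrow> real) \<Rightarrow> real"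

text \<open>Tangent vectors at \<open>p\<close> are the derivations at \<open>p\<close> of the algebra of smooth functions; the value
  \<open>0\<close> outside of that algebra makes equality of derivations equality of functions.\<close>

definition tangent_space ::
    "('a::topological_space, 'e::euclidean_space) chart set \<Rightarrow> 'a \<Rightarrow> 'a tvec set" where
  "tangent_space A p = {v.
     (\<forall>f h. smooth_fun A f \<longrightarrow> smooth_fun A h \<longrightarrow>
        v (\<lambda>x. f x + h x) = v f + v h \<and> v (\<lambda>x. f x * h x) = f p * v h + h p * v f) \<and>
     (\<forall>f c. smooth_fun A f \<longrightarrow> v (\<lambda>x. c * f x) = c * v f) \<and>
     (\<forall>f. \<not> smooth_fun A f \<longrightarrow> v f = 0)}"

definition differential :: "('b::topological_space, 'f::euclidean_space) chart set \<Rightarrow>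
    ('a \<Rightarrow> 'b) \<Rightarrow> 'a tvec \<Rightarrow> 'b tvec" where
  "differential B F v = (\<lambda>h. if smooth_fun B h then v (h \<circ> F) else 0)"

definition linear_to :: "'v::real_vector set \<Rightarrow> 'w::real_vector set \<Rightarrow> ('v \<Rightarrow> 'w) \<Rightarrow> bool" where
  "linear_to V W T \<longleftrightarrow> (\<forall>x\<in>V. T x \<in> W) \<and>
     (\<forall>x\<in>V. \<forall>y\<in>V. T (x + y) = T x + T y) \<and> (\<forall>c. \<forall>x\<in>V. T (c *\<^sub>R x) = c *\<^sub>R T x)"

type_synonym 'a vfield = "'a \<Rightarrow> 'a tvec"

definition vector_fields ::
    "('a::topological_space, 'e::euclidean_space) chart set \<Rightarrow> 'a vfield set" where
  "vector_fields A = {X. (\<forall>p. X p \<in> tangent_space A p) \<and>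
     (\<forall>f. smooth_fun A f \<longrightarrow> smooth_fun A (\<lambda>p. X p f))}"

definition lie_bracket :: "'a vfield \<Rightarrow> 'a vfield \<Rightarrow> 'a vfield" where
  "lie_bracket X Y = (\<lambda>p f. X p (\<lambda>q. Y q f) - Y p (\<lambda>q. X q f))"

definition one_form :: "('a::topological_space, 'e::euclidean_space) chart set \<Rightarrow>
    ('a \<Rightarrow> 'a tvec \<Rightarrow> real) \<Rightarrow> bool" where
  "one_form A \<eta> \<longleftrightarrow> (\<forall>p. linear_to (tangent_space A p) UNIV (\<eta> p)) \<and>
     (\<forall>X\<in>vector_fields A. smooth_fun A (\<lambda>p. \<eta> p (X p)))"

definition tensor11 :: "('a::topological_space, 'e::euclidean_space) chart set \<Rightarrow>
    ('a \<Rightarrow> 'a tvec \<Rightarrow> 'a tvec) \<Rightarrow> bool" where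
  "tensor11 A \<phi> \<longleftrightarrow> (\<forall>p. linear_to (tangent_space A p) (tangent_space A p) (\<phi> p)) \<and>
     (\<forall>X\<in>vector_fields A. (\<lambda>p. \<phi> p (X p)) \<in> vector_fields A)"

type_synonym 'a metric = "'a \<Rightarrow> 'a tvec \<Rightarrow> 'a tvec \<Rightarrow> real"

definition nondegenerate_on :: "'v set \<Rightarrow> ('v \<Rightarrow> 'v::real_vector \<Rightarrow> real) \<Rightarrow> bool" where
  "nondegenerate_on V b \<longleftrightarrow> (\<forall>v\<in>V. (\<forall>w\<in>V. b v w = 0) \<longrightarrow> v = 0)"

text \<open>Constancy of the index is automatic by connectedness.\<close>

definition semi_riemannian_metric ::
    "('a::topological_space, 'e::euclidean_space) chart set \<Rightarrow> 'a metric \<Rightarrow> bool" where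
  "semi_riemannian_metric A g \<longleftrightarrow>
     (\<forall>p. \<forall>x\<in>tangent_space A p. linear_to (tangent_space A p) UNIV (g p x)) \<and>
     (\<forall>p. \<forall>x\<in>tangent_space A p. \<forall>y\<in>tangent_space A p. g p x y = g p y x) \<and>
     (\<forall>p. nondegenerate_on (tangent_space A p) (g p)) \<and>
     (\<forall>X\<in>vector_fields A. \<forall>Y\<in>vector_fields A. smooth_fun A (\<lambda>p. g p (X p) (Y p)))"

text \<open>Signature with exactly one minus sign, read off an orthonormal basis.\<close>

definition lorentzian_metric ::
    "('a::topological_space, 'e::euclidean_space) chart set \<Rightarrow> 'a metric \<Rightarrow> bool" where
  "lorentzian_metric A g \<longleftrightarrow> semi_riemannian_metric A g \<and>
     (\<forall>p. \<exists>B. finite B \<and> independent B \<and> span B = tangent_space A p \<and>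
        (\<forall>b\<in>B. \<forall>c\<in>B. b \<noteq> c \<longrightarrow> g p b c = 0) \<and> (\<forall>b\<in>B. g p b b = 1 \<or> g p b b = -1) \<and>
        (\<exists>!b. b \<in> B \<and> g p b b = -1))"

definition levi_civita :: "('a::topological_space, 'e::euclidean_space) chart set \<Rightarrow> 'a metric \<Rightarrow>
    ('a vfield \<Rightarrow> 'a vfield \<Rightarrow> 'a vfield) \<Rightarrow> bool" where
  "levi_civita A g D \<longleftrightarrow>
     (\<forall>X\<in>vector_fields A. \<forall>Y\<in>vector_fields A. \<forall>Z\<in>vector_fields A.
        D X Y \<in> vector_fields A \<and>
        D (X + Y) Z = D X Z + D Y Z \<and>
        D X (Y + Z) = D X Y + D X Z \<and>
        (\<forall>f. smooth_fun A f \<longrightarrow>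
           D (\<lambda>p. f p *\<^sub>R X p) Y = (\<lambda>p. f p *\<^sub>R D X Y p) \<and>
           D X (\<lambda>p. f p *\<^sub>R Y p) = (\<lambda>p. X p f *\<^sub>R Y p + f p *\<^sub>R D X Y p)) \<and>
        D X Y - D Y X = lie_bracket X Y \<and>
        (\<forall>p. X p (\<lambda>q. g q (Y q) (Z q)) = g p (D X Y p) (Z p) + g p (Y p) (D X Z p)))"

definition curvature :: "('a vfield \<Rightarrow> 'a vfield \<Rightarrow> 'a vfield) \<Rightarrow>
    'a vfield \<Rightarrow> 'a vfield \<Rightarrow> 'a vfield \<Rightarrow> 'a vfield" where
  "curvature D Z W Y = D Z (D W Y) - D W (D Z Y) - D (lie_bracket Z W) Y"

text \<open>\<open>curvature_at A D p z w y\<close> is \<open>R\<^sub>p(z, w) y\<close>: the value at \<open>p\<close> of \<open>R(Z, W) Y\<close> for any vector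
  fields extending \<open>z, w, y\<close>, independent of the extension by tensoriality.\<close>

definition curvature_at :: "('a::topological_space, 'e::euclidean_space) chart set \<Rightarrow>
    ('a vfield \<Rightarrow> 'a vfield \<Rightarrow> 'a vfield) \<Rightarrow> 'a \<Rightarrow> 'a tvec \<Rightarrow> 'a tvec \<Rightarrow> 'a tvec \<Rightarrow> 'a tvec" where
  "curvature_at A D p z w y = (THE r. \<exists>Z\<in>vector_fields A. \<exists>W\<in>vector_fields A. \<exists>Y\<in>vector_fields A.
     Z p = z \<and> W p = w \<and> Y p = y \<and> r = curvature D Z W Y p)"

text \<open>Characteristic vector fields and forms are indexed by \<open>{1..s}\<close>.\<close>

definition gff_structure :: "('a::{t2_space, second_countable_topology}, 'e::euclidean_space) chart set \<Rightarrow>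
    nat \<Rightarrow> nat \<Rightarrow> ('a \<Rightarrow> 'a tvec \<Rightarrow> 'a tvec) \<Rightarrow> (nat \<Rightarrow> 'a vfield) \<Rightarrow>
    (nat \<Rightarrow> 'a \<Rightarrow> 'a tvec \<Rightarrow> real) \<Rightarrow> bool" where
  "gff_structure A n s \<phi> \<xi> \<eta> \<longleftrightarrow>
     smooth_manifold A \<and> DIM('e) = 2 * n + s \<and>
     tensor11 A \<phi> \<and> (\<forall>\<alpha>\<in>{1..s}. \<xi> \<alpha> \<in> vector_fields A) \<and> (\<forall>\<alpha>\<in>{1..s}. one_form A (\<eta> \<alpha>)) \<and>
     (\<forall>p. (\<exists>v\<in>tangent_space A p. \<phi> p v \<noteq> 0) \<and> dim (\<phi> p ` tangent_space A p) = 2 * n \<and>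
        (\<forall>v\<in>tangent_space A p. \<phi> p (\<phi> p (\<phi> p v)) + \<phi> p v = 0) \<and>
        span ((\<lambda>\<alpha>. \<xi> \<alpha> p) ` {1..s}) = {v\<in>tangent_space A p. \<phi> p v = 0} \<and>
        (\<forall>v\<in>tangent_space A p. \<phi> p (\<phi> p v) = - v + (\<Sum>\<alpha>=1..s. \<eta> \<alpha> p v *\<^sub>R \<xi> \<alpha> p)) \<and>
        (\<forall>\<alpha>\<in>{1..s}. \<forall>\<beta>\<in>{1..s}. \<eta> \<alpha> p (\<xi> \<beta> p) = (if \<alpha> = \<beta> then 1 else 0)))"

definition nijenhuis :: "('a \<Rightarrow> 'a tvec \<Rightarrow> 'a tvec) \<Rightarrow> 'a vfield \<Rightarrow> 'a vfield \<Rightarrow> 'a vfield" where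
  "nijenhuis \<phi> X Y = (let \<phi>X = (\<lambda>p. \<phi> p (X p)); \<phi>Y = (\<lambda>p. \<phi> p (Y p)) in
     (\<lambda>p. \<phi> p (\<phi> p (lie_bracket X Y p)) + lie_bracket \<phi>X \<phi>Y p
        - \<phi> p (lie_bracket \<phi>X Y p) - \<phi> p (lie_bracket X \<phi>Y p)))"

text \<open>With the factor one half: \<open>2 d\<eta>(X, Y) = X \<eta>(Y) - Y \<eta>(X) - \<eta>([X, Y])\<close>.\<close>

definition ext_deriv :: "('a \<Rightarrow> 'a tvec \<Rightarrow> real) \<Rightarrow> 'a vfield \<Rightarrow> 'a vfield \<Rightarrow> 'a \<Rightarrow> real" where
  "ext_deriv \<eta> X Y p =
     (X p (\<lambda>q. \<eta> q (Y q)) - Y p (\<lambda>q. \<eta> q (X q)) - \<eta> p (lie_bracket X Y p)) / 2"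

definition normal_gff :: "('a::topological_space, 'e::euclidean_space) chart set \<Rightarrow>
    nat \<Rightarrow> ('a \<Rightarrow> 'a tvec \<Rightarrow> 'a tvec) \<Rightarrow> (nat \<Rightarrow> 'a vfield) \<Rightarrow>
    (nat \<Rightarrow> 'a \<Rightarrow> 'a tvec \<Rightarrow> real) \<Rightarrow> bool" where
  "normal_gff A s \<phi> \<xi> \<eta> \<longleftrightarrow> (\<forall>X\<in>vector_fields A. \<forall>Y\<in>vector_fields A. \<forall>p.
     nijenhuis \<phi> X Y p + 2 *\<^sub>R (\<Sum>\<alpha>=1..s. ext_deriv (\<eta> \<alpha>) X Y p *\<^sub>R \<xi> \<alpha> p) = 0)"

text \<open>Here \<open>\<epsilon>\<^sub>\<alpha>\<close> is written out as \<open>g(\<xi>\<^sub>\<alpha>, \<xi>\<^sub>\<alpha>)\<close>.\<close>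

definition compatible_metric :: "('a::topological_space, 'e::euclidean_space) chart set \<Rightarrow>
    nat \<Rightarrow> ('a \<Rightarrow> 'a tvec \<Rightarrow> 'a tvec) \<Rightarrow> (nat \<Rightarrow> 'a vfield) \<Rightarrow>
    (nat \<Rightarrow> 'a \<Rightarrow> 'a tvec \<Rightarrow> real) \<Rightarrow> 'a metric \<Rightarrow> bool" where
  "compatible_metric A s \<phi> \<xi> \<eta> g \<longleftrightarrow>
     semi_riemannian_metric A g \<and>
     (\<forall>p. \<forall>\<alpha>\<in>{1..s}. g p (\<xi> \<alpha> p) (\<xi> \<alpha> p) = 1 \<or> g p (\<xi> \<alpha> p) (\<xi> \<alpha> p) = -1) \<and>
     (\<forall>p. \<forall>x\<in>tangent_space A p. \<forall>y\<in>tangent_space A p.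
        g p (\<phi> p x) (\<phi> p y) =
          g p x y - (\<Sum>\<alpha>=1..s. g p (\<xi> \<alpha> p) (\<xi> \<alpha> p) * \<eta> \<alpha> p x * \<eta> \<alpha> p y))"

definition indefinite_S_manifold ::
    "('a::{t2_space, second_countable_topology}, 'e::euclidean_space) chart set \<Rightarrow>
    nat \<Rightarrow> nat \<Rightarrow> ('a \<Rightarrow> 'a tvec \<Rightarrow> 'a tvec) \<Rightarrow> (nat \<Rightarrow> 'a vfield) \<Rightarrow>
    (nat \<Rightarrow> 'a \<Rightarrow> 'a tvec \<Rightarrow> real) \<Rightarrow> 'a metric \<Rightarrow> bool" where
  "indefinite_S_manifold A n s \<phi> \<xi> \<eta> g \<longleftrightarrow>
     gff_structure A n s \<phi> \<xi> \<eta> \<and> normal_gff A s \<phi> \<xi> \<eta> \<and> compatible_metric A s \<phi> \<xi> \<eta> g \<and>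
     (\<forall>\<alpha>\<in>{1..s}. \<forall>X\<in>vector_fields A. \<forall>Y\<in>vector_fields A. \<forall>p.
        ext_deriv (\<eta> \<alpha>) X Y p = g p (X p) (\<phi> p (Y p)))"

text \<open>The timelike characteristic vector field carries the label 1.\<close>

definition lorentzian_S_manifold ::
    "('a::{t2_space, second_countable_topology}, 'e::euclidean_space) chart set \<Rightarrow>
    nat \<Rightarrow> nat \<Rightarrow> ('a \<Rightarrow> 'a tvec \<Rightarrow> 'a tvec) \<Rightarrow> (nat \<Rightarrow> 'a vfield) \<Rightarrow>
    (nat \<Rightarrow> 'a \<Rightarrow> 'a tvec \<Rightarrow> real) \<Rightarrow> 'a metric \<Rightarrow> bool" where
  "lorentzian_S_manifold A n s \<phi> \<xi> \<eta> g \<longleftrightarrow>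
     indefinite_S_manifold A n s \<phi> \<xi> \<eta> g \<and> lorentzian_metric A g \<and>
     (\<forall>p. g p (\<xi> 1 p) (\<xi> 1 p) = -1 \<and> (\<forall>\<alpha>\<in>{2..s}. g p (\<xi> \<alpha> p) (\<xi> \<alpha> p) = 1))"

definition lorentz_sasakian_manifold ::
    "('a::{t2_space, second_countable_topology}, 'e::euclidean_space) chart set \<Rightarrow>
    nat \<Rightarrow> ('a \<Rightarrow> 'a tvec \<Rightarrow> 'a tvec) \<Rightarrow> 'a vfield \<Rightarrow> ('a \<Rightarrow> 'a tvec \<Rightarrow> real) \<Rightarrow> 'a metric \<Rightarrow> bool" where
  "lorentz_sasakian_manifold A n \<phi> \<xi> \<eta> g \<longleftrightarrow>
     lorentzian_S_manifold A n 1 \<phi> (\<lambda>_. \<xi>) (\<lambda>_. \<eta>) g"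

text \<open>The torus \<open>\<T>\<^sup>k\<close>, \<open>k = CARD('k)\<close>, sits in \<open>\<complex>\<^sup>k\<close> with componentwise multiplication. Since
  \<open>torus_exp\<close> is a covering and a local diffeomorphism, a map defined on \<open>V \<times> \<T>\<^sup>k\<close> is smooth iff
  its pullback to \<open>V \<times> \<real>\<^sup>k\<close> is.\<close>

definition torus :: "(complex ^ 'k) set" where
  "torus = {t. \<forall>i. norm (t $ i) = 1}"

definition torus_exp :: "real ^ 'k \<Rightarrow> complex ^ 'k" where
  "torus_exp \<theta> = (\<chi> i. cis (\<theta> $ i))"

definition principal_torus_bundle ::
    "('a::topological_space, 'e::euclidean_space) chart set \<Rightarrow>
     ('b::topological_space, 'f::euclidean_space) chart set \<Rightarrow> ('a \<Rightarrow> 'b) \<Rightarrow>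
     ('a \<Rightarrow> complex ^ 'k \<Rightarrow> 'a) \<Rightarrow> bool" where
  "principal_torus_bundle A B \<tau> act \<longleftrightarrow>
     smooth_map_on UNIV A B \<tau> \<and>
     (\<forall>p. act p 1 = p) \<and>
     (\<forall>p. \<forall>t\<in>torus. \<forall>u\<in>torus. act (act p t) u = act p (t * u)) \<and>
     smooth_map_on UNIV (prod_atlas A eucl) A (\<lambda>(p, \<theta> :: real ^ 'k). act p (torus_exp \<theta>)) \<and>
     (\<forall>p. \<forall>t\<in>torus. \<tau> (act p t) = \<tau> p) \<and>
     (\<forall>q. \<exists>V \<Psi> \<Theta>. open V \<and> q \<in> V \<and>
        smooth_map_on (\<tau> -` V) A eucl \<Psi> \<and> \<Psi> ` (\<tau> -` V) \<subseteq> torus \<and>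
        smooth_map_on (V \<times> UNIV) (prod_atlas B eucl) A
          (\<lambda>(y, \<theta> :: real ^ 'k). \<Theta> (y, torus_exp \<theta>)) \<and>
        (\<forall>p\<in>\<tau> -` V. \<Theta> (\<tau> p, \<Psi> p) = p) \<and>
        (\<forall>y\<in>V. \<forall>t\<in>torus. \<tau> (\<Theta> (y, t)) = y \<and> \<Psi> (\<Theta> (y, t)) = t) \<and>
        (\<forall>p\<in>\<tau> -` V. \<forall>t\<in>torus. \<Psi> (act p t) = \<Psi> p * t))"

definition vertical_space :: "('a::topological_space, 'e::euclidean_space) chart set \<Rightarrow>
    ('b::topological_space, 'f::euclidean_space) chart set \<Rightarrow> ('a \<Rightarrow> 'b) \<Rightarrow> 'a \<Rightarrow> 'a tvec set" where
  "vertical_space A B \<tau> p = {v\<in>tangent_space A p. differential B \<tau> v = 0}"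

definition horizontal_space :: "('a::topological_space, 'e::euclidean_space) chart set \<Rightarrow> 'a metric \<Rightarrow>
    ('b::topological_space, 'f::euclidean_space) chart set \<Rightarrow> ('a \<Rightarrow> 'b) \<Rightarrow> 'a \<Rightarrow> 'a tvec set" where
  "horizontal_space A g B \<tau> p = {x\<in>tangent_space A p. \<forall>v\<in>vertical_space A B \<tau> p. g p x v = 0}"

text \<open>Fibres of a submersion are submanifolds with tangent spaces the vertical spaces, so they are
  semi-Riemannian submanifolds iff the metric is nondegenerate on the vertical spaces.\<close>

definition semi_riemannian_submersion :: "('a::topological_space, 'e::euclidean_space) chart set \<Rightarrow>
    'a metric \<Rightarrow> ('b::topological_space, 'f::euclidean_space) chart set \<Rightarrow> 'b metric \<Rightarrow>
    ('a \<Rightarrow> 'b) \<Rightarrow> bool" where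
  "semi_riemannian_submersion A g B g' \<tau> \<longleftrightarrow>
     smooth_map_on UNIV A B \<tau> \<and> surj \<tau> \<and>
     (\<forall>p. differential B \<tau> ` tangent_space A p = tangent_space B (\<tau> p) \<and>
        nondegenerate_on (vertical_space A B \<tau> p) (g p) \<and>
        bij_betw (differential B \<tau>) (horizontal_space A g B \<tau> p) (tangent_space B (\<tau> p)) \<and>
        (\<forall>x\<in>horizontal_space A g B \<tau> p. \<forall>y\<in>horizontal_space A g B \<tau> p.
           g' (\<tau> p) (differential B \<tau> x) (differential B \<tau> y) = g p x y))"

text \<open>The second fundamental form of the fibres vanishes.\<close>

definition totally_geodesic_fibres :: "('a::topological_space, 'e::euclidean_space) chart set \<Rightarrow>
    ('a vfield \<Rightarrow> 'a vfield \<Rightarrow> 'a vfield) \<Rightarrow> ('b::topological_space, 'f::euclidean_space) chart set \<Rightarrow>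
    ('a \<Rightarrow> 'b) \<Rightarrow> bool" where
  "totally_geodesic_fibres A D B \<tau> \<longleftrightarrow>
     (\<forall>X\<in>vector_fields A. \<forall>Y\<in>vector_fields A.
        (\<forall>p. X p \<in> vertical_space A B \<tau> p) \<longrightarrow> (\<forall>p. Y p \<in> vertical_space A B \<tau> p) \<longrightarrow>
        (\<forall>p. D X Y p \<in> vertical_space A B \<tau> p))"

definition perp :: "('a::topological_space, 'e::euclidean_space) chart set \<Rightarrow> 'a metric \<Rightarrow> 'a \<Rightarrow>
    'a tvec \<Rightarrow> 'a tvec set" where
  "perp A g p z = {x\<in>tangent_space A p. g p x z = 0}"

definition jacobi :: "('a::topological_space, 'e::euclidean_space) chart set \<Rightarrow>
    ('a vfield \<Rightarrow> 'a vfield \<Rightarrow> 'a vfield) \<Rightarrow> 'a \<Rightarrow> 'a tvec \<Rightarrow> 'a tvec \<Rightarrow> 'a tvec" where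
  "jacobi A D p z y = curvature_at A D p y z z"

definition eigenvector_on :: "'v::real_vector set \<Rightarrow> ('v \<Rightarrow> 'v) \<Rightarrow> 'v \<Rightarrow> bool" where
  "eigenvector_on V T v \<longleftrightarrow> v \<in> V \<and> v \<noteq> 0 \<and> (\<exists>c. T v = c *\<^sub>R v)"

text \<open>Elements of \<open>V / span {u}\<close> are cosets; operations on the quotient are defined through
  arbitrary representatives.\<close>

definition coset :: "'v::real_vector \<Rightarrow> 'v \<Rightarrow> 'v set" where
  "coset u x = {x + y | y. y \<in> span {u}}"

definition quot_space :: "'v::real_vector \<Rightarrow> 'v set \<Rightarrow> 'v set set" where
  "quot_space u V = coset u ` V"

definition quot_map :: "'v::real_vector \<Rightarrow> ('v \<Rightarrow> 'v) \<Rightarrow> 'v set \<Rightarrow> 'v set" where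
  "quot_map u T C = (\<Union>x\<in>C. coset u (T x))"

text \<open>\<open>quot_dim u E = k\<close> iff some \<open>b\<^sub>0, \<dots>, b\<^sub>k\<^sub>-\<^sub>1\<close> have cosets forming a basis of \<open>E\<close>, i.e.
  \<open>\<real>\<^sup>k \<rightarrow> E\<close>, \<open>c \<mapsto> \<Sum>\<^sub>i c\<^sub>i [b\<^sub>i]\<close> is bijective.\<close>

definition quot_dim :: "'v::real_vector \<Rightarrow> 'v set set \<Rightarrow> nat" where
  "quot_dim u E = (THE k. \<exists>b :: nat \<Rightarrow> 'v.
     bij_betw (\<lambda>c. coset u (\<Sum>i<k. c i *\<^sub>R b i)) {c :: nat \<Rightarrow> real. \<forall>i\<ge>k. c i = 0} E)"

text \<open>The operator induced by \<open>R\<^sub>p(\<cdot>, u) u\<close> on \<open>u\<^sup>\<bottom> / span {u}\<close>, and the multiplicity of a real number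
  as an eigenvalue of it (0 for non-eigenvalues). As the operator is self-adjoint for a positive
  definite inner product, its eigenvalues are real and geometric and algebraic multiplicities agree.\<close>

definition null_jacobi :: "('a::topological_space, 'e::euclidean_space) chart set \<Rightarrow>
    ('a vfield \<Rightarrow> 'a vfield \<Rightarrow> 'a vfield) \<Rightarrow> 'a \<Rightarrow> 'a tvec \<Rightarrow> 'a tvec set \<Rightarrow> 'a tvec set" where
  "null_jacobi A D p u = quot_map u (jacobi A D p u)"

definition null_jacobi_mult :: "('a::topological_space, 'e::euclidean_space) chart set \<Rightarrow> 'a metric \<Rightarrow>
    ('a vfield \<Rightarrow> 'a vfield \<Rightarrow> 'a vfield) \<Rightarrow> 'a \<Rightarrow> 'a tvec \<Rightarrow> real \<Rightarrow> nat" where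
  "null_jacobi_mult A g D p u c = quot_dim u
     {C \<in> quot_space u (perp A g p u). null_jacobi A D p u C = quot_map u (\<lambda>x. c *\<^sub>R x) C}"

definition null_congruence :: "('a::topological_space, 'e::euclidean_space) chart set \<Rightarrow> 'a metric \<Rightarrow>
    'a \<Rightarrow> 'a tvec \<Rightarrow> 'a tvec set" where
  "null_congruence A g p z = {u\<in>tangent_space A p. g p u u = 0 \<and> g p u z = -1}"

definition unit_sphere :: "('a::topological_space, 'e::euclidean_space) chart set \<Rightarrow> 'a metric \<Rightarrow>
    'a \<Rightarrow> 'a tvec \<Rightarrow> 'a tvec set" where
  "unit_sphere A g p z = {x\<in>perp A g p z. g p x x = 1}"

definition phi_sphere :: "('a::topological_space, 'e::euclidean_space) chart set \<Rightarrow> 'a metric \<Rightarrow>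
    ('a \<Rightarrow> 'a tvec \<Rightarrow> 'a tvec) \<Rightarrow> 'a \<Rightarrow> 'a tvec \<Rightarrow> 'a tvec set" where
  "phi_sphere A g \<phi> p z = unit_sphere A g p z \<inter> \<phi> p ` tangent_space A p"

definition phi_null_congruence :: "('a::topological_space, 'e::euclidean_space) chart set \<Rightarrow> 'a metric \<Rightarrow>
    ('a \<Rightarrow> 'a tvec \<Rightarrow> 'a tvec) \<Rightarrow> 'a \<Rightarrow> 'a tvec \<Rightarrow> 'a tvec set" where
  "phi_null_congruence A g \<phi> p z = {u\<in>null_congruence A g p z. u - z \<in> phi_sphere A g \<phi> p z}"

definition null_osserman :: "('a::topological_space, 'e::euclidean_space) chart set \<Rightarrow> 'a metric \<Rightarrow>
    ('a vfield \<Rightarrow> 'a vfield \<Rightarrow> 'a vfield) \<Rightarrow> 'a \<Rightarrow> 'a tvec \<Rightarrow> bool" where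
  "null_osserman A g D p z \<longleftrightarrow>
     (\<forall>u\<in>null_congruence A g p z. \<forall>v\<in>null_congruence A g p z. \<forall>c.
        null_jacobi_mult A g D p u c = null_jacobi_mult A g D p v c)"

definition phi_null_osserman :: "('a::topological_space, 'e::euclidean_space) chart set \<Rightarrow> 'a metric \<Rightarrow>
    ('a vfield \<Rightarrow> 'a vfield \<Rightarrow> 'a vfield) \<Rightarrow> ('a \<Rightarrow> 'a tvec \<Rightarrow> 'a tvec) \<Rightarrow> 'a \<Rightarrow> 'a tvec \<Rightarrow> bool" where
  "phi_null_osserman A g D \<phi> p z \<longleftrightarrow>
     (\<forall>u\<in>phi_null_congruence A g \<phi> p z. \<forall>v\<in>phi_null_congruence A g \<phi> p z. \<forall>c.
        null_jacobi_mult A g D p u c = null_jacobi_mult A g D p v c)"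

end

theory Submission
  imports Defs
begin

text \<open>Write a null vector of the congruence as \<open>u = \<xi>\<^sub>1 + x\<close> with \<open>x\<close> a unit vector of \<open>Im \<phi>\<close>. The
  quotient \<open>u\<^sup>\<bottom> / u\<close> is represented by the orthogonal complement of \<open>\<xi>\<^sub>1\<close> and \<open>x\<close>, which splits as
  \<open>E \<oplus> span(\<xi>\<^sub>2, \<dots>, \<xi>\<^sub>s)\<close> with \<open>E\<close> the complement of \<open>x\<close> in \<open>Im \<phi>\<close>. The identity
  \<open>R(X, Y) \<xi>\<^sub>\<alpha> = \<epsilon>\<^sub>\<alpha> (\<eta>~(X) \<phi>\<^sup>2 Y - \<eta>~(Y) \<phi>\<^sup>2 X)\<close>, \<open>\<eta>~ = \<Sum>\<^sub>\<alpha> \<epsilon>\<^sub>\<alpha> \<eta>\<^sup>\<alpha>\<close>, shows that the operator of \<open>u\<close> preserves this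
  splitting, that its part on the second summand does not depend on \<open>x\<close>, and that it acts on \<open>E\<close> as
  \<open>R\<^sub>x + I\<close>. On the base the same space \<open>E\<close> carries, by O'Neill's formula, the operator
  \<open>R\<^sub>x + I + 3 (s - 1) g(\<cdot>, \<phi> x) \<phi> x\<close>. As \<open>\<phi> x\<close> is an eigenvector of \<open>R\<^sub>x\<close>, the two spectra differ only in that
  the eigenvalue of \<open>\<phi> x\<close> is shifted by the constant \<open>3 (s - 1)\<close>. If either spectrum is independent of \<open>x\<close>,
  this eigenvalue is a continuous function of \<open>x\<close> with finitely many values, hence constant along great
  circles, and then the other spectrum is independent of \<open>x\<close> as well.\<close>

section \<open>Smooth functions on Euclidean spaces\<close>

text \<open>Behind the curvature identity stand two facts: every characteristic field is Killing,
  and its covariant derivative is a constant multiple of \<phi>. Curvature on it thus reduces to the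
  covariant derivative of \<phi>, for which normality and d\<eta> = \<Phi> give a closed formula.
  The factor 3 (s - 1) arises because the s - 1 vertical fields have the same covariant derivative:
  O'Neill's tensor has the component g(\<phi> X, Y) along each of them. The obstacle in the last
  step is that a spectrum independent of x does not tell which of its values belongs to \<phi> x;
  that eigenvalue might change places with another one as x varies, and shifting it would then alter
  the second spectrum in different ways. A second obstacle is that tangent vectors are derivations
  in an unrestricted function space. Their dimension is read off the data: the Lorentzian metric
  supplies a finite basis, and the splitting into image and kernel of \<phi> supplies the number 2n
  + s. On this rest the spanning property of coordinate fields, the extension of tangent vectors to
  fields, and curvature at a point.\<close>

lemma Ck_on_cong:
  assumes "open S" "\<And>x. x \<in> S \<Longrightarrow> f x = g x"
  shows "Ck_on k S f = Ck_on k S g"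
proof -
  have "Ck_on k S g" if "Ck_on k S f" "\<And>x. x \<in> S \<Longrightarrow> f x = g x" for f g
    using that
  proof (induction k arbitrary: f g)
    case 0
    then show ?case by (simp cong: continuous_on_cong)
  next
    case (Suc k)
    have fd: "f differentiable (at x)" if "x \<in> S" for x
      using Suc.prems(1) that by simp
    have gd: "g differentiable (at x)" if "x \<in> S" for x
      using fd[OF that] that assms(1) Suc.prems(2) unfolding differentiable_def
      by (meson has_derivative_transform_within_open)
    have eq: "frechet_derivative f (at x) = frechet_derivative g (at x)" if "x \<in> S" for x
      by (rule frechet_derivative_transform_within_open[OF fd assms(1)]) (use that Suc.prems(2) in auto)
    have "Ck_on k S (\<lambda>x. frechet_derivative g (at x) v)" for v
      by (rule Suc.IH[of "\<lambda>x. frechet_derivative f (at x) v"]) (use Suc.prems(1) eq in auto)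
    then show ?case using gd by simp
  qed
  from this[of f g] this[of g f] assms(2) show ?thesis by auto
qed

lemma smooth_on_cong:
  assumes "open S" "\<And>x. x \<in> S \<Longrightarrow> f x = g x"
  shows "smooth_on S f = smooth_on S g"
  using Ck_on_cong[OF assms] by (simp add: smooth_on_def)

lemma Ck_on_SucD: "Ck_on (Suc k) S f \<Longrightarrow> Ck_on k S f"
proof (induction k arbitrary: f)
  case 0
  then show ?case
    by (auto intro!: continuous_at_imp_continuous_on differentiable_imp_continuous_within)
next
  case (Suc k)
  then show ?case by (metis Ck_on.simps(2))
qed

lemma Ck_on_subset: "Ck_on k S f \<Longrightarrow> T \<subseteq> S \<Longrightarrow> Ck_on k T f"
  by (induction k arbitrary: f) (auto intro: continuous_on_subset)

lemma smooth_on_subset: "smooth_on S f \<Longrightarrow> T \<subseteq> S \<Longrightarrow> smooth_on T f"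
  unfolding smooth_on_def using Ck_on_subset by blast

lemma Ck_on_Union:
  assumes "\<And>S. S \<in> C \<Longrightarrow> open S" "\<And>S. S \<in> C \<Longrightarrow> Ck_on k S f"
  shows "Ck_on k (\<Union>C) f"
  using assms(2)
proof (induction k arbitrary: f)
  case 0
  then show ?case using assms(1) by (auto intro: continuous_on_open_Union)
qed auto

lemma smooth_on_local:
  assumes "\<And>x. x \<in> S \<Longrightarrow> \<exists>U. open U \<and> x \<in> U \<and> smooth_on U f"
  shows "smooth_on S f"
proof -
  obtain U where U: "\<And>x. x \<in> S \<Longrightarrow> open (U x) \<and> x \<in> U x \<and> smooth_on (U x) f"
    using assms by metis
  have "Ck_on k (\<Union>(U ` S)) f" for k
    by (rule Ck_on_Union) (use U in \<open>auto simp: smooth_on_def\<close>)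
  moreover have "S \<subseteq> \<Union>(U ` S)" using U by auto
  ultimately show ?thesis unfolding smooth_on_def using Ck_on_subset by blast
qed

lemma smooth_on_imp_continuous_on: "smooth_on S f \<Longrightarrow> continuous_on S f"
  unfolding smooth_on_def by (metis Ck_on.simps(1))

lemma smooth_on_imp_differentiable: "smooth_on S f \<Longrightarrow> x \<in> S \<Longrightarrow> f differentiable (at x)"
  unfolding smooth_on_def by (metis Ck_on.simps(2))

lemma smooth_on_frechet_derivative:
  "smooth_on S f \<Longrightarrow> smooth_on S (\<lambda>x. frechet_derivative f (at x) v)"
  unfolding smooth_on_def by (metis Ck_on.simps(2))

lemma frechet_derivative_eqI: "(f has_derivative F) (at x) \<Longrightarrow> frechet_derivative f (at x) = F"
  by (metis frechet_derivative_at)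

lemma frechet_hd: "f differentiable (at x) \<Longrightarrow> (f has_derivative frechet_derivative f (at x)) (at x)"
  using frechet_derivative_works by blast

lemma Ck_on_const: "Ck_on k S (\<lambda>x. c)"
  by (induction k arbitrary: c) auto

lemma smooth_on_const: "smooth_on S (\<lambda>x. c)"
  by (simp add: smooth_on_def Ck_on_const)

lemma Ck_on_add:
  assumes "open S" "Ck_on k S f" "Ck_on k S g"
  shows "Ck_on k S (\<lambda>x. f x + g x)"
  using assms(2,3)
proof (induction k arbitrary: f g)
  case 0
  then show ?case by (auto intro: continuous_intros)
next
  case (Suc k)
  have d: "((\<lambda>x. f x + g x) has_derivative
      (\<lambda>v. frechet_derivative f (at x) v + frechet_derivative g (at x) v)) (at x)" if "x \<in> S" for x
    by (intro has_derivative_add frechet_hd) (use Suc.prems that in auto)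
  have "Ck_on k S (\<lambda>x. frechet_derivative (\<lambda>x. f x + g x) (at x) v)" for v
    by (subst Ck_on_cong[OF assms(1), where g="\<lambda>x. frechet_derivative f (at x) v + frechet_derivative g (at x) v"])
      (use Suc frechet_derivative_eqI[OF d] in auto)
  then show ?case using d by (auto simp: differentiable_def)
qed

lemma Ck_on_scaleR:
  fixes f :: "'e::euclidean_space \<Rightarrow> real" and g :: "'e \<Rightarrow> 'f::real_normed_vector"
  assumes "open S" "Ck_on k S f" "Ck_on k S g"
  shows "Ck_on k S (\<lambda>x. f x *\<^sub>R g x)"
  using assms(2,3)
proof (induction k arbitrary: f g)
  case 0
  then show ?case by (auto intro: continuous_intros)
next
  case (Suc k)
  have d: "((\<lambda>x. f x *\<^sub>R g x) has_derivative
      (\<lambda>v. f x *\<^sub>R frechet_derivative g (at x) v + frechet_derivative f (at x) v *\<^sub>R g x)) (at x)"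
    if "x \<in> S" for x
    by (intro has_derivative_scaleR frechet_hd) (use Suc.prems that in auto)
  have "Ck_on k S f" "Ck_on k S g" using Suc.prems Ck_on_SucD by auto
  then have "Ck_on k S (\<lambda>x. f x *\<^sub>R frechet_derivative g (at x) v + frechet_derivative f (at x) v *\<^sub>R g x)" for v
    by (intro Ck_on_add assms Suc.IH) (use Suc.prems in auto)
  then have "Ck_on k S (\<lambda>x. frechet_derivative (\<lambda>x. f x *\<^sub>R g x) (at x) v)" for v
    by (subst Ck_on_cong[OF assms(1)]) (use frechet_derivative_eqI[OF d] in auto)
  then show ?case using d by (auto simp: differentiable_def)
qed

lemma Ck_on_bounded_linear:
  assumes "open S" "bounded_linear L" "Ck_on k S f"
  shows "Ck_on k S (\<lambda>x. L (f x))"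
  using assms(3)
proof (induction k arbitrary: f)
  case 0
  then show ?case using bounded_linear.continuous_on[OF assms(2)] by auto
next
  case (Suc k)
  have d: "((\<lambda>x. L (f x)) has_derivative (\<lambda>v. L (frechet_derivative f (at x) v))) (at x)"
    if "x \<in> S" for x
    by (intro bounded_linear.has_derivative[OF assms(2)] frechet_hd) (use Suc.prems that in auto)
  have "Ck_on k S (\<lambda>x. L (frechet_derivative f (at x) v))" for v
    by (intro Suc.IH) (use Suc.prems in auto)
  then have "Ck_on k S (\<lambda>x. frechet_derivative (\<lambda>x. L (f x)) (at x) v)" for v
    by (subst Ck_on_cong[OF assms(1)]) (use frechet_derivative_eqI[OF d] in auto)
  then show ?case using d by (auto simp: differentiable_def)
qed

lemma Ck_on_sum:
  assumes "open S" "\<And>i. i \<in> I \<Longrightarrow> Ck_on k S (f i)"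
  shows "Ck_on k S (\<lambda>x. \<Sum>i\<in>I. f i x)"
  using assms(2)
  by (induction I rule: infinite_finite_induct) (auto intro: Ck_on_add[OF assms(1)] Ck_on_const)

lemma Ck_on_compose:
  fixes f :: "'e::euclidean_space \<Rightarrow> 'f::euclidean_space" and g :: "'f \<Rightarrow> 'h::real_normed_vector"
  assumes "open S" "open T" "f ` S \<subseteq> T" "Ck_on k S f" "Ck_on k T g"
  shows "Ck_on k S (\<lambda>x. g (f x))"
  using assms(4,5)
proof (induction k arbitrary: g)
  case 0
  then show ?case using assms(3) by (auto intro: continuous_on_compose2)
next
  case (Suc k)
  have gd: "g differentiable (at (f x))" if "x \<in> S" for x using Suc.prems(2) that assms(3) by auto
  have d: "((\<lambda>x. g (f x)) has_derivative
      (\<lambda>v. frechet_derivative g (at (f x)) (frechet_derivative f (at x) v))) (at x)"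
    if "x \<in> S" for x
    by (rule has_derivative_compose[OF frechet_hd frechet_hd]) (use Suc.prems that gd in auto)
  \<comment> \<open>The direction in which \<open>g\<close> is differentiated varies with
    \<open>x\<close>, whereas \<open>Ck_on\<close> speaks of fixed directions; the expansion in
    \<open>Basis\<close> moves the variation into scalar coefficients.\<close>
  have eq: "frechet_derivative g (at (f x)) (frechet_derivative f (at x) v) =
      (\<Sum>b\<in>Basis. (frechet_derivative f (at x) v \<bullet> b) *\<^sub>R frechet_derivative g (at (f x)) b)"
    if "x \<in> S" for x v
  proof -
    interpret linear "frechet_derivative g (at (f x))"
      using gd[OF that] by (rule linear_frechet_derivative)
    show ?thesis by (subst (1) euclidean_representation[symmetric]) (simp add: sum scale)
  qed
  have cf: "Ck_on k S f" using Suc.prems(1) by (rule Ck_on_SucD)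
  have "Ck_on k S (\<lambda>x. \<Sum>b\<in>Basis. (frechet_derivative f (at x) v \<bullet> b) *\<^sub>R frechet_derivative g (at (f x)) b)" for v
    by (intro Ck_on_sum Ck_on_scaleR assms Ck_on_bounded_linear[OF _ bounded_linear_inner_left] Suc.IH cf)
      (use Suc.prems in auto)
  then have "Ck_on k S (\<lambda>x. frechet_derivative (\<lambda>x. g (f x)) (at x) v)" for v
    by (subst Ck_on_cong[OF assms(1)]) (use frechet_derivative_eqI[OF d] eq in auto)
  then show ?case using d by (auto simp: differentiable_def)
qed

text \<open>The derivative of 1 / f contains 1 / f again, but only to the lower order, so the
  induction hypothesis and the product rule close the step.\<close>

lemma Ck_on_inverse:
  fixes f :: "'e::euclidean_space \<Rightarrow> real"
  assumes "open S" "\<And>x. x \<in> S \<Longrightarrow> f x \<noteq> 0" "Ck_on k S f"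
  shows "Ck_on k S (\<lambda>x. inverse (f x))"
  using assms(3)
proof (induction k)
  case 0
  then show ?case using assms(2) by (auto intro: continuous_intros)
next
  case (Suc k)
  have d: "((\<lambda>x. inverse (f x)) has_derivative
      (\<lambda>v. ((-1) *\<^sub>R frechet_derivative f (at x) v) *\<^sub>R inverse (f x) *\<^sub>R inverse (f x))) (at x)"
    if "x \<in> S" for x
    by (rule has_derivative_eq_rhs[OF Deriv.has_derivative_inverse[OF _ frechet_hd]])
      (use Suc.prems that assms(2) in auto)
  have i: "Ck_on k S (\<lambda>x. inverse (f x))" using Suc Ck_on_SucD by blast
  have "Ck_on k S (\<lambda>x. ((-1) *\<^sub>R frechet_derivative f (at x) v) *\<^sub>R inverse (f x) *\<^sub>R inverse (f x))" for v
    by (intro Ck_on_scaleR assms Ck_on_const i) (use Suc.prems in auto)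
  then have "Ck_on k S (\<lambda>x. frechet_derivative (\<lambda>x. inverse (f x)) (at x) v)" for v
    by (subst Ck_on_cong[OF assms(1)]) (use frechet_derivative_eqI[OF d] in auto)
  then show ?case using d by (auto simp: differentiable_def)
qed

lemma smooth_on_add: "open S \<Longrightarrow> smooth_on S f \<Longrightarrow> smooth_on S g \<Longrightarrow> smooth_on S (\<lambda>x. f x + g x)"
  by (simp add: smooth_on_def Ck_on_add)

lemma smooth_on_sum:
  "open S \<Longrightarrow> (\<And>i. i \<in> I \<Longrightarrow> smooth_on S (f i)) \<Longrightarrow> smooth_on S (\<lambda>x. \<Sum>i\<in>I. f i x)"
  unfolding smooth_on_def by (intro allI Ck_on_sum) simp_all

lemma smooth_on_mult:
  fixes f g :: "'e::euclidean_space \<Rightarrow> real"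
  shows "open S \<Longrightarrow> smooth_on S f \<Longrightarrow> smooth_on S g \<Longrightarrow> smooth_on S (\<lambda>x. f x * g x)"
  using Ck_on_scaleR[of S _ f g] by (simp add: smooth_on_def)

lemma smooth_on_inverse:
  fixes f :: "'e::euclidean_space \<Rightarrow> real"
  shows "open S \<Longrightarrow> (\<And>x. x \<in> S \<Longrightarrow> f x \<noteq> 0) \<Longrightarrow> smooth_on S f \<Longrightarrow> smooth_on S (\<lambda>x. inverse (f x))"
  by (simp add: smooth_on_def Ck_on_inverse)

lemma smooth_on_compose:
  fixes f :: "'e::euclidean_space \<Rightarrow> 'f::euclidean_space" and g :: "'f \<Rightarrow> 'h::real_normed_vector"
  assumes "open S" "open T" "f ` S \<subseteq> T" "smooth_on S f" "smooth_on T g"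
  shows "smooth_on S (\<lambda>x. g (f x))"
  unfolding smooth_on_def
proof
  fix k show "Ck_on k S (\<lambda>x. g (f x))"
    by (rule Ck_on_compose[OF assms(1-3)]) (use assms(4,5) in \<open>auto simp only: smooth_on_def\<close>)
qed

lemma Ck_on_linear:
  assumes "bounded_linear L" shows "Ck_on k S L"
proof (cases k)
  case (Suc m)
  have "(L has_derivative L) (at x)" for x using assms by (rule bounded_linear_imp_has_derivative)
  then show ?thesis unfolding Suc
    by (auto simp: differentiable_def frechet_derivative_eqI[OF \<open>\<And>x. (L has_derivative L) (at x)\<close>] Ck_on_const)
qed (auto simp: linear_continuous_on assms)

lemma smooth_on_linear: "bounded_linear L \<Longrightarrow> smooth_on S L"
  by (simp add: smooth_on_def Ck_on_linear)

text \<open>This family is closed under differentiation up to linear combinations, so that smoothness of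
  all its members is a single induction.\<close>

definition flat :: "nat \<Rightarrow> real \<Rightarrow> real" where
  "flat m t = (if t > 0 then inverse t ^ m * exp (- inverse t) else 0)"

lemma flat_tendsto_0: "(flat m \<longlongrightarrow> 0) (at 0)"
proof (rule filterlim_split_at)
  show "(flat m \<longlongrightarrow> 0) (at_left 0)"
    by (rule tendsto_eventually) (auto simp: eventually_at_filter flat_def)
  have "((\<lambda>t. inverse t ^ m / exp (inverse t :: real)) \<longlongrightarrow> 0) (at_right 0)"
    using filterlim_compose[OF tendsto_power_div_exp_0 filterlim_inverse_at_top_right] .
  then show "(flat m \<longlongrightarrow> 0) (at_right 0)"
    by (rule Lim_transform_eventually) (auto simp: eventually_at_filter flat_def exp_minus divide_inverse)
qed

lemma flat_deriv: "(flat m has_real_derivative flat (m + 2) t - real m * flat (m + 1) t) (at t)"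
proof -
  consider "t > 0" | "t < 0" | "t = 0" by linarith
  then show ?thesis
  proof cases
    case 1
    have "((\<lambda>t. inverse t ^ m * exp (- inverse t)) has_real_derivative
        inverse t ^ (m + 2) * exp (- inverse t) - real m * (inverse t ^ (m + 1) * exp (- inverse t))) (at t)"
      using 1
      by (auto intro!: derivative_eq_intros simp: power2_eq_square)
        (cases m; simp add: field_simps)
    then have "(flat m has_real_derivative
        inverse t ^ (m + 2) * exp (- inverse t) - real m * (inverse t ^ (m + 1) * exp (- inverse t))) (at t)"
      by (rule has_field_derivative_transform_within_open[where S="{0<..}"])
        (use 1 in \<open>auto simp: flat_def\<close>)
    then show ?thesis using 1 by (simp add: flat_def)
  next
    case 2
    have "((\<lambda>t. 0) has_real_derivative 0) (at t)" by simp
    then have "(flat m has_real_derivative 0) (at t)"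
      by (rule has_field_derivative_transform_within_open[where S="{..<0}"])
        (use 2 in \<open>auto simp: flat_def\<close>)
    then show ?thesis using 2 by (simp add: flat_def)
  next
    case 3
    \<comment> \<open>The difference quotient at 0 is again a member of the family, so the limit
      lemma applies to it.\<close>
    have "(\<lambda>h. (flat m (0 + h) - flat m 0) / h) = flat (m + 1)"
      by (auto simp: flat_def fun_eq_iff divide_inverse)
    then show ?thesis using flat_tendsto_0[of "m + 1"] 3
      by (simp add: DERIV_def flat_def)
  qed
qed

lemma smooth_on_flat: "smooth_on S (flat m)"
proof -
  have "Ck_on k UNIV (flat m)" for k m
  proof (induction k arbitrary: m)
    case 0
    then show ?case
      using DERIV_isCont[OF flat_deriv] by (auto intro: continuous_at_imp_continuous_on)
  next
    case (Suc k)
    have d: "(flat m has_derivative (*) (flat (m + 2) t - real m * flat (m + 1) t)) (at t)" for t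
      using flat_deriv by (simp add: has_field_derivative_def)
    have "Ck_on k UNIV (\<lambda>t. v *\<^sub>R (flat (m + 2) t + (- real m) *\<^sub>R flat (m + 1) t))" for v
      by (intro Ck_on_scaleR Ck_on_add Ck_on_const Suc.IH open_UNIV)
    then show ?case using d
      by (auto simp: differentiable_def frechet_derivative_eqI[OF d] algebra_simps)
  qed
  then show ?thesis by (meson Ck_on_subset smooth_on_def subset_UNIV)
qed

lemma euclidean_bump:
  fixes a :: "'e::euclidean_space"
  assumes "r > 0"
  obtains b :: "'e \<Rightarrow> real" where "smooth_on UNIV b" "\<And>x. x \<in> ball a r \<Longrightarrow> b x = 1"
    "\<And>x. x \<notin> ball a (2 * r) \<Longrightarrow> b x = 0"
proof -
  define q where "q = (\<lambda>x::'e. (x - a) \<bullet> (x - a))"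
  have q: "q x = (dist a x)\<^sup>2" for x
    by (metis q_def dist_commute dist_norm power2_norm_eq_inner)
  \<comment> \<open>As a polynomial in the coordinates the squared distance falls under the closure
    rules for sums and products.\<close>
  have q2: "q = (\<lambda>x. \<Sum>b\<in>Basis. (x \<bullet> b + - (a \<bullet> b)) * (x \<bullet> b + - (a \<bullet> b)))"
    unfolding q_def by (subst euclidean_inner) (simp add: inner_diff_left)
  have sq: "smooth_on UNIV q"
    unfolding q2
    by (intro smooth_on_sum smooth_on_mult smooth_on_add smooth_on_const open_UNIV
        smooth_on_linear[OF bounded_linear_inner_left])
  \<comment> \<open>\<open>u\<close> is positive exactly on the ball of radius 2 r, and
    \<open>w\<close> exactly outside the closed ball of radius r. These regions cover the space, so
    u / (u + w) has a nowhere vanishing denominator.\<close>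
  define u where "u = (\<lambda>x. flat 0 (4 * r\<^sup>2 + (-1) * q x))"
  define w where "w = (\<lambda>x. flat 0 (q x + - r\<^sup>2))"
  have su: "smooth_on UNIV u" unfolding u_def
    by (rule smooth_on_compose[OF open_UNIV open_UNIV subset_UNIV _ smooth_on_flat])
      (intro smooth_on_add smooth_on_mult smooth_on_const sq open_UNIV)
  have sw: "smooth_on UNIV w" unfolding w_def
    by (rule smooth_on_compose[OF open_UNIV open_UNIV subset_UNIV _ smooth_on_flat])
      (intro smooth_on_add smooth_on_mult smooth_on_const sq open_UNIV)
  have fp: "flat 0 t > 0 \<longleftrightarrow> t > 0" "flat 0 t \<ge> 0" for t by (auto simp: flat_def)
  have pos: "u x + w x \<noteq> 0" for x
  proof -
    have "4 * r\<^sup>2 + (-1) * q x > 0 \<or> q x + - r\<^sup>2 > 0" using assms by (smt (verit) zero_less_power)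
    then have "u x > 0 \<or> w x > 0" by (simp add: u_def w_def fp)
    moreover have "u x \<ge> 0" "w x \<ge> 0" by (auto simp: u_def w_def fp)
    ultimately show ?thesis by linarith
  qed
  show ?thesis
  proof
    show "smooth_on UNIV (\<lambda>x. u x * inverse (u x + w x))"
      by (intro smooth_on_mult smooth_on_inverse smooth_on_add su sw pos open_UNIV)
    show "u x * inverse (u x + w x) = 1" if "x \<in> ball a r" for x
    proof -
      have "(dist a x)\<^sup>2 < r\<^sup>2" using that assms by (intro power_strict_mono) auto
      then have "w x = 0" by (simp add: w_def q flat_def)
      then show ?thesis using pos[of x] by simp
    qed
    show "u x * inverse (u x + w x) = 0" if "x \<notin> ball a (2 * r)" for x
    proof -
      have "(2 * r)\<^sup>2 \<le> (dist a x)\<^sup>2" using that assms by (intro power_mono) auto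
      then have "u x = 0" by (simp add: u_def q flat_def power_mult_distrib)
      then show ?thesis by simp
    qed
  qed
qed

section \<open>Functions, vector fields and coordinates on manifolds\<close>

lemma sum_fun_apply: "(\<Sum>i\<in>I. f i) x = (\<Sum>i\<in>I. f i x)"
  by (induction I rule: infinite_finite_induct) auto

lemma subspace_tangent_space: "subspace (tangent_space A p)"
  unfolding subspace_def tangent_space_def
  by (auto simp: scaleR_fun_def algebra_simps)

lemma tangent_space_sum:
  "(\<And>i. i \<in> I \<Longrightarrow> v i \<in> tangent_space A p) \<Longrightarrow> (\<Sum>i\<in>I. c i *\<^sub>R v i) \<in> tangent_space A p"
  by (intro subspace_sum subspace_tangent_space subspace_scale)

lemmas tangent_add = subspace_add[OF subspace_tangent_space]
  and tangent_diff = subspace_diff[OF subspace_tangent_space]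
  and tangent_neg = subspace_neg[OF subspace_tangent_space]
  and tangent_scale = subspace_scale[OF subspace_tangent_space]
  and tangent_0 = subspace_0[OF subspace_tangent_space]

lemma tangent_addF: "v \<in> tangent_space A p \<Longrightarrow> smooth_fun A f \<Longrightarrow> smooth_fun A h \<Longrightarrow>
    v (\<lambda>x. f x + h x) = v f + v h"
  and tangent_multF: "v \<in> tangent_space A p \<Longrightarrow> smooth_fun A f \<Longrightarrow> smooth_fun A h \<Longrightarrow>
    v (\<lambda>x. f x * h x) = f p * v h + h p * v f"
  and tangent_cmultF: "v \<in> tangent_space A p \<Longrightarrow> smooth_fun A f \<Longrightarrow> v (\<lambda>x. c * f x) = c * v f"
  and tangent_nonsmooth: "v \<in> tangent_space A p \<Longrightarrow> \<not> smooth_fun A f \<Longrightarrow> v f = 0"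
  unfolding tangent_space_def by auto

lemma smooth_fun_iff_charts:
  "smooth_fun A f \<longleftrightarrow> continuous_on UNIV f \<and> (\<forall>c\<in>A. smooth_on (snd c ` fst c) (f \<circ> chart_inv c))"
  by (simp add: smooth_fun_def smooth_map_on_def eucl_def)

locale atlas =
  fixes A :: "('a::t2_space, 'e::euclidean_space) chart set"
  assumes atlas: "is_atlas A"
begin

lemma chart: "c \<in> A \<Longrightarrow> is_chart c"
  using atlas by (simp add: is_atlas_def)

lemma chart_at: obtains c where "c \<in> A" "p \<in> fst c"
  using atlas unfolding is_atlas_def by blast

lemma open_chart: "c \<in> A \<Longrightarrow> open (fst c)" "c \<in> A \<Longrightarrow> open (snd c ` fst c)"
  using chart by (auto simp: is_chart_def)

lemma chart_homeo: "c \<in> A \<Longrightarrow> homeomorphism (fst c) (snd c ` fst c) (snd c) (chart_inv c)"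
  using chart by (auto simp: is_chart_def)

lemma chart_inv_left: "c \<in> A \<Longrightarrow> q \<in> fst c \<Longrightarrow> chart_inv c (snd c q) = q"
  using chart_homeo by (auto simp: homeomorphism_def)

lemma open_chart_image:
  assumes "c \<in> A" "open U" "U \<subseteq> fst c" shows "open (snd c ` U)"
proof -
  have "openin (top_of_set (fst c)) U" using assms by (simp add: openin_open_eq open_chart)
  then have "openin (top_of_set (snd c ` fst c)) (snd c ` U)"
    by (rule homeomorphism_imp_open_map[OF chart_homeo[OF assms(1)]])
  then show ?thesis using open_chart[OF assms(1)] by (simp add: openin_open_eq)
qed

lemma open_chart_inv_image:
  assumes "c \<in> A" "open U" "U \<subseteq> snd c ` fst c" shows "open (chart_inv c ` U)"
proof -
  have "openin (top_of_set (snd c ` fst c)) U" using assms by (simp add: openin_open_eq open_chart)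
  then have "openin (top_of_set (fst c)) (chart_inv c ` U)"
    using homeomorphism_imp_open_map homeomorphism_symD[OF chart_homeo[OF assms(1)]] by blast
  then show ?thesis using open_chart[OF assms(1)] by (simp add: openin_open_eq)
qed

lemma continuous_on_chart: "c \<in> A \<Longrightarrow> continuous_on (fst c) (snd c)"
  using chart_homeo homeomorphism_def by blast

lemma continuous_on_chart_inv: "c \<in> A \<Longrightarrow> continuous_on (snd c ` fst c) (chart_inv c)"
  using chart_homeo homeomorphism_def by blast

lemma smooth_transition:
  "c \<in> A \<Longrightarrow> d \<in> A \<Longrightarrow> smooth_on (snd c ` (fst c \<inter> fst d)) (snd d \<circ> chart_inv c)"
  using atlas by (simp add: is_atlas_def)

lemma continuous_on_chartsI:
  assumes "\<And>c. c \<in> A \<Longrightarrow> continuous_on (snd c ` fst c) (f \<circ> chart_inv c)"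
  shows "continuous_on UNIV (f :: 'a \<Rightarrow> real)"
proof -
  have "continuous_on (\<Union>(fst ` A)) f"
  proof (rule continuous_on_open_Union)
    fix S assume "S \<in> fst ` A"
    then obtain c where c: "c \<in> A" "S = fst c" by auto
    have "continuous_on (fst c) ((f \<circ> chart_inv c) \<circ> snd c)"
      by (intro continuous_on_compose continuous_on_chart assms c)
    then show "continuous_on S f"
      unfolding c by (rule continuous_on_eq) (simp add: chart_inv_left c)
  qed (use open_chart in blast)
  moreover have "\<Union>(fst ` A) = UNIV" using atlas by (simp add: is_atlas_def)
  ultimately show ?thesis by simp
qed

lemma smooth_fun_iff:
  "smooth_fun A f \<longleftrightarrow> (\<forall>c\<in>A. smooth_on (snd c ` fst c) (f \<circ> chart_inv c))"
  unfolding smooth_fun_iff_charts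
  using continuous_on_chartsI smooth_on_imp_continuous_on by blast

lemma smooth_funD: "smooth_fun A f \<Longrightarrow> c \<in> A \<Longrightarrow> smooth_on (snd c ` fst c) (f \<circ> chart_inv c)"
  by (simp add: smooth_fun_iff)

lemma smooth_fun_const: "smooth_fun A (\<lambda>_. k)"
  by (simp add: smooth_fun_iff smooth_on_const comp_def)

lemma smooth_fun_add: "smooth_fun A f \<Longrightarrow> smooth_fun A h \<Longrightarrow> smooth_fun A (\<lambda>x. f x + h x)"
  by (simp add: smooth_fun_iff comp_def smooth_on_add open_chart)

lemma smooth_fun_mult: "smooth_fun A f \<Longrightarrow> smooth_fun A h \<Longrightarrow> smooth_fun A (\<lambda>x. f x * h x)"
  by (simp add: smooth_fun_iff comp_def smooth_on_mult open_chart)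

lemma smooth_fun_inverse:
  assumes "smooth_fun A f" "\<And>x. f x \<noteq> 0" shows "smooth_fun A (\<lambda>x. inverse (f x))"
  using assms by (simp add: smooth_fun_iff comp_def smooth_on_inverse open_chart)

lemma smooth_fun_neg: "smooth_fun A f \<Longrightarrow> smooth_fun A (\<lambda>x. - f x)"
  using smooth_fun_mult[OF smooth_fun_const[of "-1"]] by simp

lemma smooth_fun_diff: "smooth_fun A f \<Longrightarrow> smooth_fun A h \<Longrightarrow> smooth_fun A (\<lambda>x. f x - h x)"
  using smooth_fun_add[OF _ smooth_fun_neg] by simp

lemma smooth_fun_sum:
  "(\<And>i. i \<in> I \<Longrightarrow> smooth_fun A (f i)) \<Longrightarrow> smooth_fun A (\<lambda>x. \<Sum>i\<in>I. f i x)"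
  by (induction I rule: infinite_finite_induct) (auto intro: smooth_fun_add smooth_fun_const)

lemma smooth_fun_local:
  assumes "\<And>p. \<exists>U h. open U \<and> p \<in> U \<and> smooth_fun A h \<and> (\<forall>q\<in>U. f q = h q)"
  shows "smooth_fun A f"
  unfolding smooth_fun_iff
proof
  fix c assume c: "c \<in> A"
  show "smooth_on (snd c ` fst c) (f \<circ> chart_inv c)"
  proof (rule smooth_on_local)
    fix x assume "x \<in> snd c ` fst c"
    then obtain p where p: "p \<in> fst c" "x = snd c p" by auto
    obtain U h where U: "open U" "p \<in> U" "smooth_fun A h" "\<forall>q\<in>U. f q = h q" using assms by blast
    let ?W = "snd c ` (fst c \<inter> U)"
    have o: "open ?W" by (rule open_chart_image) (auto simp: c open_chart U)
    have "smooth_on ?W (h \<circ> chart_inv c)"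
      by (rule smooth_on_subset[OF smooth_funD[OF U(3) c]]) auto
    then have "smooth_on ?W (f \<circ> chart_inv c)"
      by (subst smooth_on_cong[OF o, of _ "h \<circ> chart_inv c"]) (auto simp: U chart_inv_left c)
    then show "\<exists>W. open W \<and> x \<in> W \<and> smooth_on W (f \<circ> chart_inv c)"
      using o p U by blast
  qed
qed

text \<open>The part of the manifold over \<open>K\<close> is compact, hence closed in a Hausdorff
  space. Every point outside the chart therefore has a neighbourhood avoiding it, where the extended
  function is 0; inside the chart the transition maps give smoothness.\<close>

lemma smooth_fun_extend_by_0:
  assumes c: "c \<in> A" and K: "compact K" "K \<subseteq> snd c ` fst c"
    and G: "smooth_on (snd c ` fst c) G" "\<And>x. x \<notin> K \<Longrightarrow> G x = 0"
  shows "smooth_fun A (\<lambda>q. if q \<in> fst c then G (snd c q) else 0)" (is "smooth_fun A ?f")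
  unfolding smooth_fun_iff
proof
  fix d assume d: "d \<in> A"
  define L where "L = chart_inv c ` K"
  have "compact L" unfolding L_def
    by (rule compact_continuous_image[OF continuous_on_subset[OF continuous_on_chart_inv[OF c] K(2)] K(1)])
  then have L: "closed L" by (rule compact_imp_closed)
  have LK: "q \<in> L" if "q \<in> fst c" "snd c q \<in> K" for q
    unfolding L_def using that chart_inv_left[OF c that(1)] by force
  have Lc: "L \<subseteq> fst c" unfolding L_def using K(2) chart_inv_left[OF c] by auto
  show "smooth_on (snd d ` fst d) (?f \<circ> chart_inv d)"
  proof (rule smooth_on_local)
    fix x assume "x \<in> snd d ` fst d"
    then obtain p where p: "p \<in> fst d" "x = snd d p" by auto
    show "\<exists>W. open W \<and> x \<in> W \<and> smooth_on W (?f \<circ> chart_inv d)"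
    proof (cases "p \<in> fst c")
      case True
      let ?W = "snd d ` (fst d \<inter> fst c)"
      have o: "open ?W" by (rule open_chart_image) (auto simp: c d open_chart)
      have "smooth_on ?W (\<lambda>x. G ((snd c \<circ> chart_inv d) x))"
        by (rule smooth_on_compose[OF o open_chart(2)[OF c] _ smooth_transition[OF d c] G(1)])
          (auto simp: chart_inv_left d)
      then have "smooth_on ?W (?f \<circ> chart_inv d)"
        by (subst smooth_on_cong[OF o, of _ "\<lambda>x. G ((snd c \<circ> chart_inv d) x)"])
          (auto simp: chart_inv_left d)
      then show ?thesis using o p True by blast
    next
      case False
      let ?W = "snd d ` (fst d - L)"
      have o: "open ?W" by (rule open_chart_image) (auto simp: d open_chart L open_Diff)
      have "(?f \<circ> chart_inv d) x = 0" if "x \<in> ?W" for x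
        using that LK G(2) by (auto simp: chart_inv_left d) metis
      then have "smooth_on ?W (?f \<circ> chart_inv d)"
        by (subst smooth_on_cong[OF o, of _ "\<lambda>x. 0"]) (auto simp: smooth_on_const)
      then show ?thesis using o p False Lc by blast
    qed
  qed
qed

section \<open>Cutoffs and local frames\<close>

lemma chart_bump:
  assumes "open U" "p \<in> U"
  obtains c b K V where "c \<in> A" "smooth_on UNIV b" "compact K" "K \<subseteq> snd c ` (U \<inter> fst c)"
    "\<forall>x. x \<notin> K \<longrightarrow> b x = (0::real)" "open V" "p \<in> V" "V \<subseteq> fst c" "open (snd c ` V)"
    "\<forall>x\<in>snd c ` V. b x = 1"
proof -
  obtain c where c: "c \<in> A" "p \<in> fst c" by (rule chart_at)
  have "open (snd c ` (U \<inter> fst c))" by (rule open_chart_image) (auto simp: c open_chart assms)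
  moreover have "snd c p \<in> snd c ` (U \<inter> fst c)" using assms c by auto
  ultimately obtain r' where r': "r' > 0" "cball (snd c p) r' \<subseteq> snd c ` (U \<inter> fst c)"
    using open_contains_cball by blast
  \<comment> \<open>Halving leaves room inside the image of \<open>U\<close> for the closed ball of
    radius 2 r, outside which the bump vanishes.\<close>
  define r where "r = r' / 2"
  have r: "r > 0" "cball (snd c p) (2 * r) \<subseteq> snd c ` (U \<inter> fst c)" using r' by (auto simp: r_def)
  obtain b :: "'e \<Rightarrow> real" where b: "smooth_on UNIV b" "\<And>x. x \<in> ball (snd c p) r \<Longrightarrow> b x = 1"
    "\<And>x. x \<notin> ball (snd c p) (2 * r) \<Longrightarrow> b x = 0"
    using euclidean_bump[OF r(1)] by blast
  let ?B = "ball (snd c p) r"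
  have sub: "?B \<subseteq> snd c ` (U \<inter> fst c)" using r by force
  then have sub': "?B \<subseteq> snd c ` fst c" by blast
  have im: "snd c ` chart_inv c ` ?B = ?B"
    using sub' f_inv_into_f[of _ "snd c" "fst c"] by (force simp: image_image)
  show ?thesis
  proof
    show "c \<in> A" "smooth_on UNIV b" "compact (cball (snd c p) (2 * r))" by (fact c b compact_cball)+
    show "cball (snd c p) (2 * r) \<subseteq> snd c ` (U \<inter> fst c)" by (fact r)
    show "\<forall>x. x \<notin> cball (snd c p) (2 * r) \<longrightarrow> b x = 0" using b(3) by auto
    show "open (chart_inv c ` ?B)" by (rule open_chart_inv_image) (use c sub' in auto)
    show "p \<in> chart_inv c ` ?B" using c r chart_inv_left[OF c]
      by (metis centre_in_ball image_eqI)
    show "chart_inv c ` ?B \<subseteq> fst c" using sub' inv_into_into[of _ "snd c" "fst c"] by blast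
    show "open (snd c ` chart_inv c ` ?B)" by (simp add: im)
    show "\<forall>x\<in>snd c ` chart_inv c ` ?B. b x = 1" using b(2) unfolding im by blast
  qed
qed

lemma bump:
  assumes "open U" "p \<in> U"
  obtains b V where "smooth_fun A b" "open V" "p \<in> V" "\<And>q. q \<in> V \<Longrightarrow> b q = 1"
    "\<And>q. q \<notin> U \<Longrightarrow> b q = 0"
proof -
  obtain c b K V where cb: "c \<in> A" "smooth_on UNIV b" "compact K" "K \<subseteq> snd c ` (U \<inter> fst c)"
    "\<forall>x. x \<notin> K \<longrightarrow> b x = (0::real)" "open V" "p \<in> V" "V \<subseteq> fst c" "open (snd c ` V)"
    "\<forall>x\<in>snd c ` V. b x = 1"
    by (rule chart_bump[OF assms])
  show ?thesis
  proof
    show "smooth_fun A (\<lambda>q. if q \<in> fst c then b (snd c q) else 0)"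
      by (rule smooth_fun_extend_by_0[OF cb(1,3) _ smooth_on_subset[OF cb(2)]]) (use cb in auto)
    show "open V" "p \<in> V" by (fact cb)+
    show "(if q \<in> fst c then b (snd c q) else 0) = 1" if "q \<in> V" for q using cb that by auto
    show "(if q \<in> fst c then b (snd c q) else 0) = 0" if "q \<notin> U" for q
    proof -
      have "snd c q \<notin> K" if "q \<in> fst c"
      proof
        assume "snd c q \<in> K"
        then obtain q' where "q' \<in> U" "q' \<in> fst c" "snd c q' = snd c q" using cb(4) by force
        then show False using that \<open>q \<notin> U\<close> chart_inv_left[OF cb(1)] by metis
      qed
      then show ?thesis using cb(5) by auto
    qed
  qed
qed

text \<open>With a bump \<open>b\<close> supported in \<open>{h \<noteq> 0}\<close> the function \<open>h / (h\<^sup>2 + (1 - b)\<^sup>2)\<close> is globally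
  defined and equals \<open>1 / h\<close> where \<open>b = 1\<close>.\<close>

lemma local_reciprocal:
  assumes "smooth_fun A h" "h p \<noteq> 0"
  obtains k V where "smooth_fun A k" "open V" "p \<in> V" "\<And>q. q \<in> V \<Longrightarrow> k q * h q = 1"
proof -
  have "continuous_on UNIV h" using assms(1) smooth_fun_iff_charts by blast
  then have "open (h -` (- {0}))" by (intro open_vimage) auto
  then obtain b V where b: "smooth_fun A b" "open V" "p \<in> V" "\<And>q. q \<in> V \<Longrightarrow> b q = 1"
    "\<And>q. q \<notin> h -` (- {0}) \<Longrightarrow> b q = 0"
    using bump[of "h -` (- {0})" p] assms(2) by auto
  have pos: "h q * h q + (1 - b q) * (1 - b q) \<noteq> 0" for q
    using b(5)[of q] by (cases "h q = 0") (auto simp: sum_squares_eq_zero_iff)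
  show ?thesis
  proof
    show "smooth_fun A (\<lambda>q. h q * inverse (h q * h q + (1 - b q) * (1 - b q)))"
      by (intro smooth_fun_mult smooth_fun_inverse smooth_fun_add smooth_fun_diff smooth_fun_const
          assms b pos)
    show "open V" "p \<in> V" by (fact b)+
    show "h q * inverse (h q * h q + (1 - b q) * (1 - b q)) * h q = 1" if "q \<in> V" for q
      using pos[of q] b(4)[OF that] by (simp add: field_simps)
  qed
qed

text \<open>Vector fields are defined on the whole manifold, so the partial derivatives and the
  coordinate functions of a chart are both multiplied by a bump. On the neighbourhood
  \<open>V\<close>, where the bump is 1, they are the genuine coordinate frame and its dual
  functions.\<close>

lemma local_coordinates:
  obtains X :: "'e \<Rightarrow> 'a vfield" and y :: "'e \<Rightarrow> 'a \<Rightarrow> real" and V where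
    "\<And>e. X e \<in> vector_fields A" "\<And>e. smooth_fun A (y e)" "open V" "p \<in> V"
    "\<And>q e e'. q \<in> V \<Longrightarrow> e \<in> Basis \<Longrightarrow> e' \<in> Basis \<Longrightarrow> X e q (y e') = (if e = e' then 1 else 0)"
proof -
  obtain c b K V where cb: "c \<in> A" "smooth_on UNIV b" "compact K" "K \<subseteq> snd c ` (UNIV \<inter> fst c)"
    "\<forall>x. x \<notin> K \<longrightarrow> b x = (0::real)" "open V" "p \<in> V" "V \<subseteq> fst c" "open (snd c ` V)"
    "\<forall>x\<in>snd c ` V. b x = 1"
    by (rule chart_bump[OF open_UNIV UNIV_I[of p]])
  note c = cb(1) and K = cb(4)[simplified]
  have bs: "smooth_on (snd c ` fst c) b" using cb smooth_on_subset by blast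
  define y where "y = (\<lambda>e q. if q \<in> fst c then b (snd c q) * (snd c q \<bullet> e) else 0)"
  have ys: "smooth_fun A (y e)" for e
    unfolding y_def
    by (rule smooth_fun_extend_by_0[OF cb(1,3) K, of "\<lambda>x. b x * (x \<bullet> e)"])
      (auto intro!: smooth_on_mult bs smooth_on_linear[OF bounded_linear_inner_left] simp: open_chart c cb)
  define X where "X = (\<lambda>e q f. if smooth_fun A f \<and> q \<in> fst c
      then b (snd c q) * frechet_derivative (f \<circ> chart_inv c) (at (snd c q)) e else 0)"
  have hd: "((f \<circ> chart_inv c) has_derivative frechet_derivative (f \<circ> chart_inv c) (at (snd c q))) (at (snd c q))"
    if "smooth_fun A f" "q \<in> fst c" for f q
    using that by (intro frechet_hd smooth_on_imp_differentiable[OF smooth_funD]) (auto simp: c)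
  have fadd: "frechet_derivative ((\<lambda>x. f x + h x) \<circ> chart_inv c) (at (snd c q)) =
      (\<lambda>v. frechet_derivative (f \<circ> chart_inv c) (at (snd c q)) v +
        frechet_derivative (h \<circ> chart_inv c) (at (snd c q)) v)"
    if "smooth_fun A f" "smooth_fun A h" "q \<in> fst c" for f h q
    using has_derivative_add[OF hd[OF that(1,3)] hd[OF that(2,3)]]
    by (intro frechet_derivative_eqI) (simp add: comp_def)
  have fmult: "frechet_derivative ((\<lambda>x. f x * h x) \<circ> chart_inv c) (at (snd c q)) =
      (\<lambda>v. f q * frechet_derivative (h \<circ> chart_inv c) (at (snd c q)) v +
         frechet_derivative (f \<circ> chart_inv c) (at (snd c q)) v * h q)"
    if "smooth_fun A f" "smooth_fun A h" "q \<in> fst c" for f h q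
    using has_derivative_mult[OF hd[OF that(1,3)] hd[OF that(2,3)]] that(3)
    by (intro frechet_derivative_eqI) (simp add: comp_def chart_inv_left c)
  have fcmult: "frechet_derivative ((\<lambda>x. k * f x) \<circ> chart_inv c) (at (snd c q)) =
      (\<lambda>v. k * frechet_derivative (f \<circ> chart_inv c) (at (snd c q)) v)"
    if "smooth_fun A f" "q \<in> fst c" for f k q
    using has_derivative_mult_right[OF hd[OF that]]
    by (intro frechet_derivative_eqI) (simp add: comp_def)
  have tan: "X e q \<in> tangent_space A q" for e q
    unfolding tangent_space_def X_def
    by (auto simp: fadd fmult fcmult smooth_fun_add smooth_fun_mult smooth_fun_const algebra_simps)
  have sm: "smooth_fun A (\<lambda>q. X e q f)" if "smooth_fun A f" for e f
  proof -
    have "smooth_fun A (\<lambda>q. if q \<in> fst c then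
        (\<lambda>x. b x * frechet_derivative (f \<circ> chart_inv c) (at x) e) (snd c q) else 0)"
      by (rule smooth_fun_extend_by_0[OF cb(1,3) K])
        (use cb(5) smooth_funD[OF that c, unfolded comp_def] in
          \<open>auto intro!: smooth_on_mult bs smooth_on_frechet_derivative simp: open_chart c comp_def\<close>)
    then show ?thesis using that by (simp add: X_def)
  qed
  have delta: "X e q (y e') = (if e = e' then 1 else 0)"
    if q: "q \<in> V" and e: "e \<in> Basis" "e' \<in> Basis" for q e e'
  proof -
    have "((\<lambda>x. x \<bullet> e') has_derivative (\<lambda>v. v \<bullet> e')) (at (snd c q))"
      by (rule bounded_linear_imp_has_derivative[OF bounded_linear_inner_left])
    then have "(y e' \<circ> chart_inv c has_derivative (\<lambda>v. v \<bullet> e')) (at (snd c q))"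
      by (rule has_derivative_transform_within_open[OF _ cb(9)])
        (use q cb in \<open>auto simp: y_def chart_inv_left c subset_iff\<close>)
    then have "frechet_derivative (y e' \<circ> chart_inv c) (at (snd c q)) = (\<lambda>v. v \<bullet> e')"
      by (rule frechet_derivative_eqI)
    moreover have "q \<in> fst c" "b (snd c q) = 1" using q cb by auto
    ultimately show ?thesis using e by (simp add: X_def ys inner_Basis)
  qed
  show ?thesis
    by (rule that[of X y V]) (use tan sm ys cb delta in \<open>auto simp: vector_fields_def\<close>)
qed

lemma vf_tangent: "X \<in> vector_fields A \<Longrightarrow> X p \<in> tangent_space A p"
  and vf_smooth: "X \<in> vector_fields A \<Longrightarrow> smooth_fun A f \<Longrightarrow> smooth_fun A (\<lambda>p. X p f)"
  by (auto simp: vector_fields_def)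

lemma vf_0: "0 \<in> vector_fields A"
  by (simp add: vector_fields_def tangent_0 smooth_fun_const)

lemma vf_add: "X \<in> vector_fields A \<Longrightarrow> Y \<in> vector_fields A \<Longrightarrow> X + Y \<in> vector_fields A"
  by (simp add: vector_fields_def tangent_add smooth_fun_add)

lemma vf_scale: "smooth_fun A f \<Longrightarrow> X \<in> vector_fields A \<Longrightarrow> (\<lambda>p. f p *\<^sub>R X p) \<in> vector_fields A"
  unfolding vector_fields_def
  by (auto intro: tangent_scale) (simp add: scaleR_fun_def smooth_fun_mult)

lemma vf_neg: "X \<in> vector_fields A \<Longrightarrow> - X \<in> vector_fields A"
  by (simp add: vector_fields_def tangent_neg smooth_fun_neg)

lemma vf_diff: "X \<in> vector_fields A \<Longrightarrow> Y \<in> vector_fields A \<Longrightarrow> X - Y \<in> vector_fields A"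
  by (simp add: vector_fields_def tangent_diff smooth_fun_diff)

lemma vf_sum: "(\<And>i. i \<in> I \<Longrightarrow> X i \<in> vector_fields A) \<Longrightarrow> (\<Sum>i\<in>I. X i) \<in> vector_fields A"
  by (induction I rule: infinite_finite_induct) (auto intro: vf_add vf_0)

lemma tangent_const0: "v \<in> tangent_space A p \<Longrightarrow> v (\<lambda>_. k) = 0"
  using tangent_cmultF[of v A p "\<lambda>_. 1" k] tangent_multF[of v A p "\<lambda>_. 1" "\<lambda>_. 1"] smooth_fun_const
  by simp

lemma tangent_diffF: "v \<in> tangent_space A p \<Longrightarrow> smooth_fun A f \<Longrightarrow> smooth_fun A h \<Longrightarrow>
    v (\<lambda>x. f x - h x) = v f - v h"
  using tangent_addF[of v A p f "\<lambda>x. - h x"] tangent_cmultF[of v A p h "-1"] smooth_fun_neg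
  by simp

lemma vf_bracket:
  assumes X: "X \<in> vector_fields A" and Y: "Y \<in> vector_fields A"
  shows "lie_bracket X Y \<in> vector_fields A"
proof -
  note t = vf_tangent[OF X] vf_tangent[OF Y]
  have "lie_bracket X Y p \<in> tangent_space A p" for p
    unfolding tangent_space_def
  proof (clarify, intro conjI allI impI)
    fix f h assume fh: "smooth_fun A f" "smooth_fun A h"
    show "lie_bracket X Y p (\<lambda>x. f x + h x) = lie_bracket X Y p f + lie_bracket X Y p h"
      by (simp add: lie_bracket_def t[THEN tangent_addF] X Y fh vf_smooth)
    show "lie_bracket X Y p (\<lambda>x. f x * h x) = f p * lie_bracket X Y p h + h p * lie_bracket X Y p f"
      by (simp add: lie_bracket_def t[THEN tangent_addF] t[THEN tangent_multF] X Y fh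
          vf_smooth smooth_fun_mult algebra_simps)
  next
    fix f c assume "smooth_fun A f"
    then show "lie_bracket X Y p (\<lambda>x. c * f x) = c * lie_bracket X Y p f"
      by (simp add: lie_bracket_def t[THEN tangent_cmultF] X Y vf_smooth algebra_simps)
  next
    \<comment> \<open>Both inner functions are identically 0 here, since tangent vectors vanish off
      the smooth functions, and a tangent vector kills constants.\<close>
    fix f assume "\<not> smooth_fun A f"
    then show "lie_bracket X Y p f = 0"
      by (simp add: lie_bracket_def t[THEN tangent_nonsmooth]
          t[THEN tangent_const0])
  qed
  then show ?thesis
    by (simp add: vector_fields_def) (simp add: lie_bracket_def X Y vf_smooth smooth_fun_diff)
qed

end

section \<open>Dimension counts relative to a finite spanning set\<close>

lemma finite_span_dim_basis:
  fixes V :: "'v::real_vector set"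
  assumes "finite B" "span B = V"
  obtains C where "finite C" "independent C" "span C = V" "card C = dim V" "C \<subseteq> V"
proof -
  obtain C where C: "C \<subseteq> B" "independent C" "B \<subseteq> span C"
    using maximal_independent_subset[of B] by metis
  have s: "span C = V"
    using C assms by (metis span_mono span_span subset_antisym)
  show ?thesis
  proof
    show "finite C" using C assms finite_subset by blast
    show "card C = dim V" using dim_eq_card[of C V] C s by (metis span_span)
    show "C \<subseteq> V" using s span_superset by blast
  qed (use C s in auto)
qed

lemma independent_card_le_dim_span:
  fixes V :: "'v::real_vector set"
  assumes "finite B" "span B = V" "independent C" "C \<subseteq> V"
  shows "finite C \<and> card C \<le> dim V"
proof -
  obtain B' where "finite B'" "independent B'" "span B' = V" "card B' = dim V"
    using finite_span_dim_basis[OF assms(1,2)] by metis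
  then show ?thesis using independent_span_bound[of B' C] assms by auto
qed

lemma independent_card_ge_span:
  fixes V :: "'v::real_vector set"
  assumes "finite B" "span B = V" "independent C" "C \<subseteq> V" "card C \<ge> dim V"
  shows "span C = V"
proof (rule ccontr)
  have fC: "finite C" using independent_card_le_dim_span[OF assms(1-4)] by simp
  have sub: "span C \<subseteq> V" using assms by (metis span_minimal subspace_span)
  assume "span C \<noteq> V"
  then obtain v where v: "v \<in> V" "v \<notin> span C" using sub by blast
  then have "independent (insert v C)" "v \<notin> C" using assms(3) by (auto simp: independent_insert span_base)
  then have "card (insert v C) \<le> dim V"
    using independent_card_le_dim_span[OF assms(1,2)] v assms(4) by auto
  then show False using \<open>v \<notin> C\<close> fC assms(5) by simp
qed

text \<open>Knowing the dimension of the space of derivations replaces Hadamard's lemma: the coordinate fields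
  are independent, hence they span.\<close>

locale smooth_mfd = atlas A for A :: "('a::t2_space, 'e::euclidean_space) chart set" +
  assumes tangent_fin: "\<exists>B. finite B \<and> span B = tangent_space A p"
    and tangent_dim: "dim (tangent_space A p) = DIM('e)"
begin

lemma coordinate_expansion:
  assumes delta: "\<And>e e'. e \<in> Basis \<Longrightarrow> e' \<in> Basis \<Longrightarrow> x e (y e') = (if e = e' then 1 else 0)"
    and x: "\<And>e. x e \<in> tangent_space A q" and v: "v \<in> tangent_space A q"
  shows "v = (\<Sum>e\<in>(Basis :: 'e set). v (y e) *\<^sub>R x e)"
proof -
  have ev: "(\<Sum>e\<in>Basis. c e *\<^sub>R x e) (y e') = c e'" if "e' \<in> Basis" for c and e' :: 'e
  proof -
    have "(\<Sum>e\<in>Basis. c e *\<^sub>R x e) (y e') = (\<Sum>e\<in>Basis. if e = e' then c e else 0)"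
      unfolding sum_fun_apply by (intro sum.cong) (auto simp: scaleR_fun_def delta that)
    then show ?thesis using that by simp
  qed
  have inj: "inj_on x Basis" using delta by (metis inj_onI zero_neq_one)
  have k0: "\<forall>e\<in>Basis. k (x e) = 0" if "(\<Sum>v\<in>x ` Basis. k v *\<^sub>R v) = 0" for k
  proof
    fix e :: 'e assume e: "e \<in> Basis"
    have "(\<Sum>e\<in>Basis. k (x e) *\<^sub>R x e) = 0" using that by (simp add: sum.reindex[OF inj])
    then show "k (x e) = 0" using ev[OF e, of "\<lambda>e. k (x e)"] by simp
  qed
  have ind: "independent (x ` Basis)"
    unfolding dependent_finite[OF finite_imageI[OF finite_Basis]] using k0 by blast
  obtain B where B: "finite B" "span B = tangent_space A q" using tangent_fin by blast
  have "span (x ` Basis) = tangent_space A q"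
    by (rule independent_card_ge_span[OF B ind]) (use x card_image[OF inj] tangent_dim in auto)
  then have "v \<in> span (x ` Basis)" using v by simp
  then obtain u where "v = (\<Sum>w\<in>x ` Basis. u w *\<^sub>R w)"
    using span_finite[OF finite_imageI[OF finite_Basis]] by blast
  then have u: "v = (\<Sum>e\<in>Basis. u (x e) *\<^sub>R x e)" by (simp add: sum.reindex[OF inj])
  have "v (y e) = u (x e)" if "e \<in> Basis" for e
    by (subst u) (rule ev[OF that, of "\<lambda>e. u (x e)"])
  then show ?thesis by (subst u) (intro sum.cong, auto)
qed

lemma extend_tangent:
  assumes "v \<in> tangent_space A p"
  obtains Z where "Z \<in> vector_fields A" "Z p = v"
proof -
  obtain X :: "'e \<Rightarrow> 'a vfield" and y :: "'e \<Rightarrow> 'a \<Rightarrow> real" and V where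
    X: "\<And>e. X e \<in> vector_fields A" "\<And>e. smooth_fun A (y e)" "open V" "p \<in> V"
    "\<And>q e e'. q \<in> V \<Longrightarrow> e \<in> Basis \<Longrightarrow> e' \<in> Basis \<Longrightarrow> X e q (y e') = (if e = e' then 1 else 0)"
    using local_coordinates by metis
  have "v = (\<Sum>e\<in>Basis. v (y e) *\<^sub>R X e p)"
    by (rule coordinate_expansion) (use X assms in \<open>auto simp: vf_tangent\<close>)
  moreover have "(\<Sum>e\<in>Basis. (\<lambda>q. v (y e) *\<^sub>R X e q)) \<in> vector_fields A"
    by (intro vf_sum vf_scale smooth_fun_const X)
  ultimately show ?thesis using that[of "\<Sum>e\<in>Basis. (\<lambda>q. v (y e) *\<^sub>R X e q)"]
    by (simp add: sum_fun_apply)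
qed

end

section \<open>Symmetries and tensoriality of the curvature\<close>

text \<open>This is the octahedron argument: a signed combination of the four cyclic identities,
  simplified by the two skew symmetries, leaves twice the difference of both sides. The arguments
  range over an abstract set \<open>S\<close>, because it is applied to vector fields before
  curvature is known to be a tensor.\<close>

lemma pair_symmetry:
  fixes F :: "'v \<Rightarrow> 'v \<Rightarrow> 'v \<Rightarrow> 'v \<Rightarrow> real"
  assumes skew12: "\<And>x y z w. x \<in> S \<Longrightarrow> y \<in> S \<Longrightarrow> z \<in> S \<Longrightarrow> w \<in> S \<Longrightarrow> F x y z w = - F y x z w"
    and skew34: "\<And>x y z w. x \<in> S \<Longrightarrow> y \<in> S \<Longrightarrow> z \<in> S \<Longrightarrow> w \<in> S \<Longrightarrow> F x y z w = - F x y w z"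
    and bianchi: "\<And>x y z w. x \<in> S \<Longrightarrow> y \<in> S \<Longrightarrow> z \<in> S \<Longrightarrow> w \<in> S \<Longrightarrow>
      F x y z w + F y z x w + F z x y w = 0"
    and S: "x \<in> S" "y \<in> S" "z \<in> S" "w \<in> S"
  shows "F x y z w = F z w x y"
proof -
  have "F x y z w + F y z x w + F z x y w = 0" "F y z w x + F z w y x + F w y z x = 0"
    "F z w x y + F w x z y + F x z w y = 0" "F w x y z + F x y w z + F y w x z = 0"
    by (rule bianchi; fact S)+
  moreover have "F y z w x = - F y z x w" "F z w y x = - F z w x y" "F y w z x = - F y w x z"
    "F w x z y = - F w x y z" "F z x w y = - F z x y w" "F x y w z = - F x y z w"
    by (rule skew34; fact S)+
  moreover have "F w y z x = - F y w z x" "F x z w y = - F z x w y"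
    by (rule skew12; fact S)+
  ultimately show ?thesis by linarith
qed

locale semi_riemannian = smooth_mfd A for A :: "('a::t2_space, 'e::euclidean_space) chart set" +
  fixes g :: "'a metric" and D :: "'a vfield \<Rightarrow> 'a vfield \<Rightarrow> 'a vfield"
  assumes metric: "semi_riemannian_metric A g" and levi_civita: "levi_civita A g D"
begin

abbreviation T :: "'a \<Rightarrow> 'a tvec set" where "T \<equiv> tangent_space A"
abbreviation VF :: "'a vfield set" where "VF \<equiv> vector_fields A"

lemmas T_closed [simp, intro] = tangent_add tangent_diff tangent_neg tangent_scale tangent_0
lemmas VF_closed [simp, intro] = vf_0 vf_add vf_diff vf_neg vf_scale vf_bracket vf_tangent
declare smooth_fun_const [simp, intro]

lemma g_linear: "x \<in> T p \<Longrightarrow> linear_to (T p) UNIV (g p x)"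
  using metric by (simp add: semi_riemannian_metric_def)

lemma g_sym: "x \<in> T p \<Longrightarrow> y \<in> T p \<Longrightarrow> g p x y = g p y x"
  using metric by (simp add: semi_riemannian_metric_def)

lemma g_add_right [simp]: "x \<in> T p \<Longrightarrow> y \<in> T p \<Longrightarrow> z \<in> T p \<Longrightarrow> g p x (y + z) = g p x y + g p x z"
  and g_scale_right [simp]: "x \<in> T p \<Longrightarrow> y \<in> T p \<Longrightarrow> g p x (c *\<^sub>R y) = c * g p x y"
  using g_linear by (auto simp: linear_to_def)

lemma g_add_left [simp]: "x \<in> T p \<Longrightarrow> y \<in> T p \<Longrightarrow> z \<in> T p \<Longrightarrow> g p (y + z) x = g p y x + g p z x"
  using g_sym[of _ p x] by simp

lemma g_scale_left [simp]: "x \<in> T p \<Longrightarrow> y \<in> T p \<Longrightarrow> g p (c *\<^sub>R y) x = c * g p y x"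
  using g_sym[of _ p x] by simp

lemma g_0_right [simp]: "x \<in> T p \<Longrightarrow> g p x 0 = 0"
  using g_scale_right[of x p 0 0] by simp

lemma g_0_left [simp]: "x \<in> T p \<Longrightarrow> g p 0 x = 0"
  using g_scale_left[of x p 0 0] by simp

lemma g_neg_right [simp]: "x \<in> T p \<Longrightarrow> y \<in> T p \<Longrightarrow> g p x (- y) = - g p x y"
  using g_scale_right[of x p y "-1"] by simp

lemma g_neg_left [simp]: "x \<in> T p \<Longrightarrow> y \<in> T p \<Longrightarrow> g p (- y) x = - g p y x"
  using g_scale_left[of x p y "-1"] by simp

lemma g_diff_right [simp]: "x \<in> T p \<Longrightarrow> y \<in> T p \<Longrightarrow> z \<in> T p \<Longrightarrow> g p x (y - z) = g p x y - g p x z"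
  using g_add_right[of x p y "- z"] by (simp del: g_add_right)

lemma g_diff_left [simp]: "x \<in> T p \<Longrightarrow> y \<in> T p \<Longrightarrow> z \<in> T p \<Longrightarrow> g p (y - z) x = g p y x - g p z x"
  using g_add_left[of x p y "- z"] by (simp del: g_add_left)

lemma T_sum [simp, intro]: "(\<And>i. i \<in> I \<Longrightarrow> v i \<in> T p) \<Longrightarrow> (\<Sum>i\<in>I. v i) \<in> T p"
  by (intro subspace_sum subspace_tangent_space)

lemma g_sum_right: "x \<in> T p \<Longrightarrow> (\<And>i. i \<in> I \<Longrightarrow> v i \<in> T p) \<Longrightarrow> g p x (\<Sum>i\<in>I. v i) = (\<Sum>i\<in>I. g p x (v i))"
  by (induction I rule: infinite_finite_induct) auto

lemma g_sum_left: "x \<in> T p \<Longrightarrow> (\<And>i. i \<in> I \<Longrightarrow> v i \<in> T p) \<Longrightarrow> g p (\<Sum>i\<in>I. v i) x = (\<Sum>i\<in>I. g p (v i) x)"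
  by (induction I rule: infinite_finite_induct) auto

lemma g_smooth [simp, intro]: "X \<in> VF \<Longrightarrow> Y \<in> VF \<Longrightarrow> smooth_fun A (\<lambda>q. g q (X q) (Y q))"
  using metric by (simp add: semi_riemannian_metric_def)

lemma g_eqI:
  assumes "x \<in> T p" "y \<in> T p" "\<And>w. w \<in> T p \<Longrightarrow> g p x w = g p y w"
  shows "x = y"
proof -
  have "nondegenerate_on (T p) (g p)" using metric by (simp add: semi_riemannian_metric_def)
  moreover have "\<forall>w\<in>T p. g p (x - y) w = 0" using assms by simp
  ultimately have "x - y = 0" unfolding nondegenerate_on_def using assms by blast
  then show ?thesis by simp
qed

lemma D_vf [simp, intro]: "X \<in> VF \<Longrightarrow> Y \<in> VF \<Longrightarrow> D X Y \<in> VF"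
  and D_add_left: "X \<in> VF \<Longrightarrow> Y \<in> VF \<Longrightarrow> Z \<in> VF \<Longrightarrow> D (X + Y) Z = D X Z + D Y Z"
  and D_add_right: "X \<in> VF \<Longrightarrow> Y \<in> VF \<Longrightarrow> Z \<in> VF \<Longrightarrow> D X (Y + Z) = D X Y + D X Z"
  and torsion_free: "X \<in> VF \<Longrightarrow> Y \<in> VF \<Longrightarrow> D X Y - D Y X = lie_bracket X Y"
  using levi_civita unfolding levi_civita_def by blast+

lemma D_scale_left: "X \<in> VF \<Longrightarrow> Y \<in> VF \<Longrightarrow> smooth_fun A f \<Longrightarrow>
    D (\<lambda>p. f p *\<^sub>R X p) Y = (\<lambda>p. f p *\<^sub>R D X Y p)"
  and D_scale_right: "X \<in> VF \<Longrightarrow> Y \<in> VF \<Longrightarrow> smooth_fun A f \<Longrightarrow>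
    D X (\<lambda>p. f p *\<^sub>R Y p) = (\<lambda>p. X p f *\<^sub>R Y p + f p *\<^sub>R D X Y p)"
  using levi_civita unfolding levi_civita_def by blast+

lemma metric_compat: "X \<in> VF \<Longrightarrow> Y \<in> VF \<Longrightarrow> Z \<in> VF \<Longrightarrow>
    X p (\<lambda>q. g q (Y q) (Z q)) = g p (D X Y p) (Z p) + g p (Y p) (D X Z p)"
  using levi_civita unfolding levi_civita_def by blast

lemma torsion_free_at: "X \<in> VF \<Longrightarrow> Y \<in> VF \<Longrightarrow> D X Y p = D Y X p + lie_bracket X Y p"
  using torsion_free[of X Y] by (metis add.commute diff_add_cancel minus_apply)

lemma D_neg_left: "X \<in> VF \<Longrightarrow> Y \<in> VF \<Longrightarrow> D (- X) Y = - D X Y"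
  using D_scale_left[of X Y "\<lambda>_. -1"] by (simp add: fun_Compl_def)

lemma D_neg_right: "X \<in> VF \<Longrightarrow> Y \<in> VF \<Longrightarrow> D X (- Y) = - D X Y"
  using D_scale_right[of X Y "\<lambda>_. -1"] by (simp add: fun_Compl_def tangent_const0[OF vf_tangent])

lemma D_diff_right: "X \<in> VF \<Longrightarrow> Y \<in> VF \<Longrightarrow> Z \<in> VF \<Longrightarrow> D X (Y - Z) = D X Y - D X Z"
  using D_add_right[of X Y "- Z"] by (simp add: D_neg_right)

lemma D_0_right: "X \<in> VF \<Longrightarrow> D X 0 = 0"
  using D_add_right[of X 0 0] by simp

lemma D_0_left: "X \<in> VF \<Longrightarrow> D 0 X = 0"
  using D_add_left[of 0 0 X] by simp

lemma D_cscale_right: "X \<in> VF \<Longrightarrow> Y \<in> VF \<Longrightarrow> D X (\<lambda>p. c *\<^sub>R Y p) = (\<lambda>p. c *\<^sub>R D X Y p)"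
  using D_scale_right[of X Y "\<lambda>_. c"] by (simp add: tangent_const0[OF vf_tangent])

lemma lie_bracket_skew: "lie_bracket X Y = - lie_bracket Y X"
  by (simp add: lie_bracket_def fun_eq_iff)

lemma jacobi_identity:
  assumes "X \<in> VF" "Y \<in> VF" "Z \<in> VF"
  shows "lie_bracket X (lie_bracket Y Z) + lie_bracket Y (lie_bracket Z X)
    + lie_bracket Z (lie_bracket X Y) = 0"
proof (intro ext)
  fix p f
  show "(lie_bracket X (lie_bracket Y Z) + lie_bracket Y (lie_bracket Z X)
    + lie_bracket Z (lie_bracket X Y)) p f = 0 p f"
  proof (cases "smooth_fun A f")
    case True
    then show ?thesis
      using assms by (simp add: lie_bracket_def assms[THEN vf_tangent, THEN tangent_diffF] vf_smooth)
  next
    case False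
    have "lie_bracket U V p f = 0" if "U \<in> VF" "V \<in> VF" for U V
      using tangent_nonsmooth[OF vf_tangent[OF vf_bracket[OF that]] False] .
    then show ?thesis using assms by simp
  qed
qed

text \<open>Compatibility expands the three derivatives and freedom from torsion replaces the
  brackets; all but two equal terms cancel. Being free of the connection, the right-hand side can
  later be compared term by term between lifts and the base.\<close>

lemma koszul:
  assumes [simp]: "X \<in> VF" "Y \<in> VF" "Z \<in> VF"
  shows "2 * g p (D X Y p) (Z p) =
    X p (\<lambda>q. g q (Y q) (Z q)) + Y p (\<lambda>q. g q (Z q) (X q)) - Z p (\<lambda>q. g q (X q) (Y q))
    + g p (lie_bracket X Y p) (Z p) - g p (lie_bracket Y Z p) (X p) + g p (lie_bracket Z X p) (Y p)"
  by (simp add: metric_compat torsion_free_at[of X Y] torsion_free_at[of Y Z] torsion_free_at[of Z X]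
      g_sym[of "X p"] g_sym[of "Y p"] g_sym[of "Z p"])

section \<open>Curvature identities for vector fields\<close>

lemma curvature_vf: "X \<in> VF \<Longrightarrow> Y \<in> VF \<Longrightarrow> Z \<in> VF \<Longrightarrow> curvature D X Y Z \<in> VF"
  by (simp add: curvature_def)

lemma curvature_skew12:
  "X \<in> VF \<Longrightarrow> Y \<in> VF \<Longrightarrow> Z \<in> VF \<Longrightarrow> curvature D X Y Z = - curvature D Y X Z"
  by (simp add: curvature_def lie_bracket_skew[of X Y] D_neg_left)

text \<open>The derivative of g(Z, W) along [X, Y] is computed twice: as a commutator of iterated
  derivatives and directly by compatibility. Mixed products of first derivatives cancel.\<close>

lemma curvature_skew34:
  assumes [simp]: "X \<in> VF" "Y \<in> VF" "Z \<in> VF" "W \<in> VF"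
  shows "g p (curvature D X Y Z p) (W p) = - g p (curvature D X Y W p) (Z p)"
proof -
  have YX: "U p (\<lambda>q. V q (\<lambda>q. g q (Z q) (W q))) =
     (g p (D U (D V Z) p) (W p) + g p (D V Z p) (D U W p)) +
     (g p (D U Z p) (D V W p) + g p (Z p) (D U (D V W) p))" if [simp]: "U \<in> VF" "V \<in> VF" for U V
    using that(1)[THEN vf_tangent, THEN tangent_addF] by (simp add: metric_compat)
  have "lie_bracket X Y p (\<lambda>q. g q (Z q) (W q)) =
      X p (\<lambda>q. Y q (\<lambda>q. g q (Z q) (W q))) - Y p (\<lambda>q. X q (\<lambda>q. g q (Z q) (W q)))"
    by (simp add: lie_bracket_def)
  then show ?thesis
    unfolding YX[OF assms(1,2)] YX[OF assms(2,1)] metric_compat[OF vf_bracket[OF assms(1,2)] assms(3,4)]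
    by (simp add: curvature_def g_sym[of "Z p"])
qed

text \<open>Freedom from torsion turns the cyclic sum of second derivatives into iterated brackets,
  and the Jacobi identity finishes.\<close>

lemma bianchi:
  assumes [simp]: "X \<in> VF" "Y \<in> VF" "Z \<in> VF"
  shows "curvature D X Y Z + curvature D Y Z X + curvature D Z X Y = 0"
proof -
  have *: "D U (D V W) = D U (D W V) + D U (lie_bracket V W)" if [simp]: "U \<in> VF" "V \<in> VF" "W \<in> VF" for U V W
    using D_diff_right[of U "D V W" "D W V"] by (simp add: torsion_free algebra_simps)
  have **: "D U (lie_bracket V W) = D (lie_bracket V W) U + lie_bracket U (lie_bracket V W)"
    if [simp]: "U \<in> VF" "V \<in> VF" "W \<in> VF" for U V W
    using torsion_free[of U "lie_bracket V W"] by (simp add: algebra_simps)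
  have "curvature D X Y Z + curvature D Y Z X + curvature D Z X Y =
    lie_bracket X (lie_bracket Y Z) + lie_bracket Y (lie_bracket Z X) + lie_bracket Z (lie_bracket X Y)"
    using *[of X Y Z] *[of Y Z X] *[of Z X Y] **[of X Y Z] **[of Y Z X] **[of Z X Y]
    by (simp add: curvature_def algebra_simps)
  then show ?thesis by (simp add: jacobi_identity)
qed

lemma curvature_pair_symmetry:
  assumes "X \<in> VF" "Y \<in> VF" "Z \<in> VF" "W \<in> VF"
  shows "g p (curvature D X Y Z p) (W p) = g p (curvature D Z W X p) (Y p)"
proof (rule pair_symmetry[where S = VF and F = "\<lambda>X Y Z W. g p (curvature D X Y Z p) (W p)", OF _ _ _ assms])
  fix X Y Z W assume [simp]: "X \<in> VF" "Y \<in> VF" "Z \<in> VF" "W \<in> VF"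
  show "g p (curvature D X Y Z p) (W p) = - g p (curvature D Y X Z p) (W p)"
    by (simp add: curvature_skew12[of X Y] curvature_vf)
  show "g p (curvature D X Y Z p) (W p) = - g p (curvature D X Y W p) (Z p)"
    by (rule curvature_skew34) simp_all
  have "g p ((curvature D X Y Z + curvature D Y Z X + curvature D Z X Y) p) (W p) = 0"
    by (simp add: bianchi)
  then show "g p (curvature D X Y Z p) (W p) + g p (curvature D Y Z X p) (W p)
      + g p (curvature D Z X Y p) (W p) = 0"
    by (simp add: curvature_vf)
qed

text \<open>Tensoriality comes for free: \<open>g(R(X,Y)Z,W)\<close> depends on \<open>W\<close> only through its value at \<open>p\<close>,
  and the symmetries move every argument into the last slot.\<close>

lemma curvature_tensorial:
  assumes [simp]: "X \<in> VF" "Y \<in> VF" "Z \<in> VF" "X' \<in> VF" "Y' \<in> VF" "Z' \<in> VF"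
    and eq: "X p = X' p" "Y p = Y' p" "Z p = Z' p"
  shows "curvature D X Y Z p = curvature D X' Y' Z' p"
proof (rule g_eqI)
  fix w assume "w \<in> T p"
  then obtain W where W: "W \<in> VF" "W p = w" by (rule extend_tangent)
  note [simp] = W(1)
  have "g p (curvature D X Y Z p) (W p) = - g p (curvature D X Y W p) (Z' p)"
    using curvature_skew34[of X Y Z W p] eq by simp
  also have "\<dots> = g p (curvature D X Y Z' p) (W p)"
    by (simp add: curvature_skew34[of X Y Z' W])
  also have "\<dots> = g p (curvature D Z' W X p) (Y' p)"
    using curvature_pair_symmetry[of X Y Z' W p] eq by simp
  also have "\<dots> = - g p (curvature D Z' W Y' p) (X' p)"
    using curvature_skew34[of Z' W X Y' p] eq by simp
  also have "\<dots> = g p (curvature D Z' W X' p) (Y' p)"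
    by (simp add: curvature_skew34[of Z' W X' Y'])
  also have "\<dots> = g p (curvature D X' Y' Z' p) (W p)"
    by (rule curvature_pair_symmetry) simp_all
  finally show "g p (curvature D X Y Z p) w = g p (curvature D X' Y' Z' p) w" using W by simp
qed (simp_all add: curvature_vf)

lemma curvature_at_eq:
  assumes "X \<in> VF" "Y \<in> VF" "Z \<in> VF"
  shows "curvature_at A D p (X p) (Y p) (Z p) = curvature D X Y Z p"
  unfolding curvature_at_def
  by (rule the_equality) (use assms curvature_tensorial in blast)+

section \<open>Curvature as a tensor at a point\<close>

definition Rm :: "'a \<Rightarrow> 'a tvec \<Rightarrow> 'a tvec \<Rightarrow> 'a tvec \<Rightarrow> 'a tvec \<Rightarrow> real" where
  "Rm p x y z w = g p (curvature_at A D p x y z) w"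

lemma Rm_eq:
  assumes "X \<in> VF" "Y \<in> VF" "Z \<in> VF"
  shows "Rm p (X p) (Y p) (Z p) w = g p (curvature D X Y Z p) w"
  by (simp add: Rm_def curvature_at_eq assms)

lemma curvature_at_tangent [simp, intro]:
  assumes "x \<in> T p" "y \<in> T p" "z \<in> T p" shows "curvature_at A D p x y z \<in> T p"
proof -
  obtain X where X: "X \<in> VF" "X p = x" using extend_tangent[OF assms(1)] .
  obtain Y where Y: "Y \<in> VF" "Y p = y" using extend_tangent[OF assms(2)] .
  obtain Z where Z: "Z \<in> VF" "Z p = z" using extend_tangent[OF assms(3)] .
  show ?thesis
    using vf_tangent[OF curvature_vf[OF X(1) Y(1) Z(1)], of p] curvature_at_eq[OF X(1) Y(1) Z(1), of p] X Y Z
    by simp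
qed

lemma Rm_skew12:
  assumes "x \<in> T p" "y \<in> T p" "z \<in> T p" "w \<in> T p" shows "Rm p x y z w = - Rm p y x z w"
proof -
  obtain X where X: "X \<in> VF" "X p = x" using extend_tangent[OF assms(1)] .
  obtain Y where Y: "Y \<in> VF" "Y p = y" using extend_tangent[OF assms(2)] .
  obtain Z where Z: "Z \<in> VF" "Z p = z" using extend_tangent[OF assms(3)] .
  have "curvature D X Y Z p = - curvature D Y X Z p"
    by (subst curvature_skew12) (simp_all add: X Y Z)
  then show ?thesis
    using Rm_eq[OF X(1) Y(1) Z(1), of p w] Rm_eq[OF Y(1) X(1) Z(1), of p w] X Y Z assms(4)
    by (simp add: curvature_vf)
qed

lemma Rm_skew34:
  assumes "x \<in> T p" "y \<in> T p" "z \<in> T p" "w \<in> T p" shows "Rm p x y z w = - Rm p x y w z"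
proof -
  obtain X where X: "X \<in> VF" "X p = x" using extend_tangent[OF assms(1)] .
  obtain Y where Y: "Y \<in> VF" "Y p = y" using extend_tangent[OF assms(2)] .
  obtain Z where Z: "Z \<in> VF" "Z p = z" using extend_tangent[OF assms(3)] .
  obtain W where W: "W \<in> VF" "W p = w" using extend_tangent[OF assms(4)] .
  show ?thesis
    using curvature_skew34[OF X(1) Y(1) Z(1) W(1), of p] Rm_eq[OF X(1) Y(1) Z(1), of p w] Rm_eq[OF X(1) Y(1) W(1), of p z] X Y Z W
    by simp
qed

lemma Rm_pair:
  assumes "x \<in> T p" "y \<in> T p" "z \<in> T p" "w \<in> T p" shows "Rm p x y z w = Rm p z w x y"
proof -
  obtain X where X: "X \<in> VF" "X p = x" using extend_tangent[OF assms(1)] .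
  obtain Y where Y: "Y \<in> VF" "Y p = y" using extend_tangent[OF assms(2)] .
  obtain Z where Z: "Z \<in> VF" "Z p = z" using extend_tangent[OF assms(3)] .
  obtain W where W: "W \<in> VF" "W p = w" using extend_tangent[OF assms(4)] .
  show ?thesis
    using curvature_pair_symmetry[OF X(1) Y(1) Z(1) W(1), of p] Rm_eq[OF X(1) Y(1) Z(1), of p w] Rm_eq[OF Z(1) W(1) X(1), of p y] X Y Z W
    by simp
qed

lemma Rm_add4: "x \<in> T p \<Longrightarrow> y \<in> T p \<Longrightarrow> z \<in> T p \<Longrightarrow> w \<in> T p \<Longrightarrow> v \<in> T p \<Longrightarrow>
    Rm p x y z (w + v) = Rm p x y z w + Rm p x y z v"
  and Rm_scale4: "x \<in> T p \<Longrightarrow> y \<in> T p \<Longrightarrow> z \<in> T p \<Longrightarrow> w \<in> T p \<Longrightarrow>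
    Rm p x y z (c *\<^sub>R w) = c * Rm p x y z w"
  by (simp_all add: Rm_def)

text \<open>Only the last slot is linear by definition. Skew symmetry carries linearity to the third
  slot, and pair symmetry carries it on to the first two.\<close>

lemma Rm_add3: "x \<in> T p \<Longrightarrow> y \<in> T p \<Longrightarrow> z \<in> T p \<Longrightarrow> w \<in> T p \<Longrightarrow> v \<in> T p \<Longrightarrow>
    Rm p x y (z + v) w = Rm p x y z w + Rm p x y v w"
  using Rm_skew34[of x p y _ w] Rm_add4[of x p y w] by simp

lemma Rm_scale3: "x \<in> T p \<Longrightarrow> y \<in> T p \<Longrightarrow> z \<in> T p \<Longrightarrow> w \<in> T p \<Longrightarrow>
    Rm p x y (c *\<^sub>R z) w = c * Rm p x y z w"
  using Rm_skew34[of x p y _ w] Rm_scale4[of x p y w] by simp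

lemma Rm_add2: "x \<in> T p \<Longrightarrow> y \<in> T p \<Longrightarrow> z \<in> T p \<Longrightarrow> w \<in> T p \<Longrightarrow> v \<in> T p \<Longrightarrow>
    Rm p x (y + v) z w = Rm p x y z w + Rm p x v z w"
  using Rm_pair[of x p _ z w] Rm_add4[of z p w x] by simp

lemma Rm_scale2: "x \<in> T p \<Longrightarrow> y \<in> T p \<Longrightarrow> z \<in> T p \<Longrightarrow> w \<in> T p \<Longrightarrow>
    Rm p x (c *\<^sub>R y) z w = c * Rm p x y z w"
  using Rm_pair[of x p _ z w] Rm_scale4[of z p w x] by simp

lemma Rm_add1: "x \<in> T p \<Longrightarrow> y \<in> T p \<Longrightarrow> z \<in> T p \<Longrightarrow> w \<in> T p \<Longrightarrow> v \<in> T p \<Longrightarrow>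
    Rm p (x + v) y z w = Rm p x y z w + Rm p v y z w"
  using Rm_pair[of _ p y z w] Rm_add3[of z p w] by simp

lemma Rm_scale1: "x \<in> T p \<Longrightarrow> y \<in> T p \<Longrightarrow> z \<in> T p \<Longrightarrow> w \<in> T p \<Longrightarrow>
    Rm p (c *\<^sub>R x) y z w = c * Rm p x y z w"
  using Rm_pair[of _ p y z w] Rm_scale3[of z p w] by simp

lemmas Rm_multilinear = Rm_add1 Rm_add2 Rm_add3 Rm_add4 Rm_scale1 Rm_scale2 Rm_scale3 Rm_scale4

end

section \<open>The geometry of S-manifolds\<close>

text \<open>The signs are fixed real numbers rather than functions of the point, so that they pass
  through derivatives as constants.\<close>

locale S_manifold = semi_riemannian A g D
  for A :: "('a::{t2_space, second_countable_topology}, 'e::euclidean_space) chart set" and g D +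
  fixes n s :: nat and \<phi> :: "'a \<Rightarrow> 'a tvec \<Rightarrow> 'a tvec" and \<xi> :: "nat \<Rightarrow> 'a vfield"
    and \<eta> :: "nat \<Rightarrow> 'a \<Rightarrow> 'a tvec \<Rightarrow> real" and \<epsilon> :: "nat \<Rightarrow> real"
  assumes S_manifold: "indefinite_S_manifold A n s \<phi> \<xi> \<eta> g"
    and s_pos: "1 \<le> s"
    and g_xi_xi: "\<And>\<alpha> p. \<alpha> \<in> {1..s} \<Longrightarrow> g p (\<xi> \<alpha> p) (\<xi> \<alpha> p) = \<epsilon> \<alpha>"
begin

definition I :: "nat set" where "I = {1..s}"

lemma finite_I [simp, intro]: "finite I"
  by (simp add: I_def)

abbreviation F :: "'a vfield \<Rightarrow> 'a vfield" where "F X \<equiv> (\<lambda>q. \<phi> q (X q))"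

lemma eps: "\<alpha> \<in> I \<Longrightarrow> g p (\<xi> \<alpha> p) (\<xi> \<alpha> p) = \<epsilon> \<alpha>"
  using g_xi_xi by (simp add: I_def)

lemma gff: "gff_structure A n s \<phi> \<xi> \<eta>"
  and normal: "normal_gff A s \<phi> \<xi> \<eta>"
  and compatible: "compatible_metric A s \<phi> \<xi> \<eta> g"
  using S_manifold by (auto simp: indefinite_S_manifold_def)

lemma phi_linear: "linear_to (T p) (T p) (\<phi> p)"
  using gff by (simp add: gff_structure_def tensor11_def)

lemma phi_T [simp, intro]: "x \<in> T p \<Longrightarrow> \<phi> p x \<in> T p"
  and phi_add [simp]: "x \<in> T p \<Longrightarrow> y \<in> T p \<Longrightarrow> \<phi> p (x + y) = \<phi> p x + \<phi> p y"
  and phi_scale [simp]: "x \<in> T p \<Longrightarrow> \<phi> p (c *\<^sub>R x) = c *\<^sub>R \<phi> p x"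
  using phi_linear by (auto simp: linear_to_def)

lemma phi_0 [simp]: "\<phi> p 0 = 0"
  using phi_scale[of 0 p 0] by simp

lemma phi_neg [simp]: "x \<in> T p \<Longrightarrow> \<phi> p (- x) = - \<phi> p x"
  using phi_scale[of x p "-1"] by simp

lemma phi_diff [simp]: "x \<in> T p \<Longrightarrow> y \<in> T p \<Longrightarrow> \<phi> p (x - y) = \<phi> p x - \<phi> p y"
  using phi_add[of x p "- y"] by (simp del: phi_add)

lemma F_vf [simp, intro]: "X \<in> VF \<Longrightarrow> F X \<in> VF"
  using gff by (simp add: gff_structure_def tensor11_def)

lemma xi_vf [simp, intro]: "\<alpha> \<in> I \<Longrightarrow> \<xi> \<alpha> \<in> VF"
  using gff unfolding gff_structure_def I_def by blast

lemma xi_T [simp, intro]: "\<alpha> \<in> I \<Longrightarrow> \<xi> \<alpha> p \<in> T p"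
  by (rule vf_tangent) (rule xi_vf)

lemma phi_xi [simp]: "\<alpha> \<in> I \<Longrightarrow> \<phi> p (\<xi> \<alpha> p) = 0"
proof -
  assume "\<alpha> \<in> I"
  then have "\<xi> \<alpha> p \<in> span ((\<lambda>\<alpha>. \<xi> \<alpha> p) ` I)" by (intro span_base) auto
  moreover have "span ((\<lambda>\<alpha>. \<xi> \<alpha> p) ` I) = {v \<in> T p. \<phi> p v = 0}"
    using gff unfolding gff_structure_def I_def by blast
  ultimately show ?thesis by auto
qed

lemma F_xi [simp]: "\<alpha> \<in> I \<Longrightarrow> F (\<xi> \<alpha>) = 0"
  by (rule ext) simp

lemma eta_linear: "\<alpha> \<in> I \<Longrightarrow> linear_to (T p) UNIV (\<eta> \<alpha> p)"
  and eta_smooth [simp, intro]: "\<alpha> \<in> I \<Longrightarrow> X \<in> VF \<Longrightarrow> smooth_fun A (\<lambda>q. \<eta> \<alpha> q (X q))"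
  using gff unfolding gff_structure_def I_def one_form_def by blast+

lemma eta_xi [simp]: "\<alpha> \<in> I \<Longrightarrow> \<beta> \<in> I \<Longrightarrow> \<eta> \<alpha> p (\<xi> \<beta> p) = (if \<alpha> = \<beta> then 1 else 0)"
  using gff unfolding gff_structure_def I_def by blast

lemma phi_phi: "x \<in> T p \<Longrightarrow> \<phi> p (\<phi> p x) = - x + (\<Sum>\<alpha>\<in>I. \<eta> \<alpha> p x *\<^sub>R \<xi> \<alpha> p)"
  using gff unfolding gff_structure_def I_def by blast

lemma phi_phi_phi [simp]: "x \<in> T p \<Longrightarrow> \<phi> p (\<phi> p (\<phi> p x)) = - \<phi> p x"
  using gff unfolding gff_structure_def eq_neg_iff_add_eq_0 by blast

lemma eps_sq [simp]: "\<alpha> \<in> I \<Longrightarrow> \<epsilon> \<alpha> * \<epsilon> \<alpha> = 1"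
proof -
  assume a: "\<alpha> \<in> I"
  \<comment> \<open>Any point serves, as the sign does not depend on it.\<close>
  have "g undefined (\<xi> \<alpha> undefined) (\<xi> \<alpha> undefined) = 1 \<or> g undefined (\<xi> \<alpha> undefined) (\<xi> \<alpha> undefined) = -1"
    using compatible a unfolding compatible_metric_def I_def by blast
  then show ?thesis using eps[OF a] by auto
qed

lemma g_phi_phi: "x \<in> T p \<Longrightarrow> y \<in> T p \<Longrightarrow>
    g p (\<phi> p x) (\<phi> p y) = g p x y - (\<Sum>\<alpha>\<in>I. \<epsilon> \<alpha> * \<eta> \<alpha> p x * \<eta> \<alpha> p y)"
  using compatible unfolding compatible_metric_def I_def[symmetric] by (simp add: eps)

text \<open>Compatibility is applied to \<open>x\<close> and \<open>\<xi> \<alpha> p\<close>: \<phi>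
  annihilates the second argument, so the left-hand side vanishes.\<close>

lemma g_xi: assumes "\<alpha> \<in> I" "x \<in> T p" shows "g p x (\<xi> \<alpha> p) = \<epsilon> \<alpha> * \<eta> \<alpha> p x"
proof -
  have "(\<Sum>\<beta>\<in>I. \<epsilon> \<beta> * \<eta> \<beta> p x * \<eta> \<beta> p (\<xi> \<alpha> p)) = (\<Sum>\<beta>\<in>I. if \<beta> = \<alpha> then \<epsilon> \<beta> * \<eta> \<beta> p x else 0)"
    by (intro sum.cong) (use assms in auto)
  then show ?thesis using g_phi_phi[of x p "\<xi> \<alpha> p"] assms by simp
qed

lemma eta_eq: "\<alpha> \<in> I \<Longrightarrow> x \<in> T p \<Longrightarrow> \<eta> \<alpha> p x = \<epsilon> \<alpha> * g p x (\<xi> \<alpha> p)"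
  by (simp add: g_xi mult.assoc[symmetric])

text \<open>By \<phi>^3 = - \<phi>, the formula for \<phi>^2 applied to \<phi> x leaves a vanishing
  combination of the characteristic vectors; pairing with one of them isolates its
  coefficient.\<close>

lemma eta_phi [simp]:
  assumes \<alpha>: "\<alpha> \<in> I" and x: "x \<in> T p" shows "\<eta> \<alpha> p (\<phi> p x) = 0"
proof -
  have z: "(\<Sum>\<beta>\<in>I. \<eta> \<beta> p (\<phi> p x) *\<^sub>R \<xi> \<beta> p) = 0"
    using phi_phi[of "\<phi> p x" p] x by simp
  have o: "g p (\<xi> \<beta> p) (\<xi> \<alpha> p) = (if \<beta> = \<alpha> then \<epsilon> \<alpha> else 0)" if "\<beta> \<in> I" for \<beta>
    using that \<alpha> by (simp add: g_xi)
  have "g p (\<Sum>\<beta>\<in>I. \<eta> \<beta> p (\<phi> p x) *\<^sub>R \<xi> \<beta> p) (\<xi> \<alpha> p) =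
      (\<Sum>\<beta>\<in>I. g p (\<eta> \<beta> p (\<phi> p x) *\<^sub>R \<xi> \<beta> p) (\<xi> \<alpha> p))"
    by (rule g_sum_left) (use \<alpha> in auto)
  also have "\<dots> = (\<Sum>\<beta>\<in>I. if \<beta> = \<alpha> then \<epsilon> \<alpha> * \<eta> \<alpha> p (\<phi> p x) else 0)"
    by (rule sum.cong) (use \<alpha> in \<open>auto simp: o\<close>)
  finally have "\<epsilon> \<alpha> * \<eta> \<alpha> p (\<phi> p x) = 0" using z \<alpha> by simp
  then have "\<epsilon> \<alpha> * \<epsilon> \<alpha> * \<eta> \<alpha> p (\<phi> p x) = 0" by simp
  then show ?thesis unfolding eps_sq[OF \<alpha>] by simp
qed

lemma g_phi_xi [simp]: "\<alpha> \<in> I \<Longrightarrow> x \<in> T p \<Longrightarrow> g p (\<phi> p x) (\<xi> \<alpha> p) = 0"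
  and g_xi_phi [simp]: "\<alpha> \<in> I \<Longrightarrow> x \<in> T p \<Longrightarrow> g p (\<xi> \<alpha> p) (\<phi> p x) = 0"
  using g_sym[of "\<xi> \<alpha> p" p "\<phi> p x"] by (simp_all add: g_xi)

text \<open>The value g(\<phi> x, \<phi>^2 y) is computed twice, by compatibility and by the formula
  for \<phi>^2.\<close>

lemma phi_skew: assumes x: "x \<in> T p" and y: "y \<in> T p" shows "g p (\<phi> p x) y = - g p x (\<phi> p y)"
proof -
  have "g p (\<phi> p x) (\<phi> p (\<phi> p y)) = g p x (\<phi> p y)"
    using g_phi_phi[OF x phi_T[OF y]] y by simp
  moreover have "g p (\<phi> p x) (\<phi> p (\<phi> p y)) = - g p (\<phi> p x) y"
    unfolding phi_phi[OF y] using x y by (simp add: g_sum_right g_xi)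
  ultimately show ?thesis by simp
qed

section \<open>Invariance of \<eta>, \<phi>, \<Phi> and g under the characteristic fields\<close>

lemma d_eta:
  assumes "\<alpha> \<in> I" "X \<in> VF" "Y \<in> VF"
  shows "X p (\<lambda>q. \<eta> \<alpha> q (Y q)) - Y p (\<lambda>q. \<eta> \<alpha> q (X q)) - \<eta> \<alpha> p (lie_bracket X Y p)
    = 2 * g p (X p) (\<phi> p (Y p))"
  using S_manifold assms unfolding indefinite_S_manifold_def I_def[symmetric]
  by (simp add: ext_deriv_def)

lemma bracket_neg_right: "X \<in> VF \<Longrightarrow> Y \<in> VF \<Longrightarrow> lie_bracket X (- Y) = - lie_bracket X Y"
  by (simp add: torsion_free[symmetric] D_neg_left D_neg_right)

lemma bracket_0_right: "X \<in> VF \<Longrightarrow> lie_bracket X 0 = 0"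
  by (intro ext) (simp add: lie_bracket_def tangent_const0[OF vf_tangent])

text \<open>In d\<eta> = \<Phi> at the pair \<open>\<xi> \<alpha>\<close>, \<open>X\<close> both
  \<Phi> and the derivative of the constant value of \<eta> at \<open>\<xi> \<alpha>\<close> drop
  out. What remains says that \<eta> has vanishing Lie derivative along
  \<open>\<xi> \<alpha>\<close>.\<close>

lemma lie_eta:
  assumes "\<alpha> \<in> I" "\<beta> \<in> I" "X \<in> VF"
  shows "\<eta> \<beta> p (lie_bracket (\<xi> \<alpha>) X p) = \<xi> \<alpha> p (\<lambda>q. \<eta> \<beta> q (X q))"
  using d_eta[of \<beta> "\<xi> \<alpha>" X p] assms
  by (simp add: tangent_const0[OF vf_tangent])

text \<open>Normality at the pair \<open>X\<close>, \<open>\<xi> \<alpha>\<close> places the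
  difference \<open>V\<close> of both sides in the kernel of \<phi>. All forms \<eta> vanish on
  \<open>V\<close> by \<open>lie_eta\<close>, so the formula for \<phi>^2 gives V = 0. Thus \<phi>
  has vanishing Lie derivative along \<open>\<xi> \<alpha>\<close>.\<close>

lemma lie_phi:
  assumes \<alpha>: "\<alpha> \<in> I" and X: "X \<in> VF"
  shows "\<phi> p (lie_bracket (\<xi> \<alpha>) X p) = lie_bracket (\<xi> \<alpha>) (F X) p"
proof -
  note [simp] = \<alpha> X
  have [simp]: "lie_bracket U V q \<in> T q" if "U \<in> VF" "V \<in> VF" for U V q
    by (rule vf_tangent) (use that in simp)
  have F0: "(\<lambda>q. \<phi> q (\<xi> \<alpha> q)) = 0" by (rule F_xi) simp
  have "ext_deriv (\<eta> \<beta>) X (\<xi> \<alpha>) p = 0" if "\<beta> \<in> I" for \<beta>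
    using S_manifold that unfolding indefinite_S_manifold_def I_def[symmetric] by simp
  then have "(\<Sum>\<beta>\<in>I. ext_deriv (\<eta> \<beta>) X (\<xi> \<alpha>) p *\<^sub>R \<xi> \<beta> p) = 0" by (intro sum.neutral) simp
  moreover have "nijenhuis \<phi> X (\<xi> \<alpha>) p
      + 2 *\<^sub>R (\<Sum>\<beta>\<in>I. ext_deriv (\<eta> \<beta>) X (\<xi> \<alpha>) p *\<^sub>R \<xi> \<beta> p) = 0"
    using normal X xi_vf[OF \<alpha>] unfolding normal_gff_def I_def[symmetric] by blast
  ultimately have "nijenhuis \<phi> X (\<xi> \<alpha>) p = 0" by simp
  then have n: "\<phi> p (\<phi> p (lie_bracket X (\<xi> \<alpha>) p)) - \<phi> p (lie_bracket (F X) (\<xi> \<alpha>) p) = 0"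
    unfolding nijenhuis_def Let_def F0 by (simp add: bracket_0_right)
  define V where "V = \<phi> p (lie_bracket (\<xi> \<alpha>) X p) - lie_bracket (\<xi> \<alpha>) (F X) p"
  have V: "V \<in> T p" by (simp add: V_def)
  have "\<phi> p V = 0"
    using n unfolding V_def lie_bracket_skew[of X "\<xi> \<alpha>"] lie_bracket_skew[of "F X" "\<xi> \<alpha>"] by simp
  moreover have "\<eta> \<beta> p V = 0" if b: "\<beta> \<in> I" for \<beta>
  proof -
    have "\<eta> \<beta> p (lie_bracket (\<xi> \<alpha>) (F X) p) = 0"
      using b by (simp add: lie_eta tangent_const0[OF vf_tangent])
    then show ?thesis using b unfolding V_def by (simp add: eta_eq)
  qed
  ultimately have "V = 0" using phi_phi[OF V] by simp
  then show ?thesis by (simp add: V_def)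
qed

lemma bracket_T [simp, intro]: "X \<in> VF \<Longrightarrow> Y \<in> VF \<Longrightarrow> lie_bracket X Y q \<in> T q"
  by (rule vf_tangent) simp

lemma D_T [simp, intro]: "X \<in> VF \<Longrightarrow> Y \<in> VF \<Longrightarrow> D X Y q \<in> T q"
  by (rule vf_tangent) simp

lemma lie_xi_xi: assumes "\<alpha> \<in> I" "\<beta> \<in> I" shows "lie_bracket (\<xi> \<alpha>) (\<xi> \<beta>) = 0"
proof
  fix p
  have 1: "\<phi> p (lie_bracket (\<xi> \<alpha>) (\<xi> \<beta>) p) = 0"
    unfolding lie_phi[OF assms(1) xi_vf[OF assms(2)]] F_xi[OF assms(2)]
    using assms by (simp add: bracket_0_right)
  have "\<eta> \<gamma> p (lie_bracket (\<xi> \<alpha>) (\<xi> \<beta>) p) = 0" if "\<gamma> \<in> I" for \<gamma>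
    using assms that by (simp add: lie_eta tangent_const0[OF vf_tangent])
  then show "lie_bracket (\<xi> \<alpha>) (\<xi> \<beta>) p = 0 p"
    using phi_phi[of "lie_bracket (\<xi> \<alpha>) (\<xi> \<beta>) p" p] 1 assms by simp
qed

lemma eta_add: "\<alpha> \<in> I \<Longrightarrow> x \<in> T p \<Longrightarrow> y \<in> T p \<Longrightarrow> \<eta> \<alpha> p (x + y) = \<eta> \<alpha> p x + \<eta> \<alpha> p y"
  using eta_linear by (auto simp: linear_to_def)

text \<open>Since \<Phi> = d\<eta>, invariance of \<eta> passes to \<Phi>; that the Lie derivative
  commutes with d is here the Jacobi identity. By invariance of \<phi> the last bracket can be taken
  with \<phi> Y, the form in which \<open>killing\<close> uses it.\<close>

lemma lie_Phi:
  assumes [simp]: "\<alpha> \<in> I" "X \<in> VF" "Y \<in> VF"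
  shows "\<xi> \<alpha> p (\<lambda>q. g q (X q) (\<phi> q (Y q))) =
    g p (lie_bracket (\<xi> \<alpha>) X p) (\<phi> p (Y p)) + g p (X p) (lie_bracket (\<xi> \<alpha>) (F Y) p)"
proof -
  let ?h = "\<lambda>Z q. \<eta> \<alpha> q (Z q)"
  have sm: "smooth_fun A (\<lambda>q. U q (?h V))" if "U \<in> VF" "V \<in> VF" for U V
    by (rule vf_smooth[OF that(1)]) (use that in simp)
  have jac: "lie_bracket (\<xi> \<alpha>) (lie_bracket X Y) p =
      lie_bracket (lie_bracket (\<xi> \<alpha>) X) Y p + lie_bracket X (lie_bracket (\<xi> \<alpha>) Y) p"
  proof -
    have "(lie_bracket (\<xi> \<alpha>) (lie_bracket X Y) + lie_bracket X (lie_bracket Y (\<xi> \<alpha>))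
        + lie_bracket Y (lie_bracket (\<xi> \<alpha>) X)) p = 0"
      by (subst jacobi_identity) simp_all
    moreover have "lie_bracket X (lie_bracket Y (\<xi> \<alpha>)) = - lie_bracket X (lie_bracket (\<xi> \<alpha>) Y)"
      unfolding lie_bracket_skew[of Y "\<xi> \<alpha>"] by (rule bracket_neg_right) simp_all
    ultimately show ?thesis by (simp add: lie_bracket_skew[of Y] add_eq_0_iff algebra_simps)
  qed
  have "(\<lambda>q. 2 * g q (X q) (\<phi> q (Y q))) = (\<lambda>q. X q (?h Y) - Y q (?h X) - ?h (lie_bracket X Y) q)"
    using d_eta[of \<alpha> X Y] by simp
  then have "\<xi> \<alpha> p (\<lambda>q. 2 * g q (X q) (\<phi> q (Y q))) =
      \<xi> \<alpha> p (\<lambda>q. X q (?h Y) - Y q (?h X) - ?h (lie_bracket X Y) q)" by simp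
  also have "\<dots> = \<xi> \<alpha> p (\<lambda>q. X q (?h Y)) - \<xi> \<alpha> p (\<lambda>q. Y q (?h X)) - \<xi> \<alpha> p (?h (lie_bracket X Y))"
    using tangent_diffF[OF xi_T[of \<alpha>]] sm smooth_fun_diff by simp
  also have "\<xi> \<alpha> p (?h (lie_bracket X Y)) = \<eta> \<alpha> p (lie_bracket (\<xi> \<alpha>) (lie_bracket X Y) p)"
    by (simp add: lie_eta)
  also have "\<eta> \<alpha> p (lie_bracket (\<xi> \<alpha>) (lie_bracket X Y) p) =
      \<eta> \<alpha> p (lie_bracket (lie_bracket (\<xi> \<alpha>) X) Y p) + \<eta> \<alpha> p (lie_bracket X (lie_bracket (\<xi> \<alpha>) Y) p)"
  proof (subst eta_add[symmetric])
    show "\<eta> \<alpha> p (lie_bracket (\<xi> \<alpha>) (lie_bracket X Y) p) =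
        \<eta> \<alpha> p (lie_bracket (lie_bracket (\<xi> \<alpha>) X) Y p + lie_bracket X (lie_bracket (\<xi> \<alpha>) Y) p)"
      by (rule arg_cong[OF jac])
  qed simp_all
  finally have 1: "\<xi> \<alpha> p (\<lambda>q. 2 * g q (X q) (\<phi> q (Y q))) =
     \<xi> \<alpha> p (\<lambda>q. X q (?h Y)) - \<xi> \<alpha> p (\<lambda>q. Y q (?h X))
     - (\<eta> \<alpha> p (lie_bracket (lie_bracket (\<xi> \<alpha>) X) Y p) + \<eta> \<alpha> p (lie_bracket X (lie_bracket (\<xi> \<alpha>) Y) p))" .
  have 2: "\<xi> \<alpha> p (\<lambda>q. 2 * g q (X q) (\<phi> q (Y q))) = 2 * \<xi> \<alpha> p (\<lambda>q. g q (X q) (\<phi> q (Y q)))"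
    by (rule tangent_cmultF[OF xi_T]) auto
  have 3: "(\<xi> \<alpha> p (\<lambda>q. X q (?h Y)) - X p (\<lambda>q. \<xi> \<alpha> q (?h Y))) - Y p (\<lambda>q. \<xi> \<alpha> q (?h X))
      - \<eta> \<alpha> p (lie_bracket (lie_bracket (\<xi> \<alpha>) X) Y p) = 2 * g p (lie_bracket (\<xi> \<alpha>) X p) (\<phi> p (Y p))"
    using d_eta[of \<alpha> "lie_bracket (\<xi> \<alpha>) X" Y p]
    by (simp add: lie_eta) (simp add: lie_bracket_def)
  have 4: "X p (\<lambda>q. \<xi> \<alpha> q (?h Y)) - (\<xi> \<alpha> p (\<lambda>q. Y q (?h X)) - Y p (\<lambda>q. \<xi> \<alpha> q (?h X)))
      - \<eta> \<alpha> p (lie_bracket X (lie_bracket (\<xi> \<alpha>) Y) p) = 2 * g p (X p) (lie_bracket (\<xi> \<alpha>) (F Y) p)"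
    using d_eta[of \<alpha> X "lie_bracket (\<xi> \<alpha>) Y" p]
    by (simp add: lie_eta lie_phi) (simp add: lie_bracket_def)
  show ?thesis using 1 2 3 4 by linarith
qed

lemma D_sum_left:
  assumes "\<And>i. i \<in> J \<Longrightarrow> X i \<in> VF" "Y \<in> VF"
  shows "D (\<Sum>i\<in>J. X i) Y = (\<Sum>i\<in>J. D (X i) Y)"
  using assms(1)
proof (induction J rule: infinite_finite_induct)
  case (insert x J)
  have "D (X x + sum X J) Y = D (X x) Y + D (sum X J) Y"
    by (rule D_add_left) (use insert assms(2) in \<open>auto intro: vf_sum\<close>)
  then show ?case unfolding sum.insert[OF insert.hyps(1,2)] using insert by (simp only:) simp
qed (simp_all add: D_0_left assms)

text \<open>By freedom from torsion the left-hand side is the Lie derivative of g along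
  \<open>\<xi> \<alpha>\<close>. Against \<phi> Y it vanishes because \<Phi> and \<phi> are
  invariant, against \<open>\<xi> \<beta>\<close> because \<open>\<eta> \<beta>\<close> is invariant
  and characteristic fields commute. Both sides being linear in Z over functions, the splitting of Z
  by the formula for \<phi>^2 covers every Z.\<close>

lemma killing:
  assumes [simp]: "\<alpha> \<in> I" "X \<in> VF" "Z \<in> VF"
  shows "g p (D X (\<xi> \<alpha>) p) (Z p) + g p (X p) (D Z (\<xi> \<alpha>) p) = 0"
proof -
  have S: "g p (D X (\<xi> \<alpha>) p) (Z p) + g p (X p) (D Z (\<xi> \<alpha>) p) =
      \<xi> \<alpha> p (\<lambda>q. g q (X q) (Z q)) - g p (lie_bracket (\<xi> \<alpha>) X p) (Z p) - g p (X p) (lie_bracket (\<xi> \<alpha>) Z p)"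
    if [simp]: "Z \<in> VF" for Z
    by (simp add: metric_compat torsion_free_at[of "\<xi> \<alpha>"])
  have 1: "g p (D X (\<xi> \<alpha>) p) (\<phi> p (Y p)) + g p (X p) (D (F Y) (\<xi> \<alpha>) p) = 0" if [simp]: "Y \<in> VF" for Y
    using S[of "F Y"] by (simp add: lie_Phi)
  have 2: "g p (D X (\<xi> \<alpha>) p) (\<xi> \<beta> p) + g p (X p) (D (\<xi> \<beta>) (\<xi> \<alpha>) p) = 0" if [simp]: "\<beta> \<in> I" for \<beta>
  proof -
    have "\<xi> \<alpha> p (\<lambda>q. g q (X q) (\<xi> \<beta> q)) = \<epsilon> \<beta> * \<xi> \<alpha> p (\<lambda>q. \<eta> \<beta> q (X q))"
      using tangent_cmultF[OF xi_T[of \<alpha>], where c = "\<epsilon> \<beta>"] by (simp add: g_xi)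
    then show ?thesis using S[of "\<xi> \<beta>"] by (simp add: lie_xi_xi g_xi lie_eta)
  qed
  let ?N = "\<Sum>\<beta>\<in>I. (\<lambda>q. \<eta> \<beta> q (Z q) *\<^sub>R \<xi> \<beta> q)"
  have Z: "Z = - F (F Z) + ?N"
    by (rule ext) (simp add: phi_phi sum_fun_apply)
  have N: "?N \<in> VF" by (intro vf_sum vf_scale) simp_all
  have "D Z (\<xi> \<alpha>) = - D (F (F Z)) (\<xi> \<alpha>) + D ?N (\<xi> \<alpha>)"
    by (subst Z, subst D_add_left) (simp_all add: D_neg_left N)
  also have "D ?N (\<xi> \<alpha>) = (\<Sum>\<beta>\<in>I. (\<lambda>q. \<eta> \<beta> q (Z q) *\<^sub>R D (\<xi> \<beta>) (\<xi> \<alpha>) q))"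
    by (subst D_sum_left) (auto simp: D_scale_left intro!: sum.cong)
  finally have DZ0: "D Z (\<xi> \<alpha>) =
      - D (F (F Z)) (\<xi> \<alpha>) + (\<Sum>\<beta>\<in>I. (\<lambda>q. \<eta> \<beta> q (Z q) *\<^sub>R D (\<xi> \<beta>) (\<xi> \<alpha>) q))" .
  have DZ: "D Z (\<xi> \<alpha>) p = - D (F (F Z)) (\<xi> \<alpha>) p + (\<Sum>\<beta>\<in>I. \<eta> \<beta> p (Z p) *\<^sub>R D (\<xi> \<beta>) (\<xi> \<alpha>) p)"
    by (simp only: DZ0 plus_fun_apply uminus_apply sum_fun_apply[where x = p])
  have Zp: "Z p = - \<phi> p (\<phi> p (Z p)) + (\<Sum>\<beta>\<in>I. \<eta> \<beta> p (Z p) *\<^sub>R \<xi> \<beta> p)"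
    by (simp add: phi_phi)
  have "g p (D X (\<xi> \<alpha>) p) (Z p) = - g p (D X (\<xi> \<alpha>) p) (\<phi> p (\<phi> p (Z p)))
      + (\<Sum>\<beta>\<in>I. \<eta> \<beta> p (Z p) * g p (D X (\<xi> \<alpha>) p) (\<xi> \<beta> p))"
    by (subst Zp) (simp add: g_sum_right)
  moreover have "g p (X p) (D Z (\<xi> \<alpha>) p) = - g p (X p) (D (F (F Z)) (\<xi> \<alpha>) p)
      + (\<Sum>\<beta>\<in>I. \<eta> \<beta> p (Z p) * g p (X p) (D (\<xi> \<beta>) (\<xi> \<alpha>) p))"
    unfolding DZ by (simp add: g_sum_right)
  moreover have "(\<Sum>\<beta>\<in>I. \<eta> \<beta> p (Z p) * g p (D X (\<xi> \<alpha>) p) (\<xi> \<beta> p))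
      + (\<Sum>\<beta>\<in>I. \<eta> \<beta> p (Z p) * g p (X p) (D (\<xi> \<beta>) (\<xi> \<alpha>) p)) = 0"
    unfolding sum.distrib[symmetric] distrib_left[symmetric] by (rule sum.neutral) (use 2 in auto)
  ultimately show ?thesis using 1[of "F Z"] by simp
qed

text \<open>The Killing equation removes the symmetric part of the covariant derivative of
  \<open>\<xi> \<alpha>\<close>, and the skew part is d\<eta> = \<Phi>. The sign stems from the
  conversion between \<open>\<eta> \<alpha>\<close> and g(., \<xi>_\<alpha>).\<close>

lemma D_xi:
  assumes [simp]: "\<alpha> \<in> I" "X \<in> VF"
  shows "D X (\<xi> \<alpha>) p = - \<epsilon> \<alpha> *\<^sub>R \<phi> p (X p)"
proof (rule g_eqI)
  fix w assume "w \<in> T p"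
  then obtain Y where Y [simp]: "Y \<in> VF" and w: "Y p = w" by (rule extend_tangent)
  have X: "U p (\<lambda>q. \<eta> \<alpha> q (V q)) = \<epsilon> \<alpha> * (g p (D U V p) (\<xi> \<alpha> p) + g p (V p) (D U (\<xi> \<alpha>) p))"
    if [simp]: "U \<in> VF" "V \<in> VF" for U V
    using tangent_cmultF[OF vf_tangent[OF that(1)], where c = "\<epsilon> \<alpha>"] by (simp add: eta_eq metric_compat)
  have "\<epsilon> \<alpha> * (g p (Y p) (D X (\<xi> \<alpha>) p) - g p (X p) (D Y (\<xi> \<alpha>) p)) = 2 * g p (X p) (\<phi> p (Y p))"
  proof -
    have "\<eta> \<alpha> p (lie_bracket X Y p) = \<epsilon> \<alpha> * (g p (D X Y p) (\<xi> \<alpha> p) - g p (D Y X p) (\<xi> \<alpha> p))"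
      by (simp add: eta_eq torsion_free_at[of X Y])
    then show ?thesis using d_eta[of \<alpha> X Y p] by (simp add: X algebra_simps)
  qed
  moreover have "g p (X p) (D Y (\<xi> \<alpha>) p) = - g p (Y p) (D X (\<xi> \<alpha>) p)"
    using killing[of \<alpha> X Y p] g_sym[of "D X (\<xi> \<alpha>) p" p "Y p"] by simp
  ultimately have "\<epsilon> \<alpha> * g p (Y p) (D X (\<xi> \<alpha>) p) = - g p (\<phi> p (X p)) (Y p)"
    by (simp add: phi_skew[of _ p "Y p"])
  then have "\<epsilon> \<alpha> * \<epsilon> \<alpha> * g p (D X (\<xi> \<alpha>) p) (Y p) = - \<epsilon> \<alpha> * g p (\<phi> p (X p)) (Y p)"
    using g_sym[of "D X (\<xi> \<alpha>) p" p "Y p"] by (simp only: mult.assoc) simp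
  then show "g p (D X (\<xi> \<alpha>) p) w = g p (- \<epsilon> \<alpha> *\<^sub>R \<phi> p (X p)) w"
    using w[symmetric] by simp
qed simp_all

end

section \<open>Covariant derivative of \<phi> and curvature in characteristic directions\<close>

context S_manifold
begin

text \<open>This is the form \<open>\<Sum>\<^sub>\<alpha> \<epsilon>\<^sub>\<alpha> \<eta>\<^sup>\<alpha>\<close>, since \<open>g(x, \<xi>\<^sub>\<alpha>) = \<epsilon>\<^sub>\<alpha> \<eta>\<^sup>\<alpha>(x)\<close>.\<close>

definition etat :: "'a \<Rightarrow> 'a tvec \<Rightarrow> real" where
  "etat p x = (\<Sum>\<alpha>\<in>I. g p x (\<xi> \<alpha> p))"

lemma etat_add [simp]: "x \<in> T p \<Longrightarrow> y \<in> T p \<Longrightarrow> etat p (x + y) = etat p x + etat p y"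
  and etat_scale [simp]: "x \<in> T p \<Longrightarrow> etat p (c *\<^sub>R x) = c * etat p x"
  and etat_phi [simp]: "x \<in> T p \<Longrightarrow> etat p (\<phi> p x) = 0"
  by (simp_all add: etat_def sum.distrib sum_distrib_left)

lemma etat_xi: "\<alpha> \<in> I \<Longrightarrow> etat p (\<xi> \<alpha> p) = \<epsilon> \<alpha>"
proof -
  assume a: "\<alpha> \<in> I"
  have "etat p (\<xi> \<alpha> p) = (\<Sum>\<beta>\<in>I. if \<beta> = \<alpha> then \<epsilon> \<alpha> else 0)"
    unfolding etat_def by (intro sum.cong) (use a in \<open>auto simp: g_xi\<close>)
  then show ?thesis using a by simp
qed

text \<open>The covariant derivative \<open>(\<nabla>\<^sub>X \<phi>) Y\<close>.\<close>

definition dphi :: "'a vfield \<Rightarrow> 'a vfield \<Rightarrow> 'a vfield" where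
  "dphi X Y p = D X (F Y) p - \<phi> p (D X Y p)"

lemma dphi_T [simp, intro]: "X \<in> VF \<Longrightarrow> Y \<in> VF \<Longrightarrow> dphi X Y p \<in> T p"
  by (simp add: dphi_def)

lemma D_F: "D X (F Y) p = dphi X Y p + \<phi> p (D X Y p)"
  by (simp add: dphi_def)

text \<open>The skew symmetry g(\<phi> Y, Z) = - g(Y, \<phi> Z) is differentiated along X.\<close>

lemma dphi_skew:
  assumes [simp]: "X \<in> VF" "Y \<in> VF" "Z \<in> VF"
  shows "g p (dphi X Y p) (Z p) = - g p (dphi X Z p) (Y p)"
proof -
  have eq: "(\<lambda>q. g q (\<phi> q (Y q)) (Z q)) = (\<lambda>q. -1 * g q (Y q) (\<phi> q (Z q)))"
    by (simp add: phi_skew)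
  have "X p (\<lambda>q. g q (\<phi> q (Y q)) (Z q)) = - X p (\<lambda>q. g q (Y q) (\<phi> q (Z q)))"
    unfolding eq by (subst tangent_cmultF[of _ A p]) auto
  then have "g p (D X (F Y) p) (Z p) + g p (\<phi> p (Y p)) (D X Z p)
      = - (g p (D X Y p) (\<phi> p (Z p)) + g p (Y p) (D X (F Z) p))"
    by (simp add: metric_compat[of X "F Y" Z] metric_compat[of X Y "F Z"])
  then show ?thesis
    by (simp add: D_F phi_skew[of "Y p"] phi_skew[of "D X Y p"] g_sym[of "Y p" p "dphi X Z p"])
qed

text \<open>Being the exact form d\<eta>, \<Phi> is closed; the statement is d\<Phi> = 0 spelled out
  with brackets, and d d = 0 amounts to the Jacobi identity.\<close>

lemma d_Phi:
  assumes [simp]: "X \<in> VF" "Y \<in> VF" "Z \<in> VF"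
  shows "X p (\<lambda>q. g q (Y q) (\<phi> q (Z q))) + Y p (\<lambda>q. g q (Z q) (\<phi> q (X q)))
      + Z p (\<lambda>q. g q (X q) (\<phi> q (Y q))) =
    g p (lie_bracket X Y p) (\<phi> p (Z p)) + g p (lie_bracket Y Z p) (\<phi> p (X p))
      + g p (lie_bracket Z X p) (\<phi> p (Y p))"
proof -
  \<comment> \<open>All the forms \<eta> have the same differential, so any index serves.\<close>
  obtain \<iota> where i [simp]: "\<iota> \<in> I" using s_pos by (auto simp: I_def)
  let ?h = "\<lambda>Z q. \<eta> \<iota> q (Z q)"
  have sm: "smooth_fun A (\<lambda>q. U q (?h V))" if "U \<in> VF" "V \<in> VF" for U V
    by (rule vf_smooth[OF that(1)]) (use that in simp)
  have a: "2 * W p (\<lambda>q. g q (U q) (\<phi> q (V q))) =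
      W p (\<lambda>q. U q (?h V)) - W p (\<lambda>q. V q (?h U)) - W p (?h (lie_bracket U V))"
    if [simp]: "U \<in> VF" "V \<in> VF" "W \<in> VF" for U V W
  proof -
    have eq: "(\<lambda>q. 2 * g q (U q) (\<phi> q (V q))) = (\<lambda>q. U q (?h V) - V q (?h U) - ?h (lie_bracket U V) q)"
      using d_eta[of \<iota> U V] by simp
    have "2 * W p (\<lambda>q. g q (U q) (\<phi> q (V q))) = W p (\<lambda>q. 2 * g q (U q) (\<phi> q (V q)))"
      by (rule tangent_cmultF[OF vf_tangent, symmetric]) auto
    also have "\<dots> = W p (\<lambda>q. U q (?h V)) - W p (\<lambda>q. V q (?h U)) - W p (?h (lie_bracket U V))"
      unfolding eq using tangent_diffF[OF vf_tangent[OF that(3)]] sm smooth_fun_diff by simp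
    finally show ?thesis .
  qed
  have b: "2 * g p (lie_bracket U V p) (\<phi> p (W p)) =
      U p (\<lambda>q. V q (?h W)) - V p (\<lambda>q. U q (?h W)) - W p (?h (lie_bracket U V))
      - \<eta> \<iota> p (lie_bracket (lie_bracket U V) W p)"
    if [simp]: "U \<in> VF" "V \<in> VF" "W \<in> VF" for U V W
  proof -
    have "lie_bracket U V p (?h W) = U p (\<lambda>q. V q (?h W)) - V p (\<lambda>q. U q (?h W))"
      by (simp add: lie_bracket_def)
    then show ?thesis using d_eta[of \<iota> "lie_bracket U V" W p] by simp
  qed
  have "lie_bracket (lie_bracket X Y) Z + lie_bracket (lie_bracket Y Z) X
      + lie_bracket (lie_bracket Z X) Y =
      - (lie_bracket X (lie_bracket Y Z) + lie_bracket Y (lie_bracket Z X) + lie_bracket Z (lie_bracket X Y))"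
    unfolding lie_bracket_skew[of "lie_bracket X Y" Z] lie_bracket_skew[of "lie_bracket Y Z" X]
      lie_bracket_skew[of "lie_bracket Z X" Y] by simp
  then have "lie_bracket (lie_bracket X Y) Z + lie_bracket (lie_bracket Y Z) X
      + lie_bracket (lie_bracket Z X) Y = 0"
    unfolding jacobi_identity[OF assms] by simp
  then have "(lie_bracket (lie_bracket X Y) Z + lie_bracket (lie_bracket Y Z) X
      + lie_bracket (lie_bracket Z X) Y) p = 0" by simp
  then have "\<eta> \<iota> p (lie_bracket (lie_bracket X Y) Z p + lie_bracket (lie_bracket Y Z) X p
      + lie_bracket (lie_bracket Z X) Y p) = 0"
    unfolding plus_fun_apply by (simp only:) (simp add: eta_eq)
  then have "\<eta> \<iota> p (lie_bracket (lie_bracket X Y) Z p) + \<eta> \<iota> p (lie_bracket (lie_bracket Y Z) X p)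
      + \<eta> \<iota> p (lie_bracket (lie_bracket Z X) Y p) = 0"
    by (subst (asm) eta_add, simp, simp, simp, subst (asm) eta_add, simp_all)
  then show ?thesis
    using a[of Y Z X] a[of Z X Y] a[of X Y Z] b[of X Y Z] b[of Y Z X] b[of Z X Y]
    by simp
qed

text \<open>For a torsion-free connection the cyclic sum of the covariant derivative of \<Phi> is
  d\<Phi> up to a constant factor, and \<Phi> is closed.\<close>

lemma dphi_cyclic:
  assumes [simp]: "X \<in> VF" "Y \<in> VF" "Z \<in> VF"
  shows "g p (dphi X Z p) (Y p) + g p (dphi Y X p) (Z p) + g p (dphi Z Y p) (X p) = 0"
proof -
  have a: "U p (\<lambda>q. g q (V q) (\<phi> q (W q))) =
      g p (D U V p) (\<phi> p (W p)) + g p (dphi U W p) (V p) - g p (D U W p) (\<phi> p (V p))"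
    if [simp]: "U \<in> VF" "V \<in> VF" "W \<in> VF" for U V W
    using g_sym[of "V p" p "dphi U W p"] g_sym[of "V p" p "\<phi> p (D U W p)"] phi_skew[of "D U W p" p "V p"]
    by (simp add: metric_compat[of U V "F W"] D_F)
  have b: "lie_bracket U V p = D U V p - D V U p" if "U \<in> VF" "V \<in> VF" for U V
    using torsion_free_at[OF that, of p] by simp
  show ?thesis
    using d_Phi[of X Y Z p] by (simp add: a b)
qed

text \<open>With brackets replaced by covariant derivatives, the Nijenhuis torsion becomes an
  expression in the derivative of \<phi> alone. After pairing with Z, an outer \<phi> moves onto Z,
  and the terms d\<eta> = \<Phi> add up to a multiple of \<open>etat\<close>.\<close>

lemma dphi_normal:
  assumes [simp]: "X \<in> VF" "Y \<in> VF" "Z \<in> VF"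
  shows "g p (dphi (F X) Y p) (Z p) - g p (dphi (F Y) X p) (Z p) - g p (dphi Y X p) (\<phi> p (Z p))
    + g p (dphi X Y p) (\<phi> p (Z p)) + 2 * g p (X p) (\<phi> p (Y p)) * etat p (Z p) = 0"
proof -
  have "nijenhuis \<phi> X Y p + 2 *\<^sub>R (\<Sum>\<alpha>\<in>I. ext_deriv (\<eta> \<alpha>) X Y p *\<^sub>R \<xi> \<alpha> p) = 0"
    using normal assms unfolding normal_gff_def I_def[symmetric] by blast
  moreover have "(\<Sum>\<alpha>\<in>I. ext_deriv (\<eta> \<alpha>) X Y p *\<^sub>R \<xi> \<alpha> p) =
      (\<Sum>\<alpha>\<in>I. g p (X p) (\<phi> p (Y p)) *\<^sub>R \<xi> \<alpha> p)"
    using S_manifold unfolding indefinite_S_manifold_def I_def[symmetric] by (intro sum.cong) auto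
  moreover have "nijenhuis \<phi> X Y p = dphi (F X) Y p - dphi (F Y) X p + \<phi> p (dphi Y X p) - \<phi> p (dphi X Y p)"
  proof -
    have b: "lie_bracket U V p = D U V p - D V U p" if "U \<in> VF" "V \<in> VF" for U V
      using torsion_free_at[OF that, of p] by simp
    show ?thesis
      by (simp add: nijenhuis_def Let_def b) (simp add: dphi_def algebra_simps)
  qed
  ultimately have "dphi (F X) Y p - dphi (F Y) X p + \<phi> p (dphi Y X p) - \<phi> p (dphi X Y p)
      + 2 *\<^sub>R (\<Sum>\<alpha>\<in>I. g p (X p) (\<phi> p (Y p)) *\<^sub>R \<xi> \<alpha> p) = 0" by simp
  then have "g p (dphi (F X) Y p - dphi (F Y) X p + \<phi> p (dphi Y X p) - \<phi> p (dphi X Y p)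
      + 2 *\<^sub>R (\<Sum>\<alpha>\<in>I. g p (X p) (\<phi> p (Y p)) *\<^sub>R \<xi> \<alpha> p)) (Z p) = 0" by simp
  then show ?thesis
    by (simp add: g_sum_left phi_skew[of "dphi _ _ _"] etat_def g_sym[of "\<xi> _ p" p "Z p"]
        sum_distrib_left algebra_simps)
qed

lemma D_sum_right:
  assumes "\<And>i. i \<in> J \<Longrightarrow> X i \<in> VF" "Y \<in> VF"
  shows "D Y (\<Sum>i\<in>J. X i) = (\<Sum>i\<in>J. D Y (X i))"
  using assms(1)
proof (induction J rule: infinite_finite_induct)
  case (insert x J)
  have "D Y (X x + sum X J) = D Y (X x) + D Y (sum X J)"
    by (rule D_add_right) (use insert assms(2) in \<open>auto intro: vf_sum\<close>)
  then show ?case unfolding sum.insert[OF insert.hyps(1,2)] using insert by (simp only:) simp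
qed (simp_all add: D_0_right assms)

text \<open>This is the covariant derivative of the formula for \<phi>^2. The two terms on the right
  come from differentiating the forms \<eta> and the fields \<xi>, both evaluated by
  \<open>D_xi\<close>.\<close>

lemma dphi_phi:
  assumes [simp]: "X \<in> VF" "Y \<in> VF" "Z \<in> VF"
  shows "g p (dphi X (F Y) p) (Z p) - g p (dphi X Y p) (\<phi> p (Z p)) =
    - g p (\<phi> p (X p)) (Y p) * etat p (Z p) - etat p (Y p) * g p (\<phi> p (X p)) (Z p)"
proof -
  let ?N = "\<Sum>\<beta>\<in>I. (\<lambda>q. \<eta> \<beta> q (Y q) *\<^sub>R \<xi> \<beta> q)"
  have FF: "F (F Y) = - Y + ?N"
    by (rule ext) (simp add: phi_phi sum_fun_apply)
  have N: "?N \<in> VF" by (intro vf_sum vf_scale) simp_all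
  have "D X (F (F Y)) = - D X Y + D X ?N"
    unfolding FF by (subst D_add_right) (simp_all add: D_neg_right N)
  also have "D X ?N = (\<Sum>\<beta>\<in>I. (\<lambda>q. X q (\<lambda>q. \<eta> \<beta> q (Y q)) *\<^sub>R \<xi> \<beta> q + \<eta> \<beta> q (Y q) *\<^sub>R D X (\<xi> \<beta>) q))"
    by (subst D_sum_right) (auto simp: D_scale_right intro!: sum.cong)
  finally have 0: "D X (F (F Y)) = - D X Y
    + (\<Sum>\<beta>\<in>I. (\<lambda>q. X q (\<lambda>q. \<eta> \<beta> q (Y q)) *\<^sub>R \<xi> \<beta> q + \<eta> \<beta> q (Y q) *\<^sub>R D X (\<xi> \<beta>) q))" .
  have Xe: "X p (\<lambda>q. \<eta> \<beta> q (Y q)) = \<eta> \<beta> p (D X Y p) - g p (\<phi> p (X p)) (Y p)" if [simp]: "\<beta> \<in> I" for \<beta>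
  proof -
    have "X p (\<lambda>q. \<eta> \<beta> q (Y q)) = \<epsilon> \<beta> * (g p (D X Y p) (\<xi> \<beta> p) + g p (Y p) (D X (\<xi> \<beta>) p))"
      using tangent_cmultF[OF vf_tangent[OF assms(1)], where c = "\<epsilon> \<beta>"] by (simp add: eta_eq metric_compat)
    also have "\<dots> = \<epsilon> \<beta> * g p (D X Y p) (\<xi> \<beta> p) - (\<epsilon> \<beta> * \<epsilon> \<beta>) * g p (\<phi> p (X p)) (Y p)"
      by (simp add: D_xi g_sym[of "Y p"] algebra_simps)
    finally show ?thesis by (simp add: eta_eq)
  qed
  have "D X (F (F Y)) p = - D X Y p +
      (\<Sum>\<beta>\<in>I. X p (\<lambda>q. \<eta> \<beta> q (Y q)) *\<^sub>R \<xi> \<beta> p + \<eta> \<beta> p (Y p) *\<^sub>R D X (\<xi> \<beta>) p)"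
    by (simp only: 0 plus_fun_apply uminus_apply sum_fun_apply[where x = p])
  also have "\<dots> = - D X Y p + (\<Sum>\<beta>\<in>I. (\<eta> \<beta> p (D X Y p) - g p (\<phi> p (X p)) (Y p)) *\<^sub>R \<xi> \<beta> p
      + (\<eta> \<beta> p (Y p) * - \<epsilon> \<beta>) *\<^sub>R \<phi> p (X p))"
    by (intro arg_cong2[where f = "(+)"] refl sum.cong) (auto simp: Xe D_xi)
  finally have "g p (D X (F (F Y)) p) (Z p) = - g p (D X Y p) (Z p)
      + (\<Sum>\<beta>\<in>I. (\<eta> \<beta> p (D X Y p) - g p (\<phi> p (X p)) (Y p)) * g p (\<xi> \<beta> p) (Z p)
          - (\<epsilon> \<beta> * \<eta> \<beta> p (Y p)) * g p (\<phi> p (X p)) (Z p))"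
    by (simp only:) (subst g_add_left, simp_all add: g_sum_left algebra_simps)
  also have "\<dots> = g p (\<phi> p (\<phi> p (D X Y p))) (Z p)
      - g p (\<phi> p (X p)) (Y p) * etat p (Z p) - etat p (Y p) * g p (\<phi> p (X p)) (Z p)"
    by (simp add: phi_phi g_sum_left etat_def sum.distrib sum_subtractf sum_distrib_left sum_distrib_right
        g_xi g_sym[of "\<xi> _ p" p "Z p"] algebra_simps)
  finally show ?thesis
    using phi_skew[of "dphi X Y p" p "Z p"] by (simp add: D_F)
qed

text \<open>The difference \<open>C\<close> of the two sides is skew in its last two arguments, has vanishing cyclic sum, and
  satisfies the homogeneous versions of \<open>dphi_phi\<close> and \<open>dphi_normal\<close>; these identities force it to vanish
  as soon as one of the last two arguments is in the image of \<open>\<phi>\<close>.\<close>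

lemma dphi_formula:
  assumes [simp]: "X \<in> VF" "Y \<in> VF" and z: "z \<in> T p"
  shows "g p (dphi X Y p) z = g p (\<phi> p (X p)) (\<phi> p (Y p)) * etat p z
    - etat p (Y p) * g p (\<phi> p (X p)) (\<phi> p z)"
proof -
  define P where "P = (\<lambda>x y z. g p (\<phi> p x) (\<phi> p y) * etat p z - etat p y * g p (\<phi> p x) (\<phi> p z))"
  define C where "C = (\<lambda>X Y z. g p (dphi X Y p) z - P (X p) (Y p) z)"
  have s: "g p (\<phi> p x) (\<phi> p y) = g p (\<phi> p y) (\<phi> p x)" if "x \<in> T p" "y \<in> T p" for x y
    using that g_sym by auto
  have ff: "g p (\<phi> p x) (\<phi> p (\<phi> p y)) = - g p (\<phi> p x) y" if "x \<in> T p" "y \<in> T p" for x y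
    using that by (simp add: phi_phi g_sum_right)
  have ff': "g p (\<phi> p (\<phi> p x)) (\<phi> p y) = g p (\<phi> p x) y" if "x \<in> T p" "y \<in> T p" for x y
    using ff[OF that(2,1)] s[of "\<phi> p x" y] phi_skew[of x p y] g_sym[of x p "\<phi> p y"] that by simp
  have skew: "C U V (W p) = - C U W (V p)" if "U \<in> VF" "V \<in> VF" "W \<in> VF" for U V W
    using dphi_skew[OF that, of p] by (simp add: C_def P_def)
  have cyc: "C U W (V p) + C V U (W p) + C W V (U p) = 0" if [simp]: "U \<in> VF" "V \<in> VF" "W \<in> VF" for U V W
    using dphi_cyclic[OF that, of p] s[of "U p" "V p"] s[of "U p" "W p"] s[of "V p" "W p"]
    by (simp add: C_def P_def algebra_simps)
  have phi: "C U (F V) (W p) = C U V (F W p)" if [simp]: "U \<in> VF" "V \<in> VF" "W \<in> VF" for U V W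
    using dphi_phi[OF that, of p] by (simp add: C_def P_def ff algebra_simps)
  have nor: "C (F U) V (W p) - C (F V) U (W p) - C V U (F W p) + C U V (F W p) = 0"
    if [simp]: "U \<in> VF" "V \<in> VF" "W \<in> VF" for U V W
    using dphi_normal[OF that, of p] phi_skew[of "U p" p "V p"] phi_skew[of "V p" p "U p"]
      g_sym[of "V p" p "\<phi> p (U p)"]
    by (simp add: C_def P_def ff ff' algebra_simps)
  \<comment> \<open>The cyclic sums replace the two terms of \<open>nor\<close> with \<phi> in the
    first slot. By \<open>phi\<close> and \<open>skew\<close>, interchanging the last two arguments
    while \<phi> stays in its slot changes the sign. What remains of \<open>nor\<close> is
    \<open>- 2 * C W (F U) (V p) = 0\<close>.\<close>
  have van: "C W (F U) (V p) = 0" if [simp]: "U \<in> VF" "V \<in> VF" "W \<in> VF" for U V W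
    using nor[OF that] cyc[OF F_vf[OF that(2)] that(3,1)] cyc[OF F_vf[OF that(1)] that(3,2)]
      phi[OF that(1,3,2)] skew[OF that(1) F_vf[OF that(3)] that(2)]
      phi[OF that(2,3,1)] skew[OF that(2) F_vf[OF that(3)] that(1)]
      phi[OF that(3,2,1)] skew[OF that(3,2) F_vf[OF that(1)]]
    by linarith
  \<comment> \<open>Here the formula is checked directly: \<phi> kills
    \<open>\<xi> \<alpha>\<close>, so \<open>dphi\<close> involves only the known derivative of
    \<open>\<xi> \<alpha>\<close>.\<close>
  have xi: "C X (\<xi> \<alpha>) (W p) = 0" if [simp]: "\<alpha> \<in> I" "W \<in> VF" for \<alpha> W
  proof -
    have "dphi X (\<xi> \<alpha>) p = \<epsilon> \<alpha> *\<^sub>R \<phi> p (\<phi> p (X p))"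
      unfolding dphi_def F_xi[OF that(1)] by (simp add: D_xi D_0_right)
    then show ?thesis
      by (simp add: C_def P_def etat_xi phi_skew[of "\<phi> p (X p)"])
  qed
  obtain Z where [simp]: "Z \<in> VF" and Zp: "Z p = z" using z by (rule extend_tangent)
  have Clin: "C X Y (u + v) = C X Y u + C X Y v" "C X Y (c *\<^sub>R u) = c * C X Y u"
    if [simp]: "u \<in> T p" "v \<in> T p" for u v c
    by (simp_all add: C_def P_def algebra_simps)
  have Csum: "C X Y (\<Sum>\<alpha>\<in>J. c \<alpha> *\<^sub>R \<xi> \<alpha> p) = 0" if "J \<subseteq> I" for J c
    using finite_subset[OF that finite_I] that
  proof (induction J)
    case empty
    have "C X Y 0 = 0" using Clin(2)[of 0 0 0] by simp
    then show ?case by (simp only: sum.empty)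
  next
    case (insert a J)
    have "C X Y (\<xi> a p) = 0" using skew[of X Y "\<xi> a"] xi[of a Y] insert by simp
    then have "C X Y (c a *\<^sub>R \<xi> a p) = 0" using Clin(2)[of "\<xi> a p" 0] insert by simp
    moreover have "(\<Sum>\<alpha>\<in>J. c \<alpha> *\<^sub>R \<xi> \<alpha> p) \<in> T p" using insert by auto
    moreover have "c a *\<^sub>R \<xi> a p \<in> T p" using insert by auto
    ultimately show ?case
      unfolding sum.insert[OF insert.hyps] using insert by (subst Clin(1)) auto
  qed
  \<comment> \<open>Image and kernel of \<phi> span the tangent space; \<open>van\<close> settles
    the first summand and \<open>xi\<close>, through skewness, the second.\<close>
  have "z = - \<phi> p (\<phi> p z) + (\<Sum>\<alpha>\<in>I. \<eta> \<alpha> p z *\<^sub>R \<xi> \<alpha> p)" using z by (simp add: phi_phi)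
  then have "C X Y z = C X Y (- \<phi> p (\<phi> p z)) + C X Y (\<Sum>\<alpha>\<in>I. \<eta> \<alpha> p z *\<^sub>R \<xi> \<alpha> p)"
    using Clin(1)[of "- \<phi> p (\<phi> p z)" "\<Sum>\<alpha>\<in>I. \<eta> \<alpha> p z *\<^sub>R \<xi> \<alpha> p"] z by (simp del: phi_neg)
  moreover have "C X Y (- \<phi> p (\<phi> p z)) = 0"
    using Clin(2)[of "\<phi> p (\<phi> p z)" 0 "-1"] skew[of X Y "F (F Z)"] van[of "F Z" Y X] z Zp by simp
  ultimately have "C X Y z = 0" using Csum by simp
  then show ?thesis by (simp add: C_def P_def)
qed

text \<open>As the derivative of \<open>\<xi> \<alpha>\<close> is a constant multiple of \<phi>, its
  curvature is the same multiple of \<open>dphi X Y - dphi Y X\<close>. The term of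
  \<open>dphi_formula\<close> that is symmetric in X and Y cancels.\<close>

lemma curvature_xi:
  assumes [simp]: "X \<in> VF" "Y \<in> VF" "\<alpha> \<in> I" and w: "w \<in> T p"
  shows "g p (curvature D X Y (\<xi> \<alpha>) p) w = \<epsilon> \<alpha> *
    (etat p (Y p) * g p (\<phi> p (X p)) (\<phi> p w) - etat p (X p) * g p (\<phi> p (Y p)) (\<phi> p w))"
proof -
  have Dx: "D U (\<xi> \<alpha>) = (\<lambda>q. (- \<epsilon> \<alpha>) *\<^sub>R F U q)" if "U \<in> VF" for U
    by (rule ext) (simp add: D_xi that)
  have DD: "D U (D V (\<xi> \<alpha>)) p = - \<epsilon> \<alpha> *\<^sub>R (dphi U V p + \<phi> p (D U V p))" if [simp]: "U \<in> VF" "V \<in> VF" for U V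
    unfolding Dx[OF that(2)] by (subst D_cscale_right) (simp_all add: D_F)
  have "curvature D X Y (\<xi> \<alpha>) p = - \<epsilon> \<alpha> *\<^sub>R (dphi X Y p - dphi Y X p)"
    by (simp add: curvature_def DD D_xi torsion_free_at[of X Y] algebra_simps)
  then have "g p (curvature D X Y (\<xi> \<alpha>) p) w = - \<epsilon> \<alpha> * (g p (dphi X Y p) w - g p (dphi Y X p) w)"
    using w by simp
  moreover have "g p (\<phi> p (X p)) (\<phi> p (Y p)) = g p (\<phi> p (Y p)) (\<phi> p (X p))" by (rule g_sym) auto
  ultimately show ?thesis using w by (simp add: dphi_formula algebra_simps)
qed

lemma Rm_xi:
  assumes x: "x \<in> T p" and y: "y \<in> T p" and \<alpha>: "\<alpha> \<in> I" and w: "w \<in> T p"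
  shows "Rm p x y (\<xi> \<alpha> p) w = \<epsilon> \<alpha> *
    (etat p y * g p (\<phi> p x) (\<phi> p w) - etat p x * g p (\<phi> p y) (\<phi> p w))"
proof -
  obtain X where X: "X \<in> VF" "X p = x" using extend_tangent[OF x] .
  obtain Y where Y: "Y \<in> VF" "Y p = y" using extend_tangent[OF y] .
  show ?thesis
    using Rm_eq[OF X(1) Y(1) xi_vf[OF \<alpha>], of p w] curvature_xi[OF X(1) Y(1) \<alpha> w] X Y by simp
qed

end

section \<open>Horizontal lifts\<close>

lemma smooth_fun_comp_map:
  assumes A: "is_atlas A" and B: "is_atlas B" and f: "smooth_map_on UNIV A B f" and h: "smooth_fun B h"
  shows "smooth_fun (A :: ('a::t2_space, 'e::euclidean_space) chart set)
    (h \<circ> (f :: 'a \<Rightarrow> 'b::t2_space))"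
proof -
  interpret A: atlas A by unfold_locales (rule A)
  interpret B: atlas B by unfold_locales (rule B)
  have cf: "continuous_on UNIV f" using f by (simp add: smooth_map_on_def)
  show ?thesis
    unfolding A.smooth_fun_iff
  proof
    fix c assume c: "c \<in> A"
    show "smooth_on (snd c ` fst c) (h \<circ> f \<circ> chart_inv c)"
    proof (rule smooth_on_local)
      fix x assume "x \<in> snd c ` fst c"
      then obtain p where p: "p \<in> fst c" "x = snd c p" by auto
      obtain d where d: "d \<in> B" "f p \<in> fst d" by (rule B.chart_at)
      let ?W = "snd c ` (fst c \<inter> UNIV \<inter> f -` fst d)"
      have "open (f -` fst d)" using open_vimage[OF B.open_chart(1)[OF d(1)] cf] .
      then have o: "open ?W" by (intro A.open_chart_image) (auto simp: c A.open_chart)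
      have fs: "smooth_on ?W (snd d \<circ> f \<circ> chart_inv c)" using f c d by (auto simp: smooth_map_on_def)
      have "smooth_on ?W (\<lambda>x. (h \<circ> chart_inv d) ((snd d \<circ> f \<circ> chart_inv c) x))"
        by (rule smooth_on_compose[OF o B.open_chart(2)[OF d(1)] _ fs B.smooth_funD[OF h d(1)]])
          (auto simp: A.chart_inv_left c)
      then have "smooth_on ?W (h \<circ> f \<circ> chart_inv c)"
        by (subst smooth_on_cong[OF o]) (auto simp: A.chart_inv_left B.chart_inv_left c d)
      then show "\<exists>W. open W \<and> x \<in> W \<and> smooth_on W (h \<circ> f \<circ> chart_inv c)" using o p d by blast
    qed
  qed
qed

context atlas
begin

text \<open>Gaussian elimination over the ring of smooth functions, valid near \<open>p\<close>: \<open>\<E>\<close> is a module of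
  vector fields, and at \<open>p\<close> it contains a frame dual to the functions \<open>y e\<close>.\<close>

lemma local_dual_frame:
  fixes y :: "'i \<Rightarrow> 'a \<Rightarrow> real"
  assumes "finite K" and vf: "\<E> \<subseteq> vector_fields A"
    and zero: "0 \<in> \<E>" and add: "\<And>X Y. X \<in> \<E> \<Longrightarrow> Y \<in> \<E> \<Longrightarrow> X + Y \<in> \<E>"
    and scale: "\<And>f X. smooth_fun A f \<Longrightarrow> X \<in> \<E> \<Longrightarrow> (\<lambda>q. f q *\<^sub>R X q) \<in> \<E>"
    and y: "\<And>e. e \<in> K \<Longrightarrow> smooth_fun A (y e)"
    and dual: "\<And>e. e \<in> K \<Longrightarrow> \<exists>E\<in>\<E>. \<forall>e'\<in>K. E p (y e') = (if e = e' then 1 else 0)"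
  shows "\<exists>H U. open U \<and> p \<in> U \<and> (\<forall>e\<in>K. H e \<in> \<E>) \<and>
    (\<forall>q\<in>U. \<forall>e\<in>K. \<forall>e'\<in>K. H e q (y e') = (if e = e' then 1 else 0))"
  using assms(1) y dual
proof (induction K)
  case empty
  show ?case by (rule exI, rule exI[of _ UNIV]) auto
next
  case (insert k K)
  have "\<exists>H U. open U \<and> p \<in> U \<and> (\<forall>e\<in>K. H e \<in> \<E>) \<and>
    (\<forall>q\<in>U. \<forall>e\<in>K. \<forall>e'\<in>K. H e q (y e') = (if e = e' then 1 else 0))"
    by (rule insert.IH) (use insert.prems in blast)+
  then obtain H U where H: "open U" "p \<in> U" "\<And>e. e \<in> K \<Longrightarrow> H e \<in> \<E>"
    "\<And>q e e'. q \<in> U \<Longrightarrow> e \<in> K \<Longrightarrow> e' \<in> K \<Longrightarrow> H e q (y e') = (if e = e' then 1 else 0)" by blast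
  obtain E where E: "E \<in> \<E>" "\<forall>e'\<in>insert k K. E p (y e') = (if k = e' then 1 else 0)"
    using insert.prems(2) by blast
  have sm: "smooth_fun A (\<lambda>q. X q (y e))" if "X \<in> \<E>" "e \<in> insert k K" for X e
    by (rule vf_smooth) (use that vf insert.prems in auto)
  have sum: "(\<Sum>i\<in>L. X i) \<in> \<E>" if "\<And>i. i \<in> L \<Longrightarrow> X i \<in> \<E>" for L and X :: "'i \<Rightarrow> 'a vfield"
    using that by (induction L rule: infinite_finite_induct) (auto intro: add zero simp del: plus_fun_apply)
  \<comment> \<open>Removing the components along the frame found so far makes \<open>E'\<close>
    annihilate \<open>y e\<close> on \<open>U\<close> for every \<open>e\<close> in
    \<open>K\<close>. The pivot at \<open>p\<close> survives, because there \<open>E\<close> already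
    annihilates these functions and has \<open>y k\<close>-component 1.\<close>
  define E' where "E' = E + (\<Sum>e\<in>K. (\<lambda>q. (-1 * E q (y e)) *\<^sub>R H e q))"
  have E': "E' \<in> \<E>" unfolding E'_def
    by (intro add sum scale smooth_fun_mult smooth_fun_const sm E H) auto
  have E'_ap: "E' q f = E q f - (\<Sum>e\<in>K. E q (y e) * H e q f)" for q f
    by (simp add: E'_def sum_fun_apply scaleR_fun_def sum_negf)
  have E'0: "E' q (y e') = 0" if "q \<in> U" "e' \<in> K" for q e'
  proof -
    have "(\<Sum>e\<in>K. E q (y e) * H e q (y e')) = (\<Sum>e\<in>K. if e = e' then E q (y e) else 0)"
      by (intro sum.cong) (use that H in auto)
    then show ?thesis using that insert.hyps by (simp add: E'_ap)
  qed
  have "(\<Sum>e\<in>K. E p (y e) * H e p (y k)) = 0" by (rule sum.neutral) (use E insert.hyps in auto)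
  then have "E' p (y k) \<noteq> 0" using E by (simp add: E'_ap)
  then obtain \<psi> V where \<psi>: "smooth_fun A \<psi>" "open V" "p \<in> V" "\<And>q. q \<in> V \<Longrightarrow> \<psi> q * E' q (y k) = 1"
    using local_reciprocal[of "\<lambda>q. E' q (y k)" p] sm[OF E', of k] by auto
  define Hk where "Hk = (\<lambda>q. \<psi> q *\<^sub>R E' q)"
  have Hk: "Hk \<in> \<E>" unfolding Hk_def by (intro scale \<psi> E')
  have Hk_ap: "Hk q f = \<psi> q * E' q f" for q f by (simp add: Hk_def scaleR_fun_def)
  \<comment> \<open>The second half of the elimination: the old frame is cleared of its
    \<open>y k\<close>-component, while its other components near \<open>p\<close> are unaffected
    because \<open>Hk\<close> annihilates those functions.\<close>
  define H' where "H' = (\<lambda>e. if e = k then Hk else H e + (\<lambda>q. (-1 * H e q (y k)) *\<^sub>R Hk q))"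
  have H'_ap: "H' e q f = H e q f - H e q (y k) * Hk q f" if "e \<noteq> k" for e q f
    using that by (simp add: H'_def scaleR_fun_def)
  have "H' e \<in> \<E>" if "e \<in> insert k K" for e
  proof (cases "e = k")
    case False
    then have "e \<in> K" using that by simp
    then have "H e + (\<lambda>q. (-1 * H e q (y k)) *\<^sub>R Hk q) \<in> \<E>"
      by (intro add scale Hk H smooth_fun_mult smooth_fun_const sm) auto
    then show ?thesis using False by (simp only: H'_def if_False)
  qed (simp add: H'_def Hk)
  moreover have "H' e q (y e') = (if e = e' then 1 else 0)"
    if q: "q \<in> U \<inter> V" and e: "e \<in> insert k K" "e' \<in> insert k K" for q e e'
  proof -
    have 1: "Hk q (y k) = 1" using q \<psi> by (simp add: Hk_ap)
    have 0: "Hk q (y e') = 0" if "e' \<in> K" for e' using q that by (simp add: Hk_ap E'0)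
    show ?thesis
    proof (cases "e = k")
      case True
      then have "H' e = Hk" by (simp add: H'_def)
      then show ?thesis using 0 1 e insert.hyps True by auto
    next
      case False
      then show ?thesis using H'_ap[OF False] 0 1 e insert.hyps H q by auto
    qed
  qed
  moreover have "open (U \<inter> V)" "p \<in> U \<inter> V" using H \<psi> by auto
  ultimately show ?case by (intro exI[of _ H'] exI[of _ "U \<inter> V"]) auto
qed

end

section \<open>Submersions with vertical spaces spanned by characteristic fields\<close>

locale S_submersion =
  M: S_manifold A g D n s \<phi> \<xi> \<eta> \<epsilon> + B: semi_riemannian A' g' D'
  for A :: "('a::{t2_space, second_countable_topology}, 'e::euclidean_space) chart set"
    and g D n s \<phi> \<xi> \<eta> \<epsilon>
    and A' :: "('b::{t2_space, second_countable_topology}, 'f::euclidean_space) chart set" and g' D' +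
  fixes \<tau> :: "'a \<Rightarrow> 'b"
  assumes submersion: "semi_riemannian_submersion A g A' g' \<tau>"
    and vertical: "\<And>q. vertical_space A A' \<tau> q = span ((\<lambda>\<alpha>. \<xi> \<alpha> q) ` {2..s})"
    and eps_1: "\<And>\<alpha>. \<alpha> \<in> {2..s} \<Longrightarrow> \<epsilon> \<alpha> = 1"
begin

definition J :: "nat set" where "J = {2..s}"

lemma finite_J [simp, intro]: "finite J"
  by (simp add: J_def)

lemma J_I [simp, intro]: "\<alpha> \<in> J \<Longrightarrow> \<alpha> \<in> M.I"
  by (simp add: J_def M.I_def)

lemma eps_J [simp]: "\<alpha> \<in> J \<Longrightarrow> \<epsilon> \<alpha> = 1"
  using eps_1 by (simp add: J_def)

abbreviation d\<tau> :: "'a tvec \<Rightarrow> 'b tvec" where "d\<tau> \<equiv> differential A' \<tau>"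

lemma smooth_comp: "smooth_fun A' h \<Longrightarrow> smooth_fun A (h \<circ> \<tau>)"
  using submersion by (intro smooth_fun_comp_map[OF M.atlas B.atlas]) (auto simp: semi_riemannian_submersion_def)

lemma d\<tau>_T [simp, intro]: "x \<in> M.T q \<Longrightarrow> d\<tau> x \<in> B.T (\<tau> q)"
  using submersion unfolding semi_riemannian_submersion_def by blast

lemma d\<tau>_add [simp]: "d\<tau> (x + y) = d\<tau> x + d\<tau> y"
  and d\<tau>_scale [simp]: "d\<tau> (c *\<^sub>R x) = c *\<^sub>R d\<tau> x"
  and d\<tau>_0 [simp]: "d\<tau> 0 = 0"
  and d\<tau>_diff [simp]: "d\<tau> (x - y) = d\<tau> x - d\<tau> y"
  by (auto simp: differential_def scaleR_fun_def fun_eq_iff)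

lemma d\<tau>_sum: "d\<tau> (\<Sum>i\<in>K. x i) = (\<Sum>i\<in>K. d\<tau> (x i))"
proof (cases "finite K")
  case True
  then show ?thesis
  proof (induction K)
    case empty
    show ?case unfolding sum.empty by (rule d\<tau>_0)
  next
    case (insert k K)
    show ?case unfolding sum.insert[OF insert.hyps] insert.IH[symmetric] by (rule d\<tau>_add)
  qed
next
  case False
  show ?thesis unfolding sum.infinite[OF False] by (rule d\<tau>_0)
qed

lemma d\<tau>_apply: "smooth_fun A' h \<Longrightarrow> d\<tau> x h = x (h \<circ> \<tau>)"
  by (simp add: differential_def)

definition H :: "'a \<Rightarrow> 'a tvec set" where
  "H q = {x \<in> M.T q. \<forall>\<alpha>\<in>J. g q x (\<xi> \<alpha> q) = 0}"

lemma H_T: "x \<in> H q \<Longrightarrow> x \<in> M.T q"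
  and H_xi: "x \<in> H q \<Longrightarrow> \<alpha> \<in> J \<Longrightarrow> g q x (\<xi> \<alpha> q) = 0"
  by (auto simp: H_def)

lemma vertical_xi: "\<alpha> \<in> J \<Longrightarrow> \<xi> \<alpha> q \<in> vertical_space A A' \<tau> q"
  unfolding vertical J_def by (rule span_base) auto

lemma d\<tau>_xi [simp]: "\<alpha> \<in> J \<Longrightarrow> d\<tau> (\<xi> \<alpha> q) = 0"
  using vertical_xi by (simp add: vertical_space_def)

lemma horizontal_space_eq: "horizontal_space A g A' \<tau> q = H q"
proof -
  have "g q x v = 0" if x: "x \<in> M.T q" and a: "\<forall>\<alpha>\<in>J. g q x (\<xi> \<alpha> q) = 0"
    and v: "v \<in> span ((\<lambda>\<alpha>. \<xi> \<alpha> q) ` J)" for x v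
  proof -
    have "v \<in> M.T q \<and> g q x v = 0"
      using v
    proof (induction rule: span_induct_alt)
      case (step c u w)
      then show ?case using x a by (auto simp del: plus_fun_apply)
    qed (intro conjI tangent_0 M.g_0_right x)
    then show ?thesis by simp
  qed
  then show ?thesis
    unfolding horizontal_space_def H_def using vertical_xi vertical[of q, folded J_def] by auto
qed

lemma d\<tau>_bij: "bij_betw d\<tau> (H q) (B.T (\<tau> q))"
  and d\<tau>_isometry: "x \<in> H q \<Longrightarrow> y \<in> H q \<Longrightarrow> g' (\<tau> q) (d\<tau> x) (d\<tau> y) = g q x y"
  using submersion unfolding semi_riemannian_submersion_def horizontal_space_eq by blast+

lemma d\<tau>_inj: "x \<in> H q \<Longrightarrow> y \<in> H q \<Longrightarrow> d\<tau> x = d\<tau> y \<Longrightarrow> x = y"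
  using d\<tau>_bij[of q] by (auto simp: bij_betw_def inj_on_def)

lemma H_add: "x \<in> H q \<Longrightarrow> y \<in> H q \<Longrightarrow> x + y \<in> H q"
  and H_scale: "x \<in> H q \<Longrightarrow> c *\<^sub>R x \<in> H q"
  and H_0: "0 \<in> H q"
  and H_diff: "x \<in> H q \<Longrightarrow> y \<in> H q \<Longrightarrow> x - y \<in> H q"
  by (auto simp: H_def simp del: plus_fun_apply)

lemma xi_orthonormal: "\<alpha> \<in> J \<Longrightarrow> \<beta> \<in> M.I \<Longrightarrow> g q (\<xi> \<beta> q) (\<xi> \<alpha> q) = (if \<beta> = \<alpha> then 1 else 0)"
  by (simp add: M.g_xi)

definition hor :: "'a \<Rightarrow> 'a tvec \<Rightarrow> 'a tvec" where
  "hor q x = x - (\<Sum>\<alpha>\<in>J. g q x (\<xi> \<alpha> q) *\<^sub>R \<xi> \<alpha> q)"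

lemma hor_H: assumes x: "x \<in> M.T q" shows "hor q x \<in> H q"
proof -
  have s: "(\<Sum>\<alpha>\<in>J. g q x (\<xi> \<alpha> q) *\<^sub>R \<xi> \<alpha> q) \<in> M.T q" by (intro M.T_sum M.T_closed M.xi_T J_I)
  have "g q (hor q x) (\<xi> \<beta> q) = 0" if b: "\<beta> \<in> J" for \<beta>
  proof -
    have "g q (\<Sum>\<alpha>\<in>J. g q x (\<xi> \<alpha> q) *\<^sub>R \<xi> \<alpha> q) (\<xi> \<beta> q) = (\<Sum>\<alpha>\<in>J. g q (g q x (\<xi> \<alpha> q) *\<^sub>R \<xi> \<alpha> q) (\<xi> \<beta> q))"
      by (rule M.g_sum_left) (use b in auto)
    also have "\<dots> = (\<Sum>\<alpha>\<in>J. if \<alpha> = \<beta> then g q x (\<xi> \<beta> q) else 0)"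
      by (rule sum.cong) (use b xi_orthonormal in auto)
    also have "\<dots> = g q x (\<xi> \<beta> q)" using b by simp
    finally have e: "g q (\<Sum>\<alpha>\<in>J. g q x (\<xi> \<alpha> q) *\<^sub>R \<xi> \<alpha> q) (\<xi> \<beta> q) = g q x (\<xi> \<beta> q)" .
    show ?thesis unfolding hor_def
      by (subst M.g_diff_left) (use s x b in \<open>simp_all only: e M.xi_T J_I diff_self\<close>)
  qed
  moreover have "hor q x \<in> M.T q" unfolding hor_def using x s by (rule tangent_diff)
  ultimately show ?thesis by (simp add: H_def)
qed

lemma d\<tau>_hor: "d\<tau> (hor q x) = d\<tau> x"
  by (simp add: hor_def d\<tau>_sum)

text \<open>The vertical part of \<open>x\<close> is orthogonal to \<open>y\<close>, and
  \<open>d\<tau>\<close> is isometric on the horizontal part. Hence arbitrary vectors can be paired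
  with horizontal ones on the base without first being projected.\<close>

lemma g_hor_right:
  assumes x: "x \<in> M.T q" and y: "y \<in> H q" shows "g q x y = g' (\<tau> q) (d\<tau> x) (d\<tau> y)"
proof -
  have yT: "y \<in> M.T q" using y by (rule H_T)
  have s: "(\<Sum>\<alpha>\<in>J. g q x (\<xi> \<alpha> q) *\<^sub>R \<xi> \<alpha> q) \<in> M.T q" by (intro M.T_sum M.T_closed M.xi_T J_I)
  have "g q (\<Sum>\<alpha>\<in>J. g q x (\<xi> \<alpha> q) *\<^sub>R \<xi> \<alpha> q) y = (\<Sum>\<alpha>\<in>J. g q (g q x (\<xi> \<alpha> q) *\<^sub>R \<xi> \<alpha> q) y)"
    by (rule M.g_sum_left) (use yT in auto)
  also have "\<dots> = 0" by (rule sum.neutral) (use yT y H_xi M.g_sym in auto)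
  finally have "g q x y = g q (hor q x) y" unfolding hor_def using s x yT by simp
  then show ?thesis using d\<tau>_isometry[OF hor_H[OF x] y] by (simp add: d\<tau>_hor)
qed

definition lift :: "'b vfield \<Rightarrow> 'a vfield" where
  "lift X q = inv_into (H q) d\<tau> (X (\<tau> q))"

lemma lift_H: "X \<in> B.VF \<Longrightarrow> lift X q \<in> H q"
  and d\<tau>_lift: "X \<in> B.VF \<Longrightarrow> d\<tau> (lift X q) = X (\<tau> q)"
proof -
  assume "X \<in> B.VF"
  then have "X (\<tau> q) \<in> d\<tau> ` H q" using d\<tau>_bij[of q] by (auto simp: bij_betw_def)
  then show "lift X q \<in> H q" "d\<tau> (lift X q) = X (\<tau> q)"
    by (auto simp: lift_def inv_into_into f_inv_into_f)
qed

text \<open>The pointwise inverse of the differential says nothing about smoothness. Near any point,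
  horizontal fields dual to the pulled-back coordinates project onto the coordinate frame of the
  base, and the lift is their combination with the pulled-back components of
  \<open>X\<close>.\<close>

lemma lift_vf [simp, intro]:
  assumes X: "X \<in> B.VF" shows "lift X \<in> M.VF"
proof -
  have "smooth_fun A (\<lambda>q. lift X q f)" if f: "smooth_fun A f" for f
  proof (rule M.smooth_fun_local)
    fix p
    obtain E' :: "'f \<Rightarrow> 'b vfield" and y :: "'f \<Rightarrow> 'b \<Rightarrow> real" and V where
      y: "\<And>e. E' e \<in> B.VF" "\<And>e. smooth_fun A' (y e)" "open V" "\<tau> p \<in> V"
      "\<And>q e e'. q \<in> V \<Longrightarrow> e \<in> Basis \<Longrightarrow> e' \<in> Basis \<Longrightarrow> E' e q (y e') = (if e = e' then 1 else 0)"
      using B.local_coordinates[of "\<tau> p"] by metis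
    define \<E> where "\<E> = {Z \<in> M.VF. \<forall>q. Z q \<in> H q}"
    have "\<exists>Hf U. open U \<and> p \<in> U \<and> (\<forall>e\<in>Basis. Hf e \<in> \<E>) \<and>
      (\<forall>q\<in>U. \<forall>e\<in>Basis. \<forall>e'\<in>Basis. Hf e q (y e' \<circ> \<tau>) = (if e = e' then 1 else 0))"
    proof (rule M.local_dual_frame)
      show "\<E> \<subseteq> M.VF" "0 \<in> \<E>" by (auto simp: \<E>_def H_0)
      show "Z + Z' \<in> \<E>" if "Z \<in> \<E>" "Z' \<in> \<E>" for Z Z' using that by (auto simp: \<E>_def H_add)
      show "(\<lambda>q. f q *\<^sub>R Z q) \<in> \<E>" if "smooth_fun A f" "Z \<in> \<E>" for f Z
        using that by (auto simp: \<E>_def H_scale)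
      show "smooth_fun A (y e \<circ> \<tau>)" for e by (intro smooth_comp y)
      fix e :: 'f assume e: "e \<in> Basis"
      obtain Z where Z: "Z \<in> M.VF" "Z p = lift (E' e) p"
        using M.extend_tangent[OF H_T[OF lift_H[OF y(1)]]] .
      \<comment> \<open>Subtracting the vertical part keeps the extension horizontal away from
        \<open>p\<close>; at \<open>p\<close> it still projects to the coordinate vector.\<close>
      define E where "E = Z - (\<Sum>\<alpha>\<in>J. (\<lambda>q. g q (Z q) (\<xi> \<alpha> q) *\<^sub>R \<xi> \<alpha> q))"
      have E: "E q = hor q (Z q)" for q
        by (simp only: E_def hor_def minus_apply sum_fun_apply[where x = q])
      have "E \<in> M.VF" unfolding E_def
        by (intro M.vf_diff M.vf_sum M.vf_scale M.g_smooth Z M.xi_vf J_I)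
      then have "E \<in> \<E>" by (simp add: \<E>_def E hor_H Z M.vf_tangent)
      moreover have "E p (y e' \<circ> \<tau>) = (if e = e' then 1 else 0)" if "e' \<in> Basis" for e'
        using that e y by (simp add: d\<tau>_apply[symmetric] E d\<tau>_hor Z d\<tau>_lift)
      ultimately show "\<exists>E\<in>\<E>. \<forall>e'\<in>Basis. E p (y e' \<circ> \<tau>) = (if e = e' then 1 else 0)" by blast
    qed simp
    then obtain Hf U where U: "open U" "p \<in> U" and Hf: "\<And>e. e \<in> Basis \<Longrightarrow> Hf e \<in> \<E>"
      "\<And>q e e'. q \<in> U \<Longrightarrow> e \<in> Basis \<Longrightarrow> e' \<in> Basis \<Longrightarrow> Hf e q (y e' \<circ> \<tau>) = (if e = e' then 1 else 0)"
      by blast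
    have c\<tau>: "continuous_on UNIV \<tau>"
      using submersion by (simp add: semi_riemannian_submersion_def smooth_map_on_def)
    define W where "W = U \<inter> \<tau> -` V"
    have W: "open W" "p \<in> W" unfolding W_def using U y open_vimage[OF _ c\<tau>] by auto
    have eq: "lift X q = (\<Sum>e\<in>Basis. X (\<tau> q) (y e) *\<^sub>R Hf e q)" if q: "q \<in> W" for q
    proof (rule d\<tau>_inj[OF lift_H[OF X]])
      have HfH: "Hf e q \<in> H q" if "e \<in> Basis" for e using Hf(1)[OF that] by (simp add: \<E>_def)
      show "(\<Sum>e\<in>Basis. X (\<tau> q) (y e) *\<^sub>R Hf e q) \<in> H q"
      proof -
        have "(\<Sum>e\<in>K. X (\<tau> q) (y e) *\<^sub>R Hf e q) \<in> H q" if "K \<subseteq> Basis" for K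
          using finite_subset[OF that finite_Basis] that
        proof (induction K)
          case (insert k K)
          show ?case unfolding sum.insert[OF insert.hyps]
            by (intro H_add H_scale HfH insert.IH) (use insert in auto)
        qed (simp only: sum.empty H_0)
        then show ?thesis by simp
      qed
      \<comment> \<open>A tangent vector of the base is determined by its values on the coordinates,
        so duality with their pullbacks fixes the projection.\<close>
      have dH: "d\<tau> (Hf e q) = E' e (\<tau> q)" if e: "e \<in> Basis" for e
      proof -
        have t: "d\<tau> (Hf e q) \<in> B.T (\<tau> q)" using H_T[OF HfH[OF e]] by auto
        have "d\<tau> (Hf e q) = (\<Sum>e'\<in>Basis. d\<tau> (Hf e q) (y e') *\<^sub>R E' e' (\<tau> q))"
          by (rule B.coordinate_expansion[OF _ _ t]) (use q y B.vf_tangent in \<open>auto simp: W_def\<close>)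
        also have "\<dots> = (\<Sum>e'\<in>Basis. if e' = e then E' e' (\<tau> q) else 0)"
          by (intro sum.cong) (use e q y Hf(2) in \<open>auto simp: d\<tau>_apply W_def\<close>)
        finally show ?thesis using e by simp
      qed
      have "X (\<tau> q) = (\<Sum>e\<in>Basis. X (\<tau> q) (y e) *\<^sub>R E' e (\<tau> q))"
        by (rule B.coordinate_expansion) (use q y X B.vf_tangent in \<open>auto simp: W_def\<close>)
      also have "\<dots> = (\<Sum>e\<in>Basis. X (\<tau> q) (y e) *\<^sub>R d\<tau> (Hf e q))"
        by (intro sum.cong) (auto simp: dH)
      finally show "d\<tau> (lift X q) = d\<tau> (\<Sum>e\<in>Basis. X (\<tau> q) (y e) *\<^sub>R Hf e q)"
        by (simp only: d\<tau>_lift[OF X] d\<tau>_sum d\<tau>_scale)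
    qed
    let ?h = "\<lambda>q. \<Sum>e\<in>Basis. ((\<lambda>r. X r (y e)) \<circ> \<tau>) q * Hf e q f"
    have "smooth_fun A ?h"
    proof (rule M.smooth_fun_sum, rule M.smooth_fun_mult)
      fix e :: 'f assume e: "e \<in> Basis"
      have "smooth_fun A ((\<lambda>r. X r (y e)) \<circ> \<tau>)" by (rule smooth_comp[OF B.vf_smooth[OF X y(2)]])
      then show "smooth_fun A (\<lambda>q. ((\<lambda>r. X r (y e)) \<circ> \<tau>) q)" by (simp only: comp_def)
      show "smooth_fun A (\<lambda>q. Hf e q f)"
        by (rule M.vf_smooth[OF _ f]) (use Hf(1)[OF e] in \<open>simp add: \<E>_def\<close>)
    qed
    moreover have "lift X q f = ?h q" if "q \<in> W" for q
      by (simp add: eq[OF that] sum_fun_apply scaleR_fun_def)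
    ultimately show "\<exists>U h. open U \<and> p \<in> U \<and> smooth_fun A h \<and> (\<forall>q\<in>U. lift X q f = h q)"
      using W by blast
  qed
  moreover have "lift X q \<in> M.T q" for q by (rule H_T[OF lift_H[OF X]])
  ultimately show ?thesis unfolding vector_fields_def by blast
qed

end

section \<open>O'Neill's formula\<close>

context S_submersion
begin

definition related :: "'a vfield \<Rightarrow> 'b vfield \<Rightarrow> bool" where
  "related U U' \<longleftrightarrow> U \<in> M.VF \<and> U' \<in> B.VF \<and> (\<forall>q. d\<tau> (U q) = U' (\<tau> q))"

lemma related_apply: "related U U' \<Longrightarrow> smooth_fun A' h \<Longrightarrow> U q (h \<circ> \<tau>) = U' (\<tau> q) h"
  unfolding related_def by (metis d\<tau>_apply)

lemma related_lift: "X \<in> B.VF \<Longrightarrow> related (lift X) X"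
  by (simp add: related_def d\<tau>_lift)

lemma related_bracket:
  assumes U: "related U U'" and V: "related V V'"
  shows "related (lie_bracket U V) (lie_bracket U' V')"
proof -
  have vf: "U \<in> M.VF" "V \<in> M.VF" "U' \<in> B.VF" "V' \<in> B.VF" using U V by (auto simp: related_def)
  have "d\<tau> (lie_bracket U V q) h = lie_bracket U' V' (\<tau> q) h" for q h
  proof (cases "smooth_fun A' h")
    case True
    have 1: "(\<lambda>r. W r (h \<circ> \<tau>)) = (\<lambda>y. W' y h) \<circ> \<tau>" if "related W W'" for W W'
      using related_apply[OF that True] by (simp add: fun_eq_iff)
    have "d\<tau> (lie_bracket U V q) h = U q ((\<lambda>y. V' y h) \<circ> \<tau>) - V q ((\<lambda>y. U' y h) \<circ> \<tau>)"
      unfolding d\<tau>_apply[OF True] lie_bracket_def 1[OF U] 1[OF V] ..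
    also have "\<dots> = lie_bracket U' V' (\<tau> q) h"
      unfolding related_apply[OF U B.vf_smooth[OF vf(4) True]] related_apply[OF V B.vf_smooth[OF vf(3) True]]
        lie_bracket_def ..
    finally show ?thesis .
  next
    case False
    then show ?thesis
      using tangent_nonsmooth[OF B.vf_tangent[OF B.vf_bracket[OF vf(3,4)]] False]
      by (simp add: differential_def)
  qed
  then show ?thesis unfolding related_def using vf by auto
qed

lemma T_eqI:
  assumes x: "x \<in> M.T q" and y: "y \<in> M.T q" and d: "d\<tau> x = d\<tau> y"
    and xi: "\<And>\<alpha>. \<alpha> \<in> J \<Longrightarrow> g q x (\<xi> \<alpha> q) = g q y (\<xi> \<alpha> q)"
  shows "x = y"
proof -
  have "x - y \<in> H q" using x y xi by (simp add: H_def tangent_diff del: minus_apply)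
  moreover have "d\<tau> (x - y) = d\<tau> 0" by (simp only: d\<tau>_diff d d\<tau>_0 diff_self)
  ultimately have "x - y = 0" using d\<tau>_inj[OF _ H_0] by blast
  then show ?thesis by simp
qed

text \<open>The vertical part of the derivative of one lift along another has the same coefficient
  along each of the orthonormal vertical fields, so it is a multiple of their sum.\<close>

definition \<zeta> :: "'a vfield" where "\<zeta> = (\<Sum>\<alpha>\<in>J. \<xi> \<alpha>)"

lemma \<zeta>_vf [simp, intro]: "\<zeta> \<in> M.VF"
  unfolding \<zeta>_def by (intro M.vf_sum M.xi_vf J_I)

lemma \<zeta>_at: "\<zeta> q = (\<Sum>\<alpha>\<in>J. \<xi> \<alpha> q)"
  unfolding \<zeta>_def by (rule sum_fun_apply)

lemma \<zeta>_T [simp, intro]: "\<zeta> q \<in> M.T q"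
  by (rule M.vf_tangent) simp

lemma d\<tau>_\<zeta> [simp]: "d\<tau> (\<zeta> q) = 0"
proof -
  have "d\<tau> (\<zeta> q) = (\<Sum>\<alpha>\<in>J. d\<tau> (\<xi> \<alpha> q))" unfolding \<zeta>_at by (rule d\<tau>_sum)
  also have "\<dots> = 0" by (rule sum.neutral) simp
  finally show ?thesis .
qed

lemma g_\<zeta>_xi: assumes "\<alpha> \<in> J" shows "g q (\<zeta> q) (\<xi> \<alpha> q) = 1"
proof -
  have "g q (\<zeta> q) (\<xi> \<alpha> q) = (\<Sum>\<beta>\<in>J. g q (\<xi> \<beta> q) (\<xi> \<alpha> q))"
    unfolding \<zeta>_at by (rule M.g_sum_left) (use assms in auto)
  also have "\<dots> = (\<Sum>\<beta>\<in>J. if \<beta> = \<alpha> then 1 else 0)"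
    by (rule sum.cong) (use assms xi_orthonormal in auto)
  finally show ?thesis using assms by simp
qed

lemma g_\<zeta>_H: "x \<in> H q \<Longrightarrow> g q (\<zeta> q) x = 0"
  using g_hor_right[of "\<zeta> q" q x] d\<tau>_T[OF H_T, of x q] by simp

lemma D_\<zeta>: assumes X: "X \<in> M.VF" shows "D X \<zeta> q = - real (card J) *\<^sub>R \<phi> q (X q)"
proof -
  have "D X \<zeta> q = (\<Sum>\<alpha>\<in>J. D X (\<xi> \<alpha>)) q"
    unfolding \<zeta>_def by (subst M.D_sum_right) (use X in auto)
  also have "\<dots> = (\<Sum>\<alpha>\<in>J. - \<phi> q (X q))"
    unfolding sum_fun_apply[where x = q] by (rule sum.cong) (use X in \<open>auto simp: M.D_xi\<close>)
  also have "\<dots> = - real (card J) *\<^sub>R \<phi> q (X q)" by (simp only: sum_constant_scaleR scaleR_minus_left scaleR_minus_right)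
  finally show ?thesis .
qed

text \<open>Paired with a lift, every term of the Koszul formula upstairs equals the corresponding
  term on the base: metric values by isometry, brackets by relatedness.\<close>

lemma d\<tau>_D_lift:
  assumes X: "X \<in> B.VF" and Y: "Y \<in> B.VF"
  shows "d\<tau> (D (lift X) (lift Y) q) = D' X Y (\<tau> q)"
proof (rule B.g_eqI)
  note vf [simp] = X Y
  show "d\<tau> (D (lift X) (lift Y) q) \<in> B.T (\<tau> q)" by (intro d\<tau>_T M.D_T lift_vf X Y)
  show "D' X Y (\<tau> q) \<in> B.T (\<tau> q)" by simp
  fix w assume "w \<in> B.T (\<tau> q)"
  then obtain Z where Z [simp]: "Z \<in> B.VF" and w: "Z (\<tau> q) = w" by (rule B.extend_tangent)
  have a: "lift U q (\<lambda>r. g r (lift V r) (lift W r)) = U (\<tau> q) (\<lambda>y. g' y (V y) (W y))"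
    if UVW: "U \<in> B.VF" "V \<in> B.VF" "W \<in> B.VF" for U V W
  proof -
    have "(\<lambda>r. g r (lift V r) (lift W r)) = (\<lambda>y. g' y (V y) (W y)) \<circ> \<tau>"
      using d\<tau>_isometry[OF lift_H[OF UVW(2)] lift_H[OF UVW(3)]]
      by (simp add: fun_eq_iff d\<tau>_lift UVW)
    then show ?thesis using related_apply[OF related_lift[OF UVW(1)] B.g_smooth[OF UVW(2,3)]] by simp
  qed
  have b: "g q (lie_bracket (lift U) (lift V) q) (lift W q) = g' (\<tau> q) (lie_bracket U V (\<tau> q)) (W (\<tau> q))"
    if UVW: "U \<in> B.VF" "V \<in> B.VF" "W \<in> B.VF" for U V W
    using g_hor_right[of "lie_bracket (lift U) (lift V) q" q "lift W q"] lift_H[OF UVW(3)]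
      related_bracket[OF related_lift[OF UVW(1)] related_lift[OF UVW(2)]] UVW
    by (simp add: related_def d\<tau>_lift)
  have "2 * g q (D (lift X) (lift Y) q) (lift Z q) = 2 * g' (\<tau> q) (D' X Y (\<tau> q)) (Z (\<tau> q))"
    unfolding M.koszul[OF lift_vf[OF X] lift_vf[OF Y] lift_vf[OF Z]] B.koszul[OF X Y Z]
    by (simp add: a b)
  moreover have "g q (D (lift X) (lift Y) q) (lift Z q) = g' (\<tau> q) (d\<tau> (D (lift X) (lift Y) q)) (Z (\<tau> q))"
    using g_hor_right[of "D (lift X) (lift Y) q" q "lift Z q"] lift_H[OF Z]
    by (simp add: d\<tau>_lift M.D_T)
  ultimately show "g' (\<tau> q) (d\<tau> (D (lift X) (lift Y) q)) w = g' (\<tau> q) (D' X Y (\<tau> q)) w"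
    using w by simp
qed

text \<open>Differentiating the orthogonality of \<open>lift Y\<close> and
  \<open>\<xi> \<alpha>\<close> shifts the derivative to the characteristic field, where
  \<open>D_xi\<close> evaluates it.\<close>

lemma g_D_lift_xi:
  assumes X: "X \<in> B.VF" and Y: "Y \<in> B.VF" and \<alpha> [simp]: "\<alpha> \<in> J"
  shows "g q (D (lift X) (lift Y) q) (\<xi> \<alpha> q) = g q (\<phi> q (lift X q)) (lift Y q)"
proof -
  note [simp] = lift_vf[OF X] lift_vf[OF Y] J_I[OF \<alpha>]
  have "(\<lambda>r. g r (lift Y r) (\<xi> \<alpha> r)) = (\<lambda>_. 0)" using lift_H[OF Y] H_xi \<alpha> by blast
  then have "lift X q (\<lambda>r. g r (lift Y r) (\<xi> \<alpha> r)) = 0"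
    using M.tangent_const0[of "lift X q" q 0] by (simp add: M.vf_tangent)
  then have "g q (D (lift X) (lift Y) q) (\<xi> \<alpha> q) = - g q (lift Y q) (D (lift X) (\<xi> \<alpha>) q)"
    using M.metric_compat[of "lift X" "lift Y" "\<xi> \<alpha>" q] by simp
  also have "\<dots> = g q (lift Y q) (\<phi> q (lift X q))"
    by (simp add: M.D_xi)
  also have "\<dots> = g q (\<phi> q (lift X q)) (lift Y q)" by (rule M.g_sym) auto
  finally show ?thesis .
qed

text \<open>\<open>d\<tau>_D_lift\<close> determines the horizontal part and
  \<open>g_D_lift_xi\<close> the vertical one; the second summand is O'Neill's integrability
  tensor.\<close>

lemma D_lift:
  assumes X: "X \<in> B.VF" and Y: "Y \<in> B.VF"
  shows "D (lift X) (lift Y) = lift (D' X Y) + (\<lambda>q. g q (\<phi> q (lift X q)) (lift Y q) *\<^sub>R \<zeta> q)"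
proof
  fix q
  note [simp] = X Y lift_vf[OF X] lift_vf[OF Y]
  have "D (lift X) (lift Y) q = lift (D' X Y) q + g q (\<phi> q (lift X q)) (lift Y q) *\<^sub>R \<zeta> q"
  proof (rule T_eqI)
    show "D (lift X) (lift Y) q \<in> M.T q" by simp
    show "lift (D' X Y) q + g q (\<phi> q (lift X q)) (lift Y q) *\<^sub>R \<zeta> q \<in> M.T q"
      by (intro tangent_add tangent_scale \<zeta>_T M.vf_tangent lift_vf B.D_vf X Y)
    show "d\<tau> (D (lift X) (lift Y) q) = d\<tau> (lift (D' X Y) q + g q (\<phi> q (lift X q)) (lift Y q) *\<^sub>R \<zeta> q)"
      by (simp only: d\<tau>_add d\<tau>_scale d\<tau>_\<zeta> d\<tau>_D_lift[OF X Y] d\<tau>_lift[OF B.D_vf[OF X Y]] scaleR_zero_right add_0_right)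
    fix \<alpha> assume a: "\<alpha> \<in> J"
    have "g q (lift (D' X Y) q + g q (\<phi> q (lift X q)) (lift Y q) *\<^sub>R \<zeta> q) (\<xi> \<alpha> q) =
      g q (lift (D' X Y) q) (\<xi> \<alpha> q) + g q (\<phi> q (lift X q)) (lift Y q) * g q (\<zeta> q) (\<xi> \<alpha> q)"
      using a by (subst M.g_add_left) (auto simp: lift_H H_T)
    also have "\<dots> = g q (\<phi> q (lift X q)) (lift Y q)"
      using H_xi[OF lift_H[OF B.D_vf[OF X Y]] a] g_\<zeta>_xi[OF a] by simp
    finally show "g q (D (lift X) (lift Y) q) (\<xi> \<alpha> q) =
        g q (lift (D' X Y) q + g q (\<phi> q (lift X q)) (lift Y q) *\<^sub>R \<zeta> q) (\<xi> \<alpha> q)"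
      using g_D_lift_xi[OF X Y a] by simp
  qed
  then show "D (lift X) (lift Y) q =
      (lift (D' X Y) + (\<lambda>q. g q (\<phi> q (lift X q)) (lift Y q) *\<^sub>R \<zeta> q)) q"
    by (simp only: plus_fun_apply)
qed

text \<open>The factor 2 arises because g(\<phi> X, Y) is skew, so the two vertical parts in the
  difference of covariant derivatives add up.\<close>

lemma bracket_lift:
  assumes X: "X \<in> B.VF" and Y: "Y \<in> B.VF"
  shows "lie_bracket (lift X) (lift Y) =
    lift (lie_bracket X Y) + (\<lambda>q. (2 * g q (\<phi> q (lift X q)) (lift Y q)) *\<^sub>R \<zeta> q)"
proof
  fix q
  note [simp] = X Y lift_vf[OF X] lift_vf[OF Y]
  let ?c = "2 * g q (\<phi> q (lift X q)) (lift Y q)"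
  have br: "lie_bracket X Y \<in> B.VF" by simp
  have "lie_bracket (lift X) (lift Y) q = lift (lie_bracket X Y) q + ?c *\<^sub>R \<zeta> q"
  proof (rule T_eqI)
    show "lie_bracket (lift X) (lift Y) q \<in> M.T q" by simp
    show "lift (lie_bracket X Y) q + ?c *\<^sub>R \<zeta> q \<in> M.T q"
      by (intro tangent_add tangent_scale \<zeta>_T M.vf_tangent lift_vf br)
    have "d\<tau> (lie_bracket (lift X) (lift Y) q) = lie_bracket X Y (\<tau> q)"
      using related_bracket[OF related_lift[OF X] related_lift[OF Y]] by (simp add: related_def)
    then show "d\<tau> (lie_bracket (lift X) (lift Y) q) = d\<tau> (lift (lie_bracket X Y) q + ?c *\<^sub>R \<zeta> q)"
      by (simp only: d\<tau>_add d\<tau>_scale d\<tau>_\<zeta> d\<tau>_lift[OF br] scaleR_zero_right add_0_right)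
    fix \<alpha> assume a: "\<alpha> \<in> J"
    have "g q (lift (lie_bracket X Y) q + ?c *\<^sub>R \<zeta> q) (\<xi> \<alpha> q) =
      g q (lift (lie_bracket X Y) q) (\<xi> \<alpha> q) + ?c * g q (\<zeta> q) (\<xi> \<alpha> q)"
      using a by (subst M.g_add_left) (auto simp: lift_H H_T)
    also have "\<dots> = ?c" using H_xi[OF lift_H[OF br] a] g_\<zeta>_xi[OF a] by simp
    finally have 1: "g q (lift (lie_bracket X Y) q + ?c *\<^sub>R \<zeta> q) (\<xi> \<alpha> q) = ?c" .
    have "g q (\<phi> q (lift Y q)) (lift X q) = - g q (\<phi> q (lift X q)) (lift Y q)"
      using M.phi_skew[of "lift Y q" q "lift X q"] M.g_sym[of "lift Y q" q "\<phi> q (lift X q)"]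
      by (simp add: M.vf_tangent)
    then show "g q (lie_bracket (lift X) (lift Y) q) (\<xi> \<alpha> q) =
        g q (lift (lie_bracket X Y) q + ?c *\<^sub>R \<zeta> q) (\<xi> \<alpha> q)"
      unfolding 1 using M.torsion_free_at[of "lift X" "lift Y" q] g_D_lift_xi[OF X Y a, of q]
        g_D_lift_xi[OF Y X a, of q] a by simp
  qed
  then show "lie_bracket (lift X) (lift Y) q =
      (lift (lie_bracket X Y) + (\<lambda>q. (2 * g q (\<phi> q (lift X q)) (lift Y q)) *\<^sub>R \<zeta> q)) q"
    by (simp only: plus_fun_apply)
qed

text \<open>Since \<open>\<zeta>\<close> projects to 0, its bracket with a lift is vertical. The
  derivatives of \<open>lift Z\<close> along \<open>\<zeta>\<close> and of \<open>\<zeta>\<close>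
  along \<open>lift Z\<close> thus have the same horizontal part, and the latter is known.\<close>

lemma g_D_\<zeta>_lift:
  assumes Z: "Z \<in> B.VF" and W: "W \<in> B.VF"
  shows "g q (D \<zeta> (lift Z) q) (lift W q) = - real (card J) * g q (\<phi> q (lift Z q)) (lift W q)"
proof -
  note [simp] = lift_vf[OF Z] lift_vf[OF W]
  have "related \<zeta> 0" by (simp add: related_def)
  then have "related (lie_bracket \<zeta> (lift Z)) (lie_bracket 0 Z)"
    by (rule related_bracket) (rule related_lift[OF Z])
  moreover have "lie_bracket 0 Z = 0"
    using B.torsion_free[OF B.vf_0 Z] Z by (simp add: B.D_0_left B.D_0_right)
  ultimately have "d\<tau> (lie_bracket \<zeta> (lift Z) q) = 0" by (simp add: related_def)
  then have "g q (lie_bracket \<zeta> (lift Z) q) (lift W q) = 0"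
    using g_hor_right[of "lie_bracket \<zeta> (lift Z) q" q "lift W q"] lift_H[OF W] W by (simp add: d\<tau>_lift)
  then show ?thesis
    using M.torsion_free_at[of \<zeta> "lift Z" q] by (simp add: D_\<zeta>)
qed

text \<open>The vertical part of an inner derivative contributes horizontally only through the
  derivative of \<open>\<zeta>\<close>, which is \<open>- card J\<close> times \<phi>; the
  derivative of its coefficient multiplies \<open>\<zeta>\<close> and is lost against
  \<open>lift W\<close>. The bracket contributes through its vertical part, whose factor 2 reappears
  in the last product.\<close>

lemma oneill:
  fixes q :: 'a
  assumes X: "X \<in> B.VF" and Y: "Y \<in> B.VF" and Z: "Z \<in> B.VF" and W: "W \<in> B.VF"
  defines "\<Phi> \<equiv> \<lambda>U V. g q (\<phi> q (lift U q)) (lift V q)"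
  shows "g q (curvature D (lift X) (lift Y) (lift Z) q) (lift W q) =
    g' (\<tau> q) (curvature D' X Y Z (\<tau> q)) (W (\<tau> q))
    + real (card J) * (\<Phi> X Z * \<Phi> Y W - \<Phi> Y Z * \<Phi> X W + 2 * \<Phi> X Y * \<Phi> Z W)"
proof -
  note [simp] = lift_vf[OF X] lift_vf[OF Y] lift_vf[OF Z] lift_vf[OF W]
  have hW: "g q x (lift W q) = g' (\<tau> q) (d\<tau> x) (W (\<tau> q))" if "x \<in> M.T q" for x
    using g_hor_right[OF that lift_H[OF W]] by (simp add: d\<tau>_lift[OF W])
  have \<zeta>W: "g q (\<zeta> q) (lift W q) = 0" by (rule g_\<zeta>_H[OF lift_H[OF W]])
  have DD: "g q (D (lift U) (D (lift V) (lift Z)) q) (lift W q) =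
      g' (\<tau> q) (D' U (D' V Z) (\<tau> q)) (W (\<tau> q)) - real (card J) * (\<Phi> V Z * \<Phi> U W)"
    if U: "U \<in> B.VF" and V: "V \<in> B.VF" for U V
  proof -
    note [simp] = lift_vf[OF U] lift_vf[OF V] B.D_vf[OF V Z] lift_vf[OF B.D_vf[OF V Z]]
    let ?f = "\<lambda>q. g q (\<phi> q (lift V q)) (lift Z q)"
    have sf: "smooth_fun A ?f" by (intro M.g_smooth M.F_vf) simp_all
    have "D (lift U) (D (lift V) (lift Z)) =
        D (lift U) (lift (D' V Z)) + (\<lambda>q. lift U q ?f *\<^sub>R \<zeta> q + ?f q *\<^sub>R D (lift U) \<zeta> q)"
      unfolding D_lift[OF V Z]
      by (subst M.D_add_right) (simp_all only: M.D_scale_right[OF lift_vf[OF U] \<zeta>_vf sf] lift_vf U V Z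
          B.D_vf M.vf_scale[OF sf \<zeta>_vf])
    then have "D (lift U) (D (lift V) (lift Z)) q =
        D (lift U) (lift (D' V Z)) q + (lift U q ?f *\<^sub>R \<zeta> q + ?f q *\<^sub>R D (lift U) \<zeta> q)"
      by (simp only: plus_fun_apply)
    then have "g q (D (lift U) (D (lift V) (lift Z)) q) (lift W q) =
        g q (D (lift U) (lift (D' V Z)) q) (lift W q)
        + (lift U q ?f * g q (\<zeta> q) (lift W q) + ?f q * g q (D (lift U) \<zeta> q) (lift W q))"
      by simp
    moreover have "g q (D (lift U) (lift (D' V Z)) q) (lift W q) = g' (\<tau> q) (D' U (D' V Z) (\<tau> q)) (W (\<tau> q))"
      by (subst hW) (simp_all add: d\<tau>_D_lift U)
    ultimately show ?thesis by (simp add: \<zeta>W D_\<zeta> \<Phi>_def)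
  qed
  have br: "lie_bracket X Y \<in> B.VF" using X Y by simp
  let ?f = "\<lambda>q. 2 * g q (\<phi> q (lift X q)) (lift Y q)"
  have sf: "smooth_fun A ?f" by (intro M.smooth_fun_mult M.g_smooth M.F_vf M.smooth_fun_const) simp_all
  have "D (lie_bracket (lift X) (lift Y)) (lift Z) =
      D (lift (lie_bracket X Y)) (lift Z) + (\<lambda>q. ?f q *\<^sub>R D \<zeta> (lift Z) q)"
    unfolding bracket_lift[OF X Y]
    by (subst M.D_add_left) (simp_all only: M.D_scale_left[OF \<zeta>_vf lift_vf[OF Z] sf] lift_vf br Z
        M.vf_scale[OF sf \<zeta>_vf])
  then have "D (lie_bracket (lift X) (lift Y)) (lift Z) q =
      D (lift (lie_bracket X Y)) (lift Z) q + ?f q *\<^sub>R D \<zeta> (lift Z) q"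
    by (simp only: plus_fun_apply)
  then have "g q (D (lie_bracket (lift X) (lift Y)) (lift Z) q) (lift W q) =
      g q (D (lift (lie_bracket X Y)) (lift Z) q) (lift W q) + ?f q * g q (D \<zeta> (lift Z) q) (lift W q)"
    using lift_vf[OF br] by simp
  moreover have "g q (D (lift (lie_bracket X Y)) (lift Z) q) (lift W q) =
      g' (\<tau> q) (D' (lie_bracket X Y) Z (\<tau> q)) (W (\<tau> q))"
    by (subst hW) (use lift_vf[OF br] in \<open>simp_all add: d\<tau>_D_lift br Z\<close>)
  ultimately have Db: "g q (D (lie_bracket (lift X) (lift Y)) (lift Z) q) (lift W q) =
      g' (\<tau> q) (D' (lie_bracket X Y) Z (\<tau> q)) (W (\<tau> q)) - real (card J) * (2 * \<Phi> X Y * \<Phi> Z W)"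
    by (simp add: g_D_\<zeta>_lift[OF Z W] \<Phi>_def)
  have "g q (curvature D (lift X) (lift Y) (lift Z) q) (lift W q) =
      g q (D (lift X) (D (lift Y) (lift Z)) q) (lift W q) - g q (D (lift Y) (D (lift X) (lift Z)) q) (lift W q)
      - g q (D (lie_bracket (lift X) (lift Y)) (lift Z) q) (lift W q)"
    by (simp add: curvature_def)
  moreover have "g' (\<tau> q) (curvature D' X Y Z (\<tau> q)) (W (\<tau> q)) =
      g' (\<tau> q) (D' X (D' Y Z) (\<tau> q)) (W (\<tau> q)) - g' (\<tau> q) (D' Y (D' X Z) (\<tau> q)) (W (\<tau> q))
      - g' (\<tau> q) (D' (lie_bracket X Y) Z (\<tau> q)) (W (\<tau> q))"
    using X Y Z W by (simp add: curvature_def)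
  ultimately show ?thesis unfolding DD[OF X Y] DD[OF Y X] Db by (simp add: algebra_simps)
qed

lemma lift_at: "X \<in> B.VF \<Longrightarrow> x \<in> H q \<Longrightarrow> X (\<tau> q) = d\<tau> x \<Longrightarrow> lift X q = x"
  by (rule d\<tau>_inj[OF lift_H]) (simp_all add: d\<tau>_lift)

lemma Rm_oneill:
  assumes x: "x \<in> H q" and y: "y \<in> H q" and z: "z \<in> H q" and w: "w \<in> H q"
  shows "M.Rm q x y z w = B.Rm (\<tau> q) (d\<tau> x) (d\<tau> y) (d\<tau> z) (d\<tau> w) + real (card J) *
    (g q (\<phi> q x) z * g q (\<phi> q y) w - g q (\<phi> q y) z * g q (\<phi> q x) w + 2 * g q (\<phi> q x) y * g q (\<phi> q z) w)"
proof -
  obtain X where X: "X \<in> B.VF" "X (\<tau> q) = d\<tau> x" using B.extend_tangent[OF d\<tau>_T[OF H_T[OF x]]] .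
  obtain Y where Y: "Y \<in> B.VF" "Y (\<tau> q) = d\<tau> y" using B.extend_tangent[OF d\<tau>_T[OF H_T[OF y]]] .
  obtain Z where Z: "Z \<in> B.VF" "Z (\<tau> q) = d\<tau> z" using B.extend_tangent[OF d\<tau>_T[OF H_T[OF z]]] .
  obtain W where W: "W \<in> B.VF" "W (\<tau> q) = d\<tau> w" using B.extend_tangent[OF d\<tau>_T[OF H_T[OF w]]] .
  note l = lift_at[OF X(1) x X(2)] lift_at[OF Y(1) y Y(2)] lift_at[OF Z(1) z Z(2)] lift_at[OF W(1) w W(2)]
  show ?thesis
    using oneill[OF X(1) Y(1) Z(1) W(1), of q]
      M.Rm_eq[OF lift_vf[OF X(1)] lift_vf[OF Y(1)] lift_vf[OF Z(1)], of q w]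
      B.Rm_eq[OF X(1) Y(1) Z(1), of "\<tau> q" "d\<tau> w"]
    by (simp only: l X Y Z W)
qed

end

section \<open>Quotient dimensions and eigenspaces of symmetric forms\<close>

lemma independent_ex_finite_basis:
  fixes V :: "'v::real_vector set"
  assumes "finite B" "V \<subseteq> span B" "subspace V"
  obtains C where "finite C" "independent C" "span C = V" "card C = dim V"
proof -
  obtain C where C: "C \<subseteq> V" "independent C" "V \<subseteq> span C" "card C = dim V" using basis_exists by blast
  have "finite C" using independent_span_bound[OF assms(1) C(2)] C(1) assms(2) by blast
  moreover have "span C = V" using C assms(3) span_minimal by blast
  ultimately show ?thesis using that C by blast
qed

lemma dim_direct_sum:
  fixes U V :: "'v::real_vector set"
  assumes B: "finite B" "U \<subseteq> span B" "V \<subseteq> span B" and U: "subspace U" and V: "subspace V"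
    and dis: "U \<inter> V \<subseteq> {0}"
  shows "dim {u + v | u v. u \<in> U \<and> v \<in> V} = dim U + dim V"
proof -
  obtain C where C: "finite C" "independent C" "span C = U" "card C = dim U"
    using independent_ex_finite_basis[OF B(1,2) U] .
  obtain D where D: "finite D" "independent D" "span D = V" "card D = dim V"
    using independent_ex_finite_basis[OF B(1,3) V] .
  have CD: "C \<inter> D = {}"
  proof -
    have "c = 0" if "c \<in> C" "c \<in> D" for c using that dis C(3) D(3) span_base by blast
    then show ?thesis using C(2) dependent_zero by blast
  qed
  have "independent (C \<union> D)"
    unfolding dependent_finite[OF finite_UnI[OF C(1) D(1)]]
  proof clarify
    fix f v assume s: "(\<Sum>v\<in>C \<union> D. f v *\<^sub>R v) = 0" and v: "v \<in> C \<union> D" "f v \<noteq> 0"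
    let ?a = "\<Sum>v\<in>C. f v *\<^sub>R v" and ?b = "\<Sum>v\<in>D. f v *\<^sub>R v"
    have ab: "?a + ?b = 0" using s sum.union_disjoint[OF C(1) D(1) CD] by metis
    have aU: "?a \<in> U" using C(3) by (metis (no_types, lifting) span_base span_scale span_sum)
    have bV: "?b \<in> V" using D(3) by (metis (no_types, lifting) span_base span_scale span_sum)
    have "?a = - ?b" using ab by (simp only: eq_neg_iff_add_eq_0)
    then have aV: "?a \<in> V" by (simp only: subspace_neg[OF V bV])
    have a0: "?a = 0" using subsetD[OF dis IntI[OF aU aV]] by (rule singletonD)
    have b0: "?b = 0" using ab unfolding a0 by (simp only: add_0_left)
    have "\<forall>v\<in>C. f v = 0" using a0 C(2) unfolding dependent_finite[OF C(1)] by blast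
    moreover have "\<forall>v\<in>D. f v = 0" using b0 D(2) unfolding dependent_finite[OF D(1)] by blast
    ultimately show False using v by blast
  qed
  moreover have "span (C \<union> D) = {u + v | u v. u \<in> U \<and> v \<in> V}"
    unfolding span_Un C(3) D(3) by blast
  moreover from this have "span (C \<union> D) = span {u + v | u v. u \<in> U \<and> v \<in> V}" by (metis span_span)
  ultimately have "dim {u + v | u v. u \<in> U \<and> v \<in> V} = card (C \<union> D)"
    by (intro dim_eq_card)
  then show ?thesis using card_Un_disjoint[OF C(1) D(1) CD] C D by simp
qed

lemma dim_linear_image:
  fixes f :: "'v::real_vector \<Rightarrow> 'w::real_vector"
  assumes f: "linear f" and V: "subspace V" and inj: "inj_on f V"
    and B: "finite B" "V \<subseteq> span B"
  shows "dim (f ` V) = dim V"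
proof -
  obtain C where C: "finite C" "independent C" "span C = V" "card C = dim V"
    using independent_ex_finite_basis[OF B V] .
  have i: "independent (f ` C)"
    by (rule linear_independent_injective_image[OF f C(2)]) (simp add: C inj)
  have s: "span (f ` C) = f ` V" using linear_span_image[OF f, of C] C(3) by simp
  have "C \<subseteq> V" using C(3) span_base by blast
  then have "card (f ` C) = card C" by (meson card_image inj inj_on_subset)
  moreover have "dim (f ` V) = card (f ` C)"
    by (rule dim_eq_card[OF _ i]) (metis s span_span)
  ultimately show ?thesis using C by simp
qed

lemma coset_eq_iff: "coset u x = coset u y \<longleftrightarrow> x - y \<in> span {u}"
proof
  assume "coset u x = coset u y"
  moreover have "x \<in> coset u x" unfolding coset_def using span_zero by force
  ultimately obtain z where "x = y + z" "z \<in> span {u}" unfolding coset_def by blast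
  then show "x - y \<in> span {u}" by simp
next
  assume a: "x - y \<in> span {u}"
  have "x + z \<in> coset u y" if "z \<in> span {u}" for z
  proof -
    have "x + z = y + ((x - y) + z)" by simp
    then show ?thesis unfolding coset_def using span_add[OF a that] by blast
  qed
  moreover have "y + z \<in> coset u x" if "z \<in> span {u}" for z
  proof -
    have "y + z = x + (z - (x - y))" by simp
    then show ?thesis unfolding coset_def using span_diff[OF that a] by blast
  qed
  ultimately show "coset u x = coset u y" unfolding coset_def by blast
qed

abbreviation tuples :: "nat \<Rightarrow> (nat \<Rightarrow> real) set" where
  "tuples k \<equiv> {c. \<forall>i\<ge>k. c i = 0}"

text \<open>Unit tuples are sent to the vectors \<open>w i\<close>; injectivity makes these distinct
  and independent, surjectivity makes them span.\<close>

lemma tuples_bij_imp_dim: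
  fixes w :: "nat \<Rightarrow> 'v::real_vector"
  assumes bij: "bij_betw (\<lambda>c. \<Sum>i<k. c i *\<^sub>R w i) (tuples k) W"
  shows "dim W = k"
proof -
  let ?f = "\<lambda>c. \<Sum>i<k. c i *\<^sub>R w i"
  have inj: "c = d" if "c \<in> tuples k" "d \<in> tuples k" "?f c = ?f d" for c d
    using bij that by (auto simp: bij_betw_def inj_on_def)
  have im: "W = ?f ` tuples k" using bij by (auto simp: bij_betw_def)
  define e where "e = (\<lambda>(j::nat) i. if i = j then 1 else (0::real))"
  have fe: "?f (e j) = w j" if "j < k" for j
  proof -
    have "?f (e j) = (\<Sum>i<k. if i = j then w i else 0)" by (intro sum.cong) (auto simp: e_def)
    then show ?thesis using that by simp
  qed
  have et: "e j \<in> tuples k" if "j < k" for j using that by (auto simp: e_def)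
  have wi: "inj_on w {..<k}"
  proof
    fix i j assume ij: "i \<in> {..<k}" "j \<in> {..<k}" "w i = w j"
    then have "e i = e j" by (intro inj et) (auto simp: fe)
    then show "i = j" by (metis e_def zero_neq_one)
  qed
  have "independent (w ` {..<k})"
    unfolding dependent_finite[OF finite_imageI[OF finite_lessThan]]
  proof clarify
    fix f j assume s: "(\<Sum>v\<in>w ` {..<k}. f v *\<^sub>R v) = 0" and j: "j < k" "f (w j) \<noteq> 0"
    define c where "c = (\<lambda>i. if i < k then f (w i) else 0)"
    have "?f c = (\<Sum>i<k. f (w i) *\<^sub>R w i)" by (intro sum.cong) (auto simp: c_def)
    also have "\<dots> = 0" using s by (simp only: sum.reindex[OF wi] comp_def)
    also have "\<dots> = ?f (\<lambda>_. 0)" by simp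
    finally have "c = (\<lambda>_. 0)" by (intro inj) (auto simp: c_def)
    then show False using j by (metis c_def)
  qed
  moreover have "span (w ` {..<k}) = span W"
  proof
    have "w j \<in> W" if "j < k" for j
      using imageI[OF et[OF that], of ?f] unfolding im[symmetric] fe[OF that] .
    then show "span (w ` {..<k}) \<subseteq> span W" by (intro span_mono) auto
    have "W \<subseteq> span (w ` {..<k})"
      unfolding im by (rule image_subsetI, intro span_sum span_scale span_base imageI)
    then show "span W \<subseteq> span (w ` {..<k})" by (simp add: span_minimal)
  qed
  ultimately have "dim W = card (w ` {..<k})" by (intro dim_eq_card)
  then show ?thesis by (simp add: card_image[OF wi])
qed

lemma dim_ex_tuples_bij:
  fixes W :: "'v::real_vector set"
  assumes "finite B" "W \<subseteq> span B" "subspace W"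
  shows "\<exists>w. bij_betw (\<lambda>c. \<Sum>i<dim W. c i *\<^sub>R w i) (tuples (dim W)) W"
proof -
  obtain C where C: "finite C" "independent C" "span C = W" "card C = dim W"
    using independent_ex_finite_basis[OF assms] .
  let ?k = "dim W"
  obtain w where w: "bij_betw w {..<?k} C"
    using ex_bij_betw_nat_finite[OF C(1)] C(4) by (metis atLeast0LessThan)
  have wi: "inj_on w {..<?k}" and wC: "C = w ` {..<?k}" using w by (auto simp: bij_betw_def)
  let ?f = "\<lambda>c. \<Sum>i<?k. c i *\<^sub>R w i"
  have re: "(\<Sum>v\<in>C. h v *\<^sub>R v) = (\<Sum>i<?k. h (w i) *\<^sub>R w i)" for h
    unfolding wC sum.reindex[OF wi] comp_def ..
  have "inj_on ?f (tuples ?k)"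
  proof
    fix c d assume cd: "c \<in> tuples ?k" "d \<in> tuples ?k" "?f c = ?f d"
    define h where "h = (\<lambda>v. c (inv_into {..<?k} w v) - d (inv_into {..<?k} w v))"
    have h: "h (w i) = c i - d i" if "i < ?k" for i using that wi by (simp add: h_def)
    have "(\<Sum>v\<in>C. h v *\<^sub>R v) = (\<Sum>i<?k. (c i - d i) *\<^sub>R w i)"
      unfolding re by (intro sum.cong) (auto simp: h)
    also have "\<dots> = 0" using cd(3) by (simp add: scaleR_left_diff_distrib sum_subtractf)
    finally have "\<forall>v\<in>C. h v = 0" using C(1,2) dependent_finite by blast
    then have "c i = d i" if "i < ?k" for i using h[OF that] wC that by auto
    moreover have "c i = d i" if "\<not> i < ?k" for i using cd(1,2) that by simp
    ultimately show "c = d" by blast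
  qed
  moreover have "?f ` tuples ?k = W"
  proof
    have "w i \<in> C" if "i < ?k" for i using that bij_betwE[OF w] by simp
    then have "w i \<in> W" if "i < ?k" for i using that span_base[of "w i" C] unfolding C(3) by simp
    then show "?f ` tuples ?k \<subseteq> W"
      by (intro image_subsetI subspace_sum[OF assms(3)] subspace_scale[OF assms(3)]) simp
    show "W \<subseteq> ?f ` tuples ?k"
    proof
      fix x assume "x \<in> W"
      then obtain h where "x = (\<Sum>v\<in>C. h v *\<^sub>R v)" using C(3) span_finite[OF C(1)] by blast
      then have "x = (\<Sum>i<?k. h (w i) *\<^sub>R w i)" unfolding re .
      also have "\<dots> = ?f (\<lambda>i. if i < ?k then h (w i) else 0)" by (rule sum.cong) auto
      finally have x: "x = ?f (\<lambda>i. if i < ?k then h (w i) else 0)" .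
      show "x \<in> ?f ` tuples ?k"
        by (rule rev_image_eqI[where x = "\<lambda>i. if i < ?k then h (w i) else 0"]) (simp, rule x)
    qed
  qed
  ultimately show ?thesis unfolding bij_betw_def by blast
qed

text \<open>As \<open>u\<close> lies outside the subspace \<open>W\<close>, distinct elements of
  \<open>W\<close> have distinct cosets, so a basis of \<open>W\<close> serves for the quotient. For
  uniqueness of the number, representatives of any other basis are moved into \<open>W\<close> along
  \<open>u\<close>.\<close>

lemma quot_dim_coset_image:
  fixes W :: "'v::real_vector set"
  assumes B: "finite B" "W \<subseteq> span B" and W: "subspace W" and u: "u \<notin> W"
  shows "quot_dim u (coset u ` W) = dim W"
proof -
  have inj: "inj_on (coset u) W"
  proof
    fix x y assume xy: "x \<in> W" "y \<in> W" "coset u x = coset u y"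
    then have "x - y \<in> span {u}" by (simp add: coset_eq_iff)
    then obtain t where t: "x - y = t *\<^sub>R u" by (auto simp: span_singleton)
    have "t = 0"
    proof (rule ccontr)
      assume "t \<noteq> 0"
      then have "u = inverse t *\<^sub>R (x - y)" unfolding t by simp
      then show False using u subspace_scale[OF W subspace_diff[OF W xy(1,2)]] by simp
    qed
    then show "x = y" using t by simp
  qed
  have bijc: "bij_betw (coset u) W (coset u ` W)" using inj by (simp add: bij_betw_def)
  show ?thesis unfolding quot_dim_def
  proof (rule the_equality)
    obtain w where w: "bij_betw (\<lambda>c. \<Sum>i<dim W. c i *\<^sub>R w i) (tuples (dim W)) W"
      using dim_ex_tuples_bij[OF B W] by blast
    show "\<exists>b. bij_betw (\<lambda>c. coset u (\<Sum>i<dim W. c i *\<^sub>R b i)) (tuples (dim W)) (coset u ` W)"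
      using bij_betw_trans[OF w bijc] by (auto simp: comp_def)
  next
    fix k assume "\<exists>b. bij_betw (\<lambda>c. coset u (\<Sum>i<k. c i *\<^sub>R b i)) (tuples k) (coset u ` W)"
    then obtain b where b: "bij_betw (\<lambda>c. coset u (\<Sum>i<k. c i *\<^sub>R b i)) (tuples k) (coset u ` W)" by blast
    have "\<exists>w\<in>W. b j - w \<in> span {u}" if j: "j < k" for j
    proof -
      let ?e = "\<lambda>i. if i = j then 1 else (0::real)"
      have "(\<Sum>i<k. ?e i *\<^sub>R b i) = (\<Sum>i<k. if i = j then b i else 0)" by (intro sum.cong) auto
      then have bj: "(\<Sum>i<k. ?e i *\<^sub>R b i) = b j" using j by simp
      have "?e \<in> tuples k" using j by auto
      from bij_betw_apply[OF b this] have "coset u (b j) \<in> coset u ` W" unfolding bj .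
      then show ?thesis by (auto simp: coset_eq_iff)
    qed
    then obtain w where w: "\<And>j. j < k \<Longrightarrow> w j \<in> W \<and> b j - w j \<in> span {u}" by metis
    have "coset u (\<Sum>i<k. c i *\<^sub>R b i) = coset u (\<Sum>i<k. c i *\<^sub>R w i)" for c
    proof -
      have "(\<Sum>i<k. c i *\<^sub>R b i) - (\<Sum>i<k. c i *\<^sub>R w i) = (\<Sum>i<k. c i *\<^sub>R (b i - w i))"
        by (simp add: sum_subtractf scaleR_right_diff_distrib)
      also have "\<dots> \<in> span {u}" using w by (intro span_sum span_scale) auto
      finally show ?thesis by (simp add: coset_eq_iff)
    qed
    then have "bij_betw (coset u \<circ> (\<lambda>c. \<Sum>i<k. c i *\<^sub>R w i)) (tuples k) (coset u ` W)"
      using b by (simp add: comp_def)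
    moreover have "(\<lambda>c. \<Sum>i<k. c i *\<^sub>R w i) ` tuples k \<subseteq> W"
      using w by (intro image_subsetI subspace_sum[OF W] subspace_scale[OF W]) simp
    ultimately have "bij_betw (\<lambda>c. \<Sum>i<k. c i *\<^sub>R w i) (tuples k) W"
      using bij_betw_comp_iff2[OF bijc] by blast
    then show "k = dim W" by (rule tuples_bij_imp_dim[symmetric])
  qed
qed

text \<open>For \<open>G\<close> positive definite on \<open>E\<close> this is the eigenspace of the
  self-adjoint operator that represents \<open>b\<close>. Testing against \<open>E\<close> alone
  means that no operator has to be projected onto \<open>E\<close>.\<close>

definition eigenspace :: "'v set \<Rightarrow> ('v \<Rightarrow> 'v \<Rightarrow> real) \<Rightarrow> ('v \<Rightarrow> 'v \<Rightarrow> real) \<Rightarrow> real \<Rightarrow> 'v::real_vector set" where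
  "eigenspace E G b c = {y \<in> E. \<forall>v\<in>E. b y v = c * G y v}"

locale form_space =
  fixes E :: "'v::real_vector set" and G :: "'v \<Rightarrow> 'v \<Rightarrow> real"
  assumes E: "subspace E" and E_fin: "\<exists>B. finite B \<and> E \<subseteq> span B"
    and G_add: "x \<in> E \<Longrightarrow> y \<in> E \<Longrightarrow> z \<in> E \<Longrightarrow> G (x + y) z = G x z + G y z"
    and G_scale: "x \<in> E \<Longrightarrow> z \<in> E \<Longrightarrow> G (c *\<^sub>R x) z = c * G x z"
    and G_sym: "x \<in> E \<Longrightarrow> y \<in> E \<Longrightarrow> G x y = G y x"
begin

definition symmetric_form :: "('v \<Rightarrow> 'v \<Rightarrow> real) \<Rightarrow> bool" where
  "symmetric_form b \<longleftrightarrow> (\<forall>x\<in>E. \<forall>y\<in>E. b x y = b y x) \<and>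
    (\<forall>x\<in>E. \<forall>y\<in>E. \<forall>z\<in>E. b (x + y) z = b x z + b y z) \<and>
    (\<forall>x\<in>E. \<forall>z\<in>E. \<forall>c. b (c *\<^sub>R x) z = c * b x z)"

lemma subspace_eigenspace:
  assumes "symmetric_form b" shows "subspace (eigenspace E G b c)"
proof (rule subspaceI)
  have "G 0 v = 0" "b 0 v = 0" if "v \<in> E" for v
    using G_scale[of 0 v 0] assms that subspace_0[OF E] unfolding symmetric_form_def
    by (simp, metis scale_zero_left mult_zero_left)
  then show "0 \<in> eigenspace E G b c" using subspace_0[OF E] by (simp add: eigenspace_def)
qed (use assms E G_add G_scale in \<open>auto simp: eigenspace_def symmetric_form_def subspace_add subspace_scale algebra_simps\<close>)

text \<open>A unit eigenvector splits off as an orthogonal summand of a symmetric form. The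
  remaining dimension does not mention \<open>l\<close>, which allows two forms that differ only
  along \<open>v0\<close> to be compared.\<close>

lemma eigenspace_split:
  assumes b: "symmetric_form b" and v0: "v0 \<in> E" "G v0 v0 = 1"
    and eig: "\<And>v. v \<in> E \<Longrightarrow> b v0 v = l * G v0 v"
  shows "dim (eigenspace E G b c) =
    dim {y \<in> E. G y v0 = 0 \<and> (\<forall>v\<in>E. b y v = c * G y v)} + (if c = l then 1 else 0)"
proof -
  let ?N = "{y \<in> E. G y v0 = 0 \<and> (\<forall>v\<in>E. b y v = c * G y v)}"
  have b_add: "b (x + y) z = b x z + b y z" and b_scale: "b (k *\<^sub>R x) z = k * b x z"
    and b_sym: "b x y = b y x" if "x \<in> E" "y \<in> E" "z \<in> E" for x y z k
    using b that by (auto simp: symmetric_form_def)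
  obtain B where B: "finite B" "E \<subseteq> span B" using E_fin by blast
  have N_eq: "?N = eigenspace E G b c \<inter> {y \<in> E. G y v0 = 0}" by (auto simp: eigenspace_def)
  have "subspace {y \<in> E. G y v0 = 0}"
    using E G_add G_scale G_scale[of 0 v0 0] v0
    by (auto simp: subspace_def)
  then have N: "subspace ?N" unfolding N_eq by (intro subspace_inter subspace_eigenspace b)
  have dec: "\<exists>a y0. y = a *\<^sub>R v0 + y0 \<and> y0 \<in> E \<and> G y0 v0 = 0" if y: "y \<in> E" for y
  proof (intro exI conjI)
    show "y = G y v0 *\<^sub>R v0 + (y + (- G y v0) *\<^sub>R v0)" by simp
    show "y + (- G y v0) *\<^sub>R v0 \<in> E" using E y v0 by (intro subspace_add subspace_scale)
    have "G (y + (- G y v0) *\<^sub>R v0) v0 = G y v0 + - G y v0 * G v0 v0"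
      using y v0 E by (simp only: G_add G_scale subspace_scale)
    then show "G (y + (- G y v0) *\<^sub>R v0) v0 = 0" using v0 by simp
  qed
  have key: "a * (l - c) = 0 \<and> y0 \<in> ?N"
    if y0: "y0 \<in> E" "G y0 v0 = 0" and y: "a *\<^sub>R v0 + y0 \<in> eigenspace E G b c" for a y0
  proof -
    have av: "a *\<^sub>R v0 \<in> E" using E v0 by (simp add: subspace_scale)
    have *: "a * (l - c) * G v0 v + (b y0 v - c * G y0 v) = 0" if v: "v \<in> E" for v
    proof -
      have "b (a *\<^sub>R v0 + y0) v = c * G (a *\<^sub>R v0 + y0) v" using y v by (auto simp: eigenspace_def)
      then show ?thesis
        using b_add[OF av y0(1) v] b_scale[OF v0(1) v0(1) v] G_add[OF av y0(1) v] G_scale[OF v0(1) v] eig[OF v]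
        by (simp add: algebra_simps)
    qed
    \<comment> \<open>By symmetry and the eigenvector property this is a multiple of
      \<open>G y0 v0\<close>. Testing with \<open>v0\<close> therefore isolates
      \<open>a * (l - c)\<close>.\<close>
    have "b y0 v0 = 0" using b_sym[OF y0(1) v0(1) v0(1)] eig[OF y0(1)] G_sym[OF v0(1) y0(1)] y0 by simp
    then have 0: "a * (l - c) = 0" using *[OF v0(1)] y0 v0 by simp
    then have "b y0 v = c * G y0 v" if "v \<in> E" for v using *[OF that] unfolding 0 by simp
    then show ?thesis using y0 0 by blast
  qed
  have NE: "?N \<subseteq> span B" using B by auto
  show ?thesis
  proof (cases "c = l")
    case False
    have "eigenspace E G b c = ?N"
    proof
      show "eigenspace E G b c \<subseteq> ?N"
      proof
        fix y assume y: "y \<in> eigenspace E G b c"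
        then obtain a y0 where "y = a *\<^sub>R v0 + y0" "y0 \<in> E" "G y0 v0 = 0"
          using dec[of y] by (auto simp: eigenspace_def)
        then show "y \<in> ?N" using key[of y0 a] y False by auto
      qed
    qed (auto simp: eigenspace_def)
    then show ?thesis using False by simp
  next
    case True
    have v0n: "v0 \<noteq> 0" using v0 G_scale[of 0 0 0] subspace_0[OF E] by auto
    have L: "a *\<^sub>R v0 \<in> eigenspace E G b c" for a
      using subspace_scale[OF subspace_eigenspace[OF b]] v0 eig True by (auto simp: eigenspace_def)
    have "eigenspace E G b c = {x + y | x y. x \<in> span {v0} \<and> y \<in> ?N}" (is "_ = ?S")
    proof
      show "eigenspace E G b c \<subseteq> ?S"
      proof
        fix y assume y: "y \<in> eigenspace E G b c"
        then obtain a y0 where a: "y = a *\<^sub>R v0 + y0" "y0 \<in> E" "G y0 v0 = 0"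
          using dec[of y] by (auto simp: eigenspace_def)
        then have "y0 \<in> ?N" using key[of y0 a] y by auto
        then show "y \<in> ?S" using a span_singleton by blast
      qed
      show "?S \<subseteq> eigenspace E G b c"
      proof
        fix y assume "y \<in> ?S"
        then obtain a z where "y = a *\<^sub>R v0 + z" "z \<in> ?N" by (auto simp: span_singleton)
        then show "y \<in> eigenspace E G b c"
          using subspace_add[OF subspace_eigenspace[OF b] L] N_eq by blast
      qed
    qed
    moreover have "dim ?S = dim (span {v0}) + dim ?N"
    proof (rule dim_direct_sum[OF B(1) _ NE subspace_span N])
      show "span {v0} \<subseteq> span B" using B v0 by (intro span_minimal) auto
      show "span {v0} \<inter> ?N \<subseteq> {0}" using v0 G_scale by (auto simp: span_singleton)
    qed
    moreover have "dim (span {v0}) = 1"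
      using v0n dim_eq_card[of "{v0}" "span {v0}"] by (simp add: span_span)
    ultimately show ?thesis using True by simp
  qed
qed

text \<open>Eigenvectors for different eigenvalues are orthogonal, hence independent by positivity;
  \<open>card B + 1\<close> of them cannot fit into the span of \<open>B\<close>.\<close>

lemma finite_eigenvalues:
  assumes b: "symmetric_form b" and pos: "\<And>x. x \<in> E \<Longrightarrow> x \<noteq> 0 \<Longrightarrow> G x x > 0"
  shows "finite {c. dim (eigenspace E G b c) > 0}"
proof (rule ccontr)
  obtain B where B: "finite B" "E \<subseteq> span B" using E_fin by blast
  assume "infinite {c. dim (eigenspace E G b c) > 0}"
  then obtain C where C: "C \<subseteq> {c. dim (eigenspace E G b c) > 0}" "finite C" "card C = card B + 1"
    using infinite_arbitrarily_large by blast
  have "\<exists>y\<in>eigenspace E G b c. y \<noteq> 0" if "c \<in> C" for c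
  proof (rule ccontr)
    assume "\<not> ?thesis"
    then have "eigenspace E G b c \<subseteq> span {}" by auto
    then have "dim (eigenspace E G b c) \<le> card ({} :: 'v set)" by (intro dim_le_card) auto
    then show False using that C(1) by auto
  qed
  then obtain y where y: "\<And>c. c \<in> C \<Longrightarrow> y c \<in> eigenspace E G b c \<and> y c \<noteq> 0" by metis
  have yE: "y c \<in> E" if "c \<in> C" for c using y[OF that] by (simp add: eigenspace_def)
  have orth: "G (y c) (y d) = 0" if cd: "c \<in> C" "d \<in> C" "c \<noteq> d" for c d
  proof -
    have "c * G (y c) (y d) = b (y c) (y d)" using y[OF cd(1)] yE[OF cd(2)] by (simp add: eigenspace_def)
    also have "\<dots> = b (y d) (y c)" using b yE cd by (auto simp: symmetric_form_def)
    also have "\<dots> = d * G (y d) (y c)" using y[OF cd(2)] yE[OF cd(1)] by (simp add: eigenspace_def)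
    also have "\<dots> = d * G (y c) (y d)" using G_sym[OF yE[OF cd(1)] yE[OF cd(2)]] by simp
    finally have "c * G (y c) (y d) = d * G (y c) (y d)" .
    then show ?thesis using cd(3) mult_cancel_right by blast
  qed
  have inj: "inj_on y C"
    using orth pos y yE by (metis (no_types, lifting) inj_onI less_irrefl)
  have G_sum: "G (\<Sum>c\<in>K. f c *\<^sub>R y c) z = (\<Sum>c\<in>K. f c * G (y c) z)" if "K \<subseteq> C" "z \<in> E" for K f z
    using finite_subset[OF that(1) C(2)] that
  proof (induction K)
    case empty
    then show ?case using G_scale[of 0 z 0] subspace_0[OF E] by simp
  next
    case (insert k K)
    have "(\<Sum>c\<in>K. f c *\<^sub>R y c) \<in> E" using insert.prems yE E by (intro subspace_sum subspace_scale) auto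
    then show ?case using insert yE E by (simp add: G_add G_scale subspace_scale)
  qed
  have "independent (y ` C)"
    unfolding dependent_finite[OF finite_imageI[OF C(2)]]
  proof clarify
    fix f c assume s: "(\<Sum>v\<in>y ` C. f v *\<^sub>R v) = 0" and c: "c \<in> C" "f (y c) \<noteq> 0"
    have "(\<Sum>d\<in>C. f (y d) * G (y d) (y c)) = G (\<Sum>d\<in>C. f (y d) *\<^sub>R y d) (y c)"
      using G_sum[of C "y c" "\<lambda>d. f (y d)"] yE c by simp
    also have "\<dots> = G 0 (y c)" using s by (simp only: sum.reindex[OF inj] comp_def)
    also have "\<dots> = 0" using G_scale[of 0 "y c" 0] subspace_0[OF E] yE c by simp
    finally have "(\<Sum>d\<in>C. f (y d) * G (y d) (y c)) = 0" .
    moreover have "(\<Sum>d\<in>C. f (y d) * G (y d) (y c)) = (\<Sum>d\<in>C. if d = c then f (y c) * G (y c) (y c) else 0)"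
      by (intro sum.cong) (use orth c in auto)
    ultimately have "f (y c) * G (y c) (y c) = 0" using c C(2) by simp
    then show False using c pos[OF yE[OF c(1)]] y[OF c(1)] by simp
  qed
  moreover have "y ` C \<subseteq> span B" using yE B by auto
  ultimately have "card (y ` C) \<le> card B" using independent_span_bound[OF B(1)] by blast
  then show False using C(3) card_image[OF inj] by simp
qed

end

section \<open>The operator of a null direction as a form on the screen space\<close>

lemma quot_map_coset:
  assumes "\<And>t. T (w + t *\<^sub>R u) - T w \<in> span {u}"
  shows "quot_map u T (coset u w) = coset u (T w)"
proof -
  have "coset u (T x) = coset u (T w)" if x: "x \<in> coset u w" for x
  proof -
    obtain t where "x = w + t *\<^sub>R u" using x by (auto simp: coset_def span_singleton)
    then show ?thesis using assms by (simp add: coset_eq_iff)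
  qed
  moreover have "w \<in> coset u w" unfolding coset_def using span_zero by force
  ultimately show ?thesis unfolding quot_map_def by blast
qed

lemma lorentzian_metric_basis:
  assumes "lorentzian_metric A g"
  shows "\<exists>B. finite B \<and> independent B \<and> span B = tangent_space A p \<and>
      (\<forall>b\<in>B. \<forall>c\<in>B. b \<noteq> c \<longrightarrow> g p b c = 0) \<and> (\<forall>b\<in>B. g p b b = 1 \<or> g p b b = -1) \<and>
      (\<exists>!b. b \<in> B \<and> g p b b = -1)"
  using assms unfolding lorentzian_metric_def by (elim conjE allE)

context semi_riemannian
begin

lemma form_space_subspace:
  assumes "subspace E" "E \<subseteq> T p" shows "form_space E (g p)"
proof
  obtain B where "finite B" "span B = T p" using tangent_fin by blast
  then show "\<exists>B. finite B \<and> E \<subseteq> span B" using assms(2) by auto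
qed (use assms g_sym in \<open>auto simp: subset_iff simp del: plus_fun_apply\<close>)

lemma Rm_symmetric:
  assumes "w \<in> T p" "u \<in> T p" "v \<in> T p"
  shows "Rm p w u u v = Rm p v u u w"
  using Rm_pair[OF assms(1,2,2,3)] Rm_skew12[OF assms(2,3,1,2)] Rm_skew34[OF assms(3,2,1,2)] by simp

lemma Rm_same12: "u \<in> T p \<Longrightarrow> z \<in> T p \<Longrightarrow> w \<in> T p \<Longrightarrow> Rm p u u z w = 0"
  using Rm_skew12[of u p u z w] by simp

lemma Rm_same34: "x \<in> T p \<Longrightarrow> y \<in> T p \<Longrightarrow> z \<in> T p \<Longrightarrow> Rm p x y z z = 0"
  using Rm_skew34[of x p y z z] by simp

lemma symmetric_form_Rm:
  assumes E: "subspace E" "E \<subseteq> T p" and u: "u \<in> T p"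
  shows "form_space.symmetric_form E (\<lambda>w v. Rm p w u u v)"
proof -
  interpret form_space E "g p" by (rule form_space_subspace[OF E])
  have "x \<in> T p" if "x \<in> E" for x using that assms(2) by blast
  then show ?thesis
    unfolding symmetric_form_def using u by (auto simp: Rm_add1 Rm_scale1 intro: Rm_symmetric simp del: plus_fun_apply)
qed

definition screen :: "'a \<Rightarrow> 'a tvec \<Rightarrow> 'a tvec \<Rightarrow> 'a tvec set" where
  "screen p z x = {w \<in> T p. g p w z = 0 \<and> g p w x = 0}"

lemma subspace_screen: "z \<in> T p \<Longrightarrow> x \<in> T p \<Longrightarrow> subspace (screen p z x)"
  unfolding subspace_def screen_def by (auto simp del: plus_fun_apply)

text \<open>The screen space is a complement of \<open>u = z + x\<close> in its orthogonal space, which turns the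
  operator on the quotient into a symmetric bilinear form.\<close>

lemma null_jacobi_mult_eq:
  assumes z: "z \<in> T p" and x: "x \<in> T p" and zz: "g p z z = -1" and xx: "g p x x = 1" and zx: "g p z x = 0"
  shows "null_jacobi_mult A g D p (z + x) c =
    dim (eigenspace (screen p z x) (g p) (\<lambda>w v. Rm p w (z + x) (z + x) v) c)"
proof -
  define u where "u = z + x"
  let ?W = "screen p z x"
  let ?R = "jacobi A D p u"
  let ?S = "eigenspace ?W (g p) (\<lambda>w v. Rm p w u u v) c"
  have xz: "g p x z = 0" using g_sym[OF x z] zx by simp
  have u [simp]: "u \<in> T p" unfolding u_def using z x by (rule tangent_add)
  have uz: "g p u z = -1" and ux: "g p u x = 1"
    unfolding u_def using z x xx zx zz xz by (simp_all del: plus_fun_apply)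
  have gu: "g p y u = g p y z + g p y x" if "y \<in> T p" for y
    unfolding u_def using that z x by (simp del: plus_fun_apply)
  have uu: "g p u u = 0" using gu[OF u] uz ux by simp
  have W: "subspace ?W" by (rule subspace_screen[OF z x])
  have WT: "w \<in> T p" "g p w z = 0" "g p w x = 0" "g p w u = 0" if "w \<in> ?W" for w
    using that gu by (auto simp: screen_def)
  interpret W: form_space ?W "g p" by (rule form_space_subspace[OF W]) (auto simp: screen_def)
  have S: "subspace ?S"
    by (rule W.subspace_eigenspace[OF symmetric_form_Rm[OF W _ u]]) (auto simp: screen_def)
  have uW: "u \<notin> ?W" using uz WT(2) by fastforce
  have RT: "?R y \<in> T p" if "y \<in> T p" for y using that by (simp add: jacobi_def)
  have gR: "g p (?R y) v = Rm p y u u v" for y v by (simp add: jacobi_def Rm_def)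
  have Ru: "?R (w + t *\<^sub>R u) = ?R w" if w: "w \<in> T p" for w t
  proof (rule g_eqI)
    show "?R (w + t *\<^sub>R u) \<in> T p" by (intro RT tangent_add tangent_scale w u)
    show "?R w \<in> T p" by (rule RT[OF w])
    fix v assume v: "v \<in> T p"
    show "g p (?R (w + t *\<^sub>R u)) v = g p (?R w) v"
      unfolding gR using w v by (subst Rm_add1) (auto simp: Rm_scale1 Rm_same12)
  qed
  have perp: "perp A g p u = {w + t *\<^sub>R u | w t. w \<in> ?W}"
  proof
    show "perp A g p u \<subseteq> {w + t *\<^sub>R u | w t. w \<in> ?W}"
    proof
      fix y assume "y \<in> perp A g p u"
      then have y: "y \<in> T p" "g p y z + g p y x = 0" using gu by (auto simp: perp_def)
      \<comment> \<open>As g(u, z) = -1 and g(u, x) = 1, this multiple of \<open>u\<close> cancels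
        the z-component of \<open>y\<close>, and also the x-component because \<open>y\<close> is
        orthogonal to u = z + x.\<close>
      have "y + g p y z *\<^sub>R u \<in> T p" using y by (intro tangent_add tangent_scale u)
      moreover have "g p (y + g p y z *\<^sub>R u) z = 0"
        using y z uz by (subst g_add_left) auto
      moreover have "g p (y + g p y z *\<^sub>R u) x = 0"
        using y x ux by (subst g_add_left) auto
      ultimately have "y + g p y z *\<^sub>R u \<in> ?W" by (simp add: screen_def)
      moreover have "y = (y + g p y z *\<^sub>R u) + (- g p y z) *\<^sub>R u" by simp
      ultimately show "y \<in> {w + t *\<^sub>R u | w t. w \<in> ?W}" by blast
    qed
    show "{w + t *\<^sub>R u | w t. w \<in> ?W} \<subseteq> perp A g p u"
    proof clarify
      fix w t assume w: "w \<in> ?W"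
      have "g p (w + t *\<^sub>R u) u = 0" using WT[OF w] uu by (subst g_add_left) auto
      moreover have "w + t *\<^sub>R u \<in> T p" using WT[OF w] by (intro tangent_add tangent_scale u)
      ultimately show "w + t *\<^sub>R u \<in> perp A g p u" by (simp add: perp_def)
    qed
  qed
  have "coset u (w + t *\<^sub>R u) = coset u w" for w t
    by (simp add: coset_eq_iff span_scale span_base)
  then have Q: "quot_space u (perp A g p u) = coset u ` ?W"
    unfolding quot_space_def perp by (force simp: image_iff)+
  have iff: "null_jacobi A D p u (coset u w) = quot_map u (\<lambda>x. c *\<^sub>R x) (coset u w) \<longleftrightarrow> w \<in> ?S"
    if w: "w \<in> ?W" for w
  proof -
    \<comment> \<open>\<open>q\<close> represents the class of \<open>?R w\<close> in the screen:
      the added multiple of \<open>u\<close> removes the z-component, and then the x-component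
      vanishes because R(w, u, u, u) = 0.\<close>
    define q where "q = ?R w + g p (?R w) z *\<^sub>R u"
    note wT = WT[OF w]
    have q: "q \<in> T p" unfolding q_def by (intro tangent_add tangent_scale RT wT u)
    have cw: "c *\<^sub>R w \<in> T p" by (intro tangent_scale wT)
    have qv: "g p q v = Rm p w u u v + Rm p w u u z * g p u v" if v: "v \<in> T p" for v
      unfolding q_def using RT[OF wT(1)] v by (subst g_add_left) (auto simp: gR)
    have qz: "g p q z = 0" using qv[OF z] uz by simp
    have "Rm p w u u z + Rm p w u u x = Rm p w u u u"
      using Rm_add4[OF wT(1) u u z x] unfolding u_def[symmetric] by simp
    then have qx: "g p q x = 0" using qv[OF x] ux Rm_same34[OF wT(1) u u] by simp
    have n: "null_jacobi A D p u (coset u w) = coset u (?R w)"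
      unfolding null_jacobi_def by (rule quot_map_coset) (simp add: Ru[OF wT(1)] span_zero)
    have m: "quot_map u (\<lambda>x. c *\<^sub>R x) (coset u w) = coset u (c *\<^sub>R w)"
      by (rule quot_map_coset) (simp add: scaleR_add_right span_scale span_base)
    have "coset u (?R w) = coset u (c *\<^sub>R w) \<longleftrightarrow> q = c *\<^sub>R w"
    proof
      assume "coset u (?R w) = coset u (c *\<^sub>R w)"
      then obtain t where t: "?R w - c *\<^sub>R w = t *\<^sub>R u" by (auto simp: coset_eq_iff span_singleton)
      then have qt: "q = c *\<^sub>R w + (t + g p (?R w) z) *\<^sub>R u"
        unfolding q_def by (simp add: algebra_simps)
      have "g p q z = c * g p w z + (t + g p (?R w) z) * g p u z"
        unfolding qt using wT z by (subst g_add_left) auto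
      then have "t + g p (?R w) z = 0" using qz uz wT by simp
      then show "q = c *\<^sub>R w" using qt by simp
    next
      assume "q = c *\<^sub>R w"
      then have "?R w - c *\<^sub>R w = (- g p (?R w) z) *\<^sub>R u" unfolding q_def by (simp add: algebra_simps)
      then show "coset u (?R w) = coset u (c *\<^sub>R w)" unfolding coset_eq_iff span_singleton by blast
    qed
    also have "\<dots> \<longleftrightarrow> w \<in> ?S"
    proof
      assume "q = c *\<^sub>R w"
      then have "Rm p w u u v = c * g p w v" if "v \<in> ?W" for v
        using qv[OF WT(1)[OF that]] WT[OF that] wT g_sym[of u p v] by simp
      then show "w \<in> ?S" using w by (simp add: eigenspace_def)
    next
      assume S: "w \<in> ?S"
      show "q = c *\<^sub>R w"
      proof (rule g_eqI[OF q cw])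
        fix v assume v: "v \<in> T p"
        \<comment> \<open>The orthogonal projection of \<open>v\<close> to the screen, with the
          opposite sign at \<open>z\<close> because \<open>z\<close> is timelike.\<close>
        define v' where "v' = v + (g p v z *\<^sub>R z - g p v x *\<^sub>R x)"
        have v'T: "v' \<in> T p" unfolding v'_def by (intro tangent_add tangent_diff tangent_scale v z x)
        have gv: "g p y v' = g p y v + (g p v z * g p y z - g p v x * g p y x)" if "y \<in> T p" for y
          unfolding v'_def using that v z x by (simp del: plus_fun_apply minus_apply)
        have "g p v' z = 0" "g p v' x = 0"
          unfolding v'_def using v z x zz xx zx xz by (simp_all del: plus_fun_apply minus_apply)
        then have v': "v' \<in> ?W" using v'T by (simp add: screen_def)
        have "g p q v = g p q v'" using gv[OF q] qz qx by simp
        also have "\<dots> = Rm p w u u v'" using qv[OF v'T] WT[OF v'] g_sym[OF u v'T] by simp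
        also have "\<dots> = c * g p w v'" using S v' by (simp add: eigenspace_def)
        also have "\<dots> = g p (c *\<^sub>R w) v" using gv[OF wT(1)] wT v by simp
        finally show "g p q v = g p (c *\<^sub>R w) v" .
      qed
    qed
    finally show ?thesis unfolding n m .
  qed
  have "{C \<in> quot_space u (perp A g p u). null_jacobi A D p u C = quot_map u (\<lambda>x. c *\<^sub>R x) C} = coset u ` ?S"
  proof -
    have "?S \<subseteq> ?W" by (auto simp: eigenspace_def)
    then show ?thesis unfolding Q using iff by blast
  qed
  moreover obtain B where B: "finite B" "span B = T p" using tangent_fin by blast
  moreover have "?S \<subseteq> span B" using B by (auto simp: eigenspace_def screen_def)
  moreover have "u \<notin> ?S" using uW by (simp add: eigenspace_def)
  ultimately show ?thesis
    unfolding null_jacobi_mult_def u_def[symmetric] using quot_dim_coset_image[OF B(1) _ S] by simp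
qed

text \<open>This is the reversed Cauchy-Schwarz argument in an orthonormal basis with timelike
  member \<open>b0\<close>. Orthogonality to \<open>z\<close> forces \<open>m = f b0 * h b0\<close>,
  while \<open>m\<close> squared is at most \<open>l * k\<close> and \<open>k\<close> is below the
  square of \<open>h b0\<close>; so the square of \<open>f b0\<close> is below
  \<open>l\<close>.\<close>

lemma lorentzian_spacelike:
  assumes L: "lorentzian_metric A g" and z: "z \<in> T p" "g p z z < 0"
    and x: "x \<in> T p" "x \<noteq> 0" "g p x z = 0"
  shows "g p x x > 0"
proof -
  obtain B where B': "finite B \<and> independent B \<and> span B = T p \<and>
      (\<forall>b\<in>B. \<forall>c\<in>B. b \<noteq> c \<longrightarrow> g p b c = 0) \<and> (\<forall>b\<in>B. g p b b = 1 \<or> g p b b = -1) \<and>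
      (\<exists>!b. b \<in> B \<and> g p b b = -1)"
    by (rule exE[OF lorentzian_metric_basis[OF L]])
  then have B: "finite B" "span B = T p" "\<And>b c. b \<in> B \<Longrightarrow> c \<in> B \<Longrightarrow> b \<noteq> c \<Longrightarrow> g p b c = 0"
    by simp_all
  obtain b0 where b0: "b0 \<in> B" "g p b0 b0 = -1" "\<And>b. b \<in> B \<Longrightarrow> b \<noteq> b0 \<Longrightarrow> g p b b = 1"
    using B' by metis
  have BT: "b \<in> T p" if "b \<in> B" for b using that B(2) span_base by blast
  have cT: "t *\<^sub>R b \<in> T p" if "b \<in> B" for t b by (intro tangent_scale BT that)
  have sT: "(\<Sum>b\<in>B. f b *\<^sub>R b) \<in> T p" for f by (intro T_sum cT)
  let ?K = "B - {b0}"
  have gf: "g p (\<Sum>b\<in>B. f b *\<^sub>R b) (\<Sum>b\<in>B. h b *\<^sub>R b) = - f b0 * h b0 + (\<Sum>b\<in>?K. f b * h b)" for f h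
  proof -
    have "g p (\<Sum>b\<in>B. f b *\<^sub>R b) (\<Sum>b\<in>B. h b *\<^sub>R b) = (\<Sum>b\<in>B. g p (f b *\<^sub>R b) (\<Sum>b\<in>B. h b *\<^sub>R b))"
      by (rule g_sum_left[OF sT cT])
    also have "\<dots> = (\<Sum>b\<in>B. f b * h b * g p b b)"
    proof (rule sum.cong[OF refl])
      fix b assume b: "b \<in> B"
      have "g p (f b *\<^sub>R b) (\<Sum>c\<in>B. h c *\<^sub>R c) = f b * g p b (\<Sum>c\<in>B. h c *\<^sub>R c)"
        by (rule g_scale_left[OF sT BT[OF b]])
      also have "g p b (\<Sum>c\<in>B. h c *\<^sub>R c) = (\<Sum>c\<in>B. g p b (h c *\<^sub>R c))"
        by (rule g_sum_right[OF BT[OF b] cT])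
      also have "\<dots> = (\<Sum>c\<in>B. if c = b then h b * g p b b else 0)"
        by (rule sum.cong) (use B(3) b BT in auto)
      finally show "g p (f b *\<^sub>R b) (\<Sum>b\<in>B. h b *\<^sub>R b) = f b * h b * g p b b" using b B(1) by simp
    qed
    also have "\<dots> = f b0 * h b0 * g p b0 b0 + (\<Sum>b\<in>?K. f b * h b * g p b b)"
      by (rule sum.remove[OF B(1) b0(1)])
    also have "(\<Sum>b\<in>?K. f b * h b * g p b b) = (\<Sum>b\<in>?K. f b * h b)"
      by (rule sum.cong) (use b0 in auto)
    finally show ?thesis using b0 by simp
  qed
  obtain f where f: "x = (\<Sum>b\<in>B. f b *\<^sub>R b)" using x(1) B(2) span_finite[OF B(1)] by blast
  obtain h where h: "z = (\<Sum>b\<in>B. h b *\<^sub>R b)" using z(1) B(2) span_finite[OF B(1)] by blast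
  define k l m where "k = (\<Sum>b\<in>?K. (h b)\<^sup>2)" and "l = (\<Sum>b\<in>?K. (f b)\<^sup>2)" and "m = (\<Sum>b\<in>?K. f b * h b)"
  have zz: "k < (h b0)\<^sup>2" using z(2) gf[of h h] unfolding h[symmetric] k_def power2_eq_square by simp
  have xz: "m = f b0 * h b0" using x(3) gf[of f h] unfolding h[symmetric] f[symmetric] m_def by simp
  have xx: "g p x x = l - (f b0)\<^sup>2" using gf[of f f] unfolding f[symmetric] l_def power2_eq_square by simp
  have cs: "m\<^sup>2 \<le> l * k" unfolding m_def l_def k_def by (rule Cauchy_Schwarz_ineq_sum)
  have k0: "k \<ge> 0" and l0: "l \<ge> 0" unfolding k_def l_def by (auto intro: sum_nonneg)
  show ?thesis
  proof (cases "l = 0")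
    \<comment> \<open>A vector without spatial components is a multiple of \<open>b0\<close>;
      orthogonality to \<open>z\<close>, whose \<open>b0\<close>-component is nonzero, leaves only
      0.\<close>
    case True
    then have fK: "\<forall>b\<in>?K. f b = 0" unfolding l_def using B(1) by (subst (asm) sum_nonneg_eq_0_iff) auto
    then have "m = 0" unfolding m_def by (intro sum.neutral) auto
    then have "f b0 = 0" using xz zz k0 by auto
    then have "\<forall>b\<in>B. f b = 0" using fK by blast
    then have "x = 0" unfolding f by (intro sum.neutral) auto
    then show ?thesis using x(2) by simp
  next
    case False
    then have l: "l > 0" using l0 by simp
    have "(f b0)\<^sup>2 * (h b0)\<^sup>2 \<le> l * k" using cs unfolding xz power_mult_distrib .
    also have "\<dots> < l * (h b0)\<^sup>2" using zz l by simp
    finally have "(f b0)\<^sup>2 * (h b0)\<^sup>2 < l * (h b0)\<^sup>2" .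
    moreover have "(h b0)\<^sup>2 > 0" using zz k0 by linarith
    ultimately have "(f b0)\<^sup>2 < l" by (simp only: mult_less_cancel_right_pos)
    then show ?thesis unfolding xx by simp
  qed
qed

end

section \<open>Comparison of the null directions of total space and base\<close>

locale lorentzian_S_submersion = S_submersion +
  assumes lorentz: "lorentzian_metric A g" and eps_time: "\<epsilon> 1 = -1"
begin

declare One_nat_def [simp del]

lemma one_I [simp]: "1 \<in> M.I"
  using M.s_pos by (simp add: M.I_def)

lemma I_eq: "M.I = insert 1 J"
  using M.s_pos by (auto simp: M.I_def J_def)

lemma one_J [simp]: "1 \<notin> J"
  by (simp add: J_def)

definition Sph :: "'a \<Rightarrow> 'a tvec set" where
  "Sph p = {x \<in> M.T p. (\<forall>\<alpha>\<in>M.I. g p x (\<xi> \<alpha> p) = 0) \<and> g p x x = 1}"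

definition E :: "'a \<Rightarrow> 'a tvec \<Rightarrow> 'a tvec set" where
  "E p x = {y \<in> M.T p. (\<forall>\<alpha>\<in>M.I. g p y (\<xi> \<alpha> p) = 0) \<and> g p y x = 0}"

text \<open>A vector x orthogonal to all characteristic vectors equals \<phi> (- \<phi> x) by the
  formula for \<phi>^2, so membership in the image of \<phi> can be tested with g.\<close>

lemma phi_sphere_eq: "phi_sphere A g \<phi> p (\<xi> 1 p) = Sph p"
proof -
  have "x \<in> \<phi> p ` M.T p" if x: "x \<in> M.T p" "\<forall>\<alpha>\<in>M.I. g p x (\<xi> \<alpha> p) = 0" for x
  proof -
    have "(\<Sum>\<alpha>\<in>M.I. \<eta> \<alpha> p x *\<^sub>R \<xi> \<alpha> p) = 0"
      by (rule sum.neutral) (use x in \<open>auto simp: M.eta_eq\<close>)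
    then have "x = \<phi> p (- \<phi> p x)" using M.phi_phi[OF x(1)] x(1) by simp
    then show ?thesis using x(1) by (metis M.phi_T imageI tangent_neg)
  qed
  then show ?thesis
    unfolding phi_sphere_def unit_sphere_def perp_def Sph_def by auto
qed

lemma etat_0: "\<forall>\<alpha>\<in>M.I. g p y (\<xi> \<alpha> p) = 0 \<Longrightarrow> M.etat p y = 0"
  unfolding M.etat_def by (rule sum.neutral) simp

lemma g_phi_phi_0:
  assumes "x \<in> M.T p" "y \<in> M.T p" "\<forall>\<alpha>\<in>M.I. g p x (\<xi> \<alpha> p) = 0"
  shows "g p (\<phi> p y) (\<phi> p x) = g p y x"
proof -
  have "(\<Sum>\<alpha>\<in>M.I. \<epsilon> \<alpha> * \<eta> \<alpha> p y * \<eta> \<alpha> p x) = 0"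
    by (rule sum.neutral) (use assms in \<open>auto simp: M.eta_eq\<close>)
  then show ?thesis using M.g_phi_phi[OF assms(2,1)] by simp
qed

lemma phi_Sph:
  assumes x: "x \<in> Sph p"
  shows "\<phi> p x \<in> E p x" "g p (\<phi> p x) (\<phi> p x) = 1"
proof -
  have xT: "x \<in> M.T p" using x by (simp add: Sph_def)
  have "g p (\<phi> p x) x = - g p (\<phi> p x) x"
    using M.phi_skew[OF xT xT] M.g_sym[OF xT M.phi_T[OF xT]] by simp
  then show "\<phi> p x \<in> E p x" using xT by (simp add: E_def)
  show "g p (\<phi> p x) (\<phi> p x) = 1" using g_phi_phi_0[OF xT xT] x by (simp add: Sph_def)
qed

lemma E_H: "y \<in> E p x \<Longrightarrow> y \<in> H p"
  by (auto simp: E_def H_def)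

lemma xi1_H: "\<xi> 1 p \<in> H p"
  using M.xi_T[OF one_I] M.g_xi[OF J_I M.xi_T[OF one_I]] by (auto simp: H_def)

lemma xi1_xi1: "g p (\<xi> 1 p) (\<xi> 1 p) = -1"
  using M.eps[OF one_I] eps_time by simp

lemma subspace_E: "x \<in> M.T p \<Longrightarrow> subspace (E p x)"
  unfolding subspace_def E_def by (auto simp del: plus_fun_apply)

lemma E_T: "E p x \<subseteq> M.T p"
  by (auto simp: E_def)

lemma form_space_E: "x \<in> M.T p \<Longrightarrow> form_space (E p x) (g p)"
  by (rule M.form_space_subspace[OF subspace_E E_T])

definition R_form :: "'a \<Rightarrow> 'a tvec \<Rightarrow> 'a tvec \<Rightarrow> 'a tvec \<Rightarrow> real" where
  "R_form p x w v = M.Rm p w (\<xi> 1 p + x) (\<xi> 1 p + x) v"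

definition Fv :: "'a \<Rightarrow> 'a tvec set" where
  "Fv p = span ((\<lambda>\<alpha>. \<xi> \<alpha> p) ` J)"

lemma Fv_T: "f \<in> Fv p \<Longrightarrow> f \<in> M.T p"
proof -
  have "(\<lambda>\<alpha>. \<xi> \<alpha> p) ` J \<subseteq> M.T p" by auto
  then show "f \<in> Fv p \<Longrightarrow> f \<in> M.T p"
    unfolding Fv_def using span_minimal[OF _ subspace_tangent_space] by blast
qed

lemma d\<tau>_Fv: "f \<in> Fv p \<Longrightarrow> d\<tau> f = 0"
  unfolding Fv_def
proof (induction rule: span_induct_alt)
  case base
  show ?case by (rule d\<tau>_0)
next
  case (step c a f)
  then show ?case by (auto simp only: d\<tau>_add d\<tau>_scale d\<tau>_xi scaleR_zero_right add_0_left)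
qed

lemma g_Fv:
  assumes f: "f \<in> Fv p" and y: "y \<in> H p"
  shows "g p y f = 0" "g p f y = 0"
proof -
  have "g p f y = g' (\<tau> p) 0 (d\<tau> y)" using g_hor_right[OF Fv_T[OF f] y] d\<tau>_Fv[OF f] by simp
  also have "\<dots> = 0" by (rule B.g_0_left) (intro d\<tau>_T H_T y)
  finally show "g p f y = 0" .
  then show "g p y f = 0" using M.g_sym[OF H_T[OF y] Fv_T[OF f]] by simp
qed

lemma xi_Fv: "\<alpha> \<in> J \<Longrightarrow> \<xi> \<alpha> p \<in> Fv p"
  unfolding Fv_def by (rule span_base) auto

lemma subspace_Fv: "subspace (Fv p)"
  unfolding Fv_def by (rule subspace_span)

lemma E_iff: "y \<in> E p x \<longleftrightarrow> y \<in> H p \<and> g p y (\<xi> 1 p) = 0 \<and> g p y x = 0"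
  by (auto simp: E_def H_def I_eq)

text \<open>Pairing the eigenvector equation with the unit vector \<phi> x identifies its
  eigenvalue.\<close>

lemma L_eigen:
  assumes "eigenvector_on (perp A g p x) (jacobi A D p x) (\<phi> p x)" and x: "x \<in> Sph p" and v: "v \<in> M.T p"
  shows "M.Rm p (\<phi> p x) x x v = M.Rm p (\<phi> p x) x x (\<phi> p x) * g p (\<phi> p x) v"
proof -
  have xT: "x \<in> M.T p" using x by (simp add: Sph_def)
  obtain k where k: "jacobi A D p x (\<phi> p x) = k *\<^sub>R \<phi> p x" using assms(1) unfolding eigenvector_on_def by blast
  have "M.Rm p (\<phi> p x) x x w = k * g p (\<phi> p x) w" if "w \<in> M.T p" for w
    unfolding M.Rm_def using k that xT by (simp add: jacobi_def)
  then show ?thesis using v xT phi_Sph(2)[OF x] by simp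
qed

text \<open>If \<open>\<phi> x\<close> is an eigenvector of \<open>R\<^sub>x\<close>, then \<open>L p x\<close> is its eigenvalue, and \<open>L p x + 1\<close> is the eigenvalue of
  \<open>\<phi> x\<close> for the null direction \<open>\<xi>\<^sub>1 + x\<close>.\<close>

definition L :: "'a \<Rightarrow> 'a tvec \<Rightarrow> real" where
  "L p x = M.Rm p (\<phi> p x) x x (\<phi> p x)"

text \<open>The eigenvectors orthogonal to \<phi> x are common to the forms of the total space and
  of the base, because the two forms differ by a multiple of g(., \<phi> x) g(., \<phi> x).\<close>

definition N :: "'a \<Rightarrow> 'a tvec \<Rightarrow> real \<Rightarrow> 'a tvec set" where
  "N p x c = {y \<in> E p x. g p y (\<phi> p x) = 0 \<and> (\<forall>v\<in>E p x. R_form p x y v = c * g p y v)}"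

text \<open>By O'Neill's formula this is the form of the null direction \<open>d\<tau>(\<xi>\<^sub>1 + x)\<close> on the base; it differs from
  \<open>R_form\<close> only on the line spanned by \<open>\<phi> x\<close>.\<close>

definition R_form' :: "'a \<Rightarrow> 'a tvec \<Rightarrow> 'a tvec \<Rightarrow> 'a tvec \<Rightarrow> real" where
  "R_form' p x y v = R_form p x y v + 3 * real (card J) * (g p y (\<phi> p x) * g p v (\<phi> p x))"

section \<open>The two forms for a fixed unit vector x\<close>

context
  fixes p x assumes x: "x \<in> Sph p"
begin

private lemma xT [simp]: "x \<in> M.T p" and x_xi: "\<And>\<alpha>. \<alpha> \<in> M.I \<Longrightarrow> g p x (\<xi> \<alpha> p) = 0" and xx: "g p x x = 1"
  using x by (auto simp: Sph_def)

private abbreviation "u \<equiv> \<xi> 1 p + x"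
private abbreviation "W \<equiv> M.screen p (\<xi> 1 p) x"

private lemma uT [simp]: "u \<in> M.T p"
  by (intro tangent_add xT M.xi_T one_I)

private lemma phi_u: "\<phi> p u = \<phi> p x"
  using M.phi_add[OF M.xi_T[OF one_I] xT] M.phi_xi[OF one_I, of p] by simp

private lemma etat_u: "M.etat p u = -1"
  using M.etat_add[OF M.xi_T[OF one_I] xT] M.etat_xi[OF one_I, of p] etat_0[of p x] x_xi eps_time by simp

text \<open>In the formula for R(w, u) on a characteristic vector the first product contains
  g(\<phi> w, \<phi> x) = g(w, x) = 0, while g(\<phi> u, \<phi> u) = 1; skewness in the last two
  slots absorbs the sign.\<close>

private lemma R_form_xi:
  assumes w: "w \<in> W" and \<alpha>: "\<alpha> \<in> J"
  shows "R_form p x w (\<xi> \<alpha> p) = M.etat p w"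
proof -
  have wT: "w \<in> M.T p" "g p w x = 0" using w by (auto simp: M.screen_def)
  have "g p (\<phi> p w) (\<phi> p u) = 0" unfolding phi_u using g_phi_phi_0[OF xT wT(1)] x_xi wT by simp
  moreover have "g p (\<phi> p u) (\<phi> p u) = 1" unfolding phi_u by (rule phi_Sph(2)[OF x])
  ultimately have "M.Rm p w u (\<xi> \<alpha> p) u = - M.etat p w"
    using M.Rm_xi[OF wT(1) uT J_I[OF \<alpha>] uT] \<alpha> by simp
  then show ?thesis
    using M.Rm_skew34[OF wT(1) uT uT M.xi_T[OF J_I[OF \<alpha>]]] by (simp add: R_form_def)
qed

private lemma W_T: "w \<in> W \<Longrightarrow> w \<in> M.T p"
  by (simp add: M.screen_def)

private lemma W_subspace: "subspace W"
  by (rule M.subspace_screen) auto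

private lemma E_W: "y \<in> E p x \<Longrightarrow> y \<in> W"
  by (simp add: E_def M.screen_def)

private lemma xi1_x: "x \<in> H p"
  using x_xi by (simp add: H_def)

private lemma Fv_W: "f \<in> Fv p \<Longrightarrow> f \<in> W"
  using Fv_T g_Fv(2)[OF _ xi1_H] g_Fv(2)[OF _ xi1_x] by (simp add: M.screen_def)

private lemma R_form_add1: "w \<in> M.T p \<Longrightarrow> w' \<in> M.T p \<Longrightarrow> v \<in> M.T p \<Longrightarrow>
    R_form p x (w + w') v = R_form p x w v + R_form p x w' v"
  and R_form_scale1: "w \<in> M.T p \<Longrightarrow> v \<in> M.T p \<Longrightarrow> R_form p x (t *\<^sub>R w) v = t * R_form p x w v"
  and R_form_add2: "w \<in> M.T p \<Longrightarrow> w' \<in> M.T p \<Longrightarrow> v \<in> M.T p \<Longrightarrow>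
    R_form p x v (w + w') = R_form p x v w + R_form p x v w'"
  and R_form_scale2: "w \<in> M.T p \<Longrightarrow> v \<in> M.T p \<Longrightarrow> R_form p x v (t *\<^sub>R w) = t * R_form p x v w"
  and R_form_sym: "w \<in> M.T p \<Longrightarrow> v \<in> M.T p \<Longrightarrow> R_form p x v w = R_form p x w v"
  unfolding R_form_def
  by (rule M.Rm_add1 M.Rm_scale1 M.Rm_add4 M.Rm_scale4 M.Rm_symmetric; simp only: uT)+

text \<open>\<open>R_form_xi\<close> is extended linearly, \<open>etat\<close> being 1 on each
  vertical characteristic vector. On the vertical space the form is thus independent of x.\<close>

private lemma R_form_Fv:
  assumes w: "w \<in> W" and f: "f \<in> Fv p"
  shows "R_form p x w f = M.etat p w * M.etat p f"
proof -
  have "f \<in> M.T p \<and> R_form p x w f = M.etat p w * M.etat p f"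
    using f unfolding Fv_def
  proof (induction rule: span_induct_alt)
    case base
    have "R_form p x w 0 = 0" using R_form_scale2[of 0 w 0] W_T[OF w] tangent_0 by simp
    moreover have "M.etat p 0 = 0" using M.etat_scale[of 0 p 0] tangent_0 by simp
    ultimately show ?case by (simp only: tangent_0 mult_zero_right simp_thms)
  next
    case (step c a f)
    then obtain \<alpha> where \<alpha>: "\<alpha> \<in> J" "a = \<xi> \<alpha> p" by auto
    have aT: "a \<in> M.T p" using \<alpha> by simp
    have caT: "c *\<^sub>R a \<in> M.T p" by (rule tangent_scale[OF aT])
    have fT: "f \<in> M.T p" using step by simp
    have 1: "R_form p x w (c *\<^sub>R a + f) = c * M.etat p w + M.etat p w * M.etat p f"
      using R_form_add2[OF caT fT W_T[OF w]] R_form_scale2[OF aT W_T[OF w]] R_form_xi[OF w \<alpha>(1)] \<alpha> step by simp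
    have 2: "M.etat p (c *\<^sub>R a + f) = c + M.etat p f"
      using M.etat_add[OF caT fT] M.etat_scale[OF aT] M.etat_xi[OF J_I[OF \<alpha>(1)], of p] \<alpha> by simp
    have "c *\<^sub>R a + f \<in> M.T p" by (rule tangent_add[OF caT fT])
    then show ?case unfolding 1 2 by (simp only: distrib_left mult.commute[of c] simp_thms)
  qed
  then show ?thesis by simp
qed

private lemma etat_E: "y \<in> E p x \<Longrightarrow> M.etat p y = 0"
  by (rule etat_0) (simp add: E_def)

private lemma W_decomp:
  assumes w: "w \<in> W"
  obtains y f where "w = y + f" "y \<in> E p x" "f \<in> Fv p"
proof
  let ?f = "\<Sum>\<alpha>\<in>J. g p w (\<xi> \<alpha> p) *\<^sub>R \<xi> \<alpha> p"
  have wT: "w \<in> M.T p" by (rule W_T[OF w])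
  show f: "?f \<in> Fv p" by (intro subspace_sum[OF subspace_Fv] subspace_scale[OF subspace_Fv] xi_Fv)
  show "w = hor p w + ?f" by (simp add: hor_def)
  have "hor p w = w - ?f" by (simp add: hor_def)
  then have "hor p w \<in> W" using subspace_diff[OF W_subspace w Fv_W[OF f]] by simp
  then show "hor p w \<in> E p x" using hor_H[OF wT] by (simp add: E_iff M.screen_def)
qed

text \<open>The form is block diagonal, since mixed terms are products of values of
  \<open>etat\<close>, which vanishes on \<open>E p x\<close>. Testing with y' + 0 and with 0 + f'
  separates the two eigenvector conditions.\<close>

private lemma eigenspace_W:
  "eigenspace W (g p) (R_form p x) c =
    {y + f | y f. y \<in> eigenspace (E p x) (g p) (R_form p x) c \<and>
      f \<in> eigenspace (Fv p) (g p) (\<lambda>f f'. M.etat p f * M.etat p f') c}" (is "_ = ?S")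
proof -
  have expand: "R_form p x (y + f) (y' + f') = R_form p x y y' + M.etat p f * M.etat p f'
      \<and> g p (y + f) (y' + f') = g p y y' + g p f f'"
    if y: "y \<in> E p x" "y' \<in> E p x" and f: "f \<in> Fv p" "f' \<in> Fv p" for y y' f f'
  proof -
    note T = E_T[THEN subsetD, OF y(1)] E_T[THEN subsetD, OF y(2)] Fv_T[OF f(1)] Fv_T[OF f(2)]
    have "R_form p x (y + f) (y' + f') = R_form p x y y' + R_form p x y f' + (R_form p x f y' + R_form p x f f')"
      using R_form_add1[OF T(1,3) tangent_add[OF T(2,4)]] R_form_add2[OF T(2,4) T(1)] R_form_add2[OF T(2,4) T(3)]
      by simp
    moreover have "R_form p x y f' = 0" using R_form_Fv[OF E_W[OF y(1)] f(2)] etat_E[OF y(1)] by simp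
    moreover have "R_form p x f y' = 0"
      using R_form_sym[OF T(2,3)] R_form_Fv[OF E_W[OF y(2)] f(1)] etat_E[OF y(2)] by simp
    moreover have "R_form p x f f' = M.etat p f * M.etat p f'" by (rule R_form_Fv[OF Fv_W[OF f(1)] f(2)])
    moreover have "g p (y + f) (y' + f') = g p y y' + g p y f' + (g p f y' + g p f f')"
      using T by (simp del: plus_fun_apply)
    ultimately show ?thesis
      using g_Fv(1)[OF f(2) E_H[OF y(1)]] g_Fv(2)[OF f(1) E_H[OF y(2)]] by simp
  qed
  have E0: "0 \<in> E p x" by (rule subspace_0[OF subspace_E[OF xT]])
  have F0: "0 \<in> Fv p" by (rule subspace_0[OF subspace_Fv])
  have R0: "R_form p x y 0 = 0" "g p y 0 = 0" if "y \<in> M.T p" for y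
    using R_form_scale2[OF tangent_0 that, of 0] M.g_0_right[OF that] by simp_all
  have e0: "M.etat p 0 = 0" using M.etat_scale[of 0 p 0] tangent_0 by simp
  show ?thesis
  proof (intro set_eqI iffI)
    fix w assume w: "w \<in> eigenspace W (g p) (R_form p x) c"
    then have "w \<in> W" by (simp add: eigenspace_def)
    then obtain y f where yf: "w = y + f" "y \<in> E p x" "f \<in> Fv p" by (rule W_decomp)
    have *: "R_form p x w v = c * g p w v" if "v \<in> W" for v using w that by (simp add: eigenspace_def)
    have "R_form p x y y' = c * g p y y'" if y': "y' \<in> E p x" for y'
      using expand[OF yf(2) y' yf(3) F0] *[OF E_W[OF y']] R0(2)[OF Fv_T[OF yf(3)]]
      unfolding yf(1) e0 add_0_right mult_zero_right by (metis add_0_right)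
    moreover have "M.etat p f * M.etat p f' = c * g p f f'" if f': "f' \<in> Fv p" for f'
      using expand[OF yf(2) E0 yf(3) f'] *[OF Fv_W[OF f']] R0[OF E_T[THEN subsetD, OF yf(2)]]
      unfolding yf(1) add_0_left by (metis add_0_left)
    ultimately show "w \<in> ?S" using yf by (auto simp: eigenspace_def)
  next
    fix w assume "w \<in> ?S"
    then obtain y f where yf: "w = y + f" "y \<in> eigenspace (E p x) (g p) (R_form p x) c"
      "f \<in> eigenspace (Fv p) (g p) (\<lambda>f f'. M.etat p f * M.etat p f') c" by blast
    have yE: "y \<in> E p x" and fF: "f \<in> Fv p" using yf by (auto simp: eigenspace_def)
    have "R_form p x w v = c * g p w v" if vW: "v \<in> W" for v
    proof -
      obtain y' f' where v: "v = y' + f'" "y' \<in> E p x" "f' \<in> Fv p" using vW by (rule W_decomp)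
      have "R_form p x y y' = c * g p y y'" using yf(2) v(2) by (simp add: eigenspace_def)
      moreover have "M.etat p f * M.etat p f' = c * g p f f'" using yf(3) v(3) by (simp add: eigenspace_def)
      ultimately show ?thesis
        using expand[OF yE v(2) fF v(3)] unfolding yf(1) v(1) by (simp add: distrib_left)
    qed
    moreover have "w \<in> W" unfolding yf(1) by (intro subspace_add[OF W_subspace] E_W Fv_W yE fF)
    ultimately show "w \<in> eigenspace W (g p) (R_form p x) c" by (simp add: eigenspace_def)
  qed
qed

lemma symmetric_R_form: "form_space.symmetric_form (E p x) (R_form p x)"
  using M.symmetric_form_Rm[OF subspace_E[OF xT] E_T uT] by (simp only: R_form_def[abs_def])

lemma symmetric_R_form': "form_space.symmetric_form (E p x) (R_form' p x)"
proof -
  interpret F: form_space "E p x" "g p" by (rule form_space_E[OF xT])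
  have T: "y \<in> M.T p" if "y \<in> E p x" for y using that E_T by blast
  have pT: "\<phi> p x \<in> M.T p" by simp
  show ?thesis
    using symmetric_R_form unfolding F.symmetric_form_def R_form'_def
    by (simp add: T pT algebra_simps del: plus_fun_apply)
qed

text \<open>The second dimension is free of x, so only the first one matters when null directions
  are compared.\<close>

lemma mult_M:
  "null_jacobi_mult A g D p (\<xi> 1 p + x) c =
    dim (eigenspace (E p x) (g p) (R_form p x) c) +
    dim (eigenspace (Fv p) (g p) (\<lambda>f f'. M.etat p f * M.etat p f') c)"
proof -
  interpret FE: form_space "E p x" "g p" by (rule form_space_E[OF xT])
  interpret FF: form_space "Fv p" "g p"
    by (rule M.form_space_subspace[OF subspace_Fv]) (use Fv_T in blast)
  have zx: "g p (\<xi> 1 p) x = 0" using M.g_sym[OF xT M.xi_T[OF one_I]] x_xi[OF one_I] by simp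
  have sF: "FF.symmetric_form (\<lambda>f f'. M.etat p f * M.etat p f')"
    unfolding FF.symmetric_form_def using Fv_T by (simp add: algebra_simps del: plus_fun_apply)
  obtain B where B: "finite B" "span B = M.T p" using M.tangent_fin by blast
  have "null_jacobi_mult A g D p u c = dim (eigenspace W (g p) (\<lambda>w v. M.Rm p w u u v) c)"
    by (rule M.null_jacobi_mult_eq[OF M.xi_T[OF one_I] xT xi1_xi1 xx zx])
  also have "(\<lambda>w v. M.Rm p w u u v) = R_form p x" by (simp add: R_form_def fun_eq_iff)
  also have "dim (eigenspace W (g p) (R_form p x) c) = dim (eigenspace (E p x) (g p) (R_form p x) c) +
    dim (eigenspace (Fv p) (g p) (\<lambda>f f'. M.etat p f * M.etat p f') c)"
    unfolding eigenspace_W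
  proof (rule dim_direct_sum[OF B(1)])
    show "eigenspace (E p x) (g p) (R_form p x) c \<subseteq> span B"
      unfolding B(2) eigenspace_def using E_T by blast
    show "eigenspace (Fv p) (g p) (\<lambda>f f'. M.etat p f * M.etat p f') c \<subseteq> span B"
      unfolding B(2) eigenspace_def using Fv_T by blast
    show "subspace (eigenspace (E p x) (g p) (R_form p x) c)"
      by (rule FE.subspace_eigenspace[OF symmetric_R_form])
    show "subspace (eigenspace (Fv p) (g p) (\<lambda>f f'. M.etat p f * M.etat p f') c)"
      by (rule FF.subspace_eigenspace[OF sF])
    have "y = 0" if "y \<in> E p x" "y \<in> Fv p" for y
      by (rule d\<tau>_inj[OF E_H[OF that(1)] H_0]) (simp only: d\<tau>_Fv[OF that(2)] d\<tau>_0)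
    then show "eigenspace (E p x) (g p) (R_form p x) c \<inter>
        eigenspace (Fv p) (g p) (\<lambda>f f'. M.etat p f * M.etat p f') c \<subseteq> {0}"
      unfolding eigenspace_def by blast
  qed
  finally show ?thesis .
qed

text \<open>The differential maps \<open>E p x\<close> isometrically onto the screen of the base,
  and O'Neill's formula identifies the curvature form there with \<open>R_form'\<close>.\<close>

lemma mult_B:
  "null_jacobi_mult A' g' D' (\<tau> p) (d\<tau> (\<xi> 1 p) + d\<tau> x) c = dim (eigenspace (E p x) (g p) (R_form' p x) c)"
proof -
  interpret FE: form_space "E p x" "g p" by (rule form_space_E[OF xT])
  have uH: "u \<in> H p" by (intro H_add xi1_H xi1_x)
  have du: "d\<tau> (\<xi> 1 p) + d\<tau> x = d\<tau> u" by (rule d\<tau>_add[symmetric])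
  have zx: "g p (\<xi> 1 p) x = 0" using M.g_sym[OF xT M.xi_T[OF one_I]] x_xi[OF one_I] by simp
  have sc: "B.screen (\<tau> p) (d\<tau> (\<xi> 1 p)) (d\<tau> x) = d\<tau> ` E p x"
  proof (intro set_eqI iffI)
    fix w assume w: "w \<in> B.screen (\<tau> p) (d\<tau> (\<xi> 1 p)) (d\<tau> x)"
    then have "w \<in> d\<tau> ` H p" using d\<tau>_bij[of p] by (auto simp: B.screen_def bij_betw_def)
    then obtain y where y: "y \<in> H p" "w = d\<tau> y" by blast
    then have "y \<in> E p x"
      using w d\<tau>_isometry[OF y(1) xi1_H] d\<tau>_isometry[OF y(1) xi1_x] by (simp add: B.screen_def E_iff)
    then show "w \<in> d\<tau> ` E p x" using y by blast
  next
    fix w assume "w \<in> d\<tau> ` E p x"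
    then obtain y where y: "y \<in> E p x" "w = d\<tau> y" by blast
    then show "w \<in> B.screen (\<tau> p) (d\<tau> (\<xi> 1 p)) (d\<tau> x)"
      using d\<tau>_isometry[OF E_H[OF y(1)] xi1_H] d\<tau>_isometry[OF E_H[OF y(1)] xi1_x]
        d\<tau>_T[OF H_T[OF E_H[OF y(1)]]]
      by (simp add: B.screen_def E_iff)
  qed
  have Rm': "B.Rm (\<tau> p) (d\<tau> y) (d\<tau> u) (d\<tau> u) (d\<tau> v) = R_form' p x y v"
    if y: "y \<in> E p x" and v: "v \<in> E p x" for y v
  proof -
    note yT = H_T[OF E_H[OF y]] and vT = H_T[OF E_H[OF v]]
    \<comment> \<open>In O'Neill's correction the term with g(\<phi> u, u) vanishes; the other two
      carry the same product with weights 1 and 2, whence the 3 in \<open>R_form'\<close>.\<close>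
    have "g p (\<phi> p u) u = - g p (\<phi> p u) u"
      using M.phi_skew[OF uT uT] M.g_sym[OF uT M.phi_T[OF uT]] by simp
    then have 1: "g p (\<phi> p u) u = 0" by simp
    have 2: "g p (\<phi> p y) u = - g p y (\<phi> p x)" using M.phi_skew[OF yT uT] unfolding phi_u .
    have 3: "g p (\<phi> p u) v = g p v (\<phi> p x)" unfolding phi_u by (rule M.g_sym) (use vT in auto)
    show ?thesis
      using Rm_oneill[OF E_H[OF y] uH uH E_H[OF v]] unfolding 1 2 3 R_form'_def R_form_def
      by (simp add: algebra_simps)
  qed
  have eq: "eigenspace (d\<tau> ` E p x) (g' (\<tau> p)) (\<lambda>w v. B.Rm (\<tau> p) w (d\<tau> u) (d\<tau> u) v) c =
      d\<tau> ` eigenspace (E p x) (g p) (R_form' p x) c"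
    using Rm' d\<tau>_isometry[OF E_H E_H] unfolding eigenspace_def by auto
  obtain B where B: "finite B" "span B = M.T p" using M.tangent_fin by blast
  have "null_jacobi_mult A' g' D' (\<tau> p) (d\<tau> (\<xi> 1 p) + d\<tau> x) c =
      dim (eigenspace (B.screen (\<tau> p) (d\<tau> (\<xi> 1 p)) (d\<tau> x)) (g' (\<tau> p))
        (\<lambda>w v. B.Rm (\<tau> p) w (d\<tau> (\<xi> 1 p) + d\<tau> x) (d\<tau> (\<xi> 1 p) + d\<tau> x) v) c)"
    by (rule B.null_jacobi_mult_eq)
      (use d\<tau>_isometry[OF xi1_H xi1_H] d\<tau>_isometry[OF xi1_x xi1_x] d\<tau>_isometry[OF xi1_H xi1_x]
        xi1_xi1 xx zx xi1_H xi1_x in \<open>auto intro!: d\<tau>_T H_T\<close>)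
  also have "\<dots> = dim (d\<tau> ` eigenspace (E p x) (g p) (R_form' p x) c)"
    unfolding du sc eq ..
  also have "\<dots> = dim (eigenspace (E p x) (g p) (R_form' p x) c)"
  proof (rule dim_linear_image[OF _ _ _ B(1)])
    show "linear d\<tau>" by (rule linearI) (rule d\<tau>_add, rule d\<tau>_scale)
    show "subspace (eigenspace (E p x) (g p) (R_form' p x) c)"
      by (rule FE.subspace_eigenspace[OF symmetric_R_form'])
    show "inj_on d\<tau> (eigenspace (E p x) (g p) (R_form' p x) c)"
      by (rule inj_onI, rule d\<tau>_inj[of _ p]) (auto simp: eigenspace_def E_H)
    show "eigenspace (E p x) (g p) (R_form' p x) c \<subseteq> span B"
      unfolding B(2) eigenspace_def using E_T by blast
  qed
  finally show ?thesis .
qed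

text \<open>Of the four terms in the expansion of u = \<xi>_1 + x the mixed ones vanish, because
  \<open>etat\<close> is 0 at x, v and \<phi> x. The term with \<xi>_1 twice gives the summand 1, as
  the sign of \<xi>_1 and the value of \<open>etat\<close> there are both -1.\<close>

lemma R_form_phi:
  assumes eig: "eigenvector_on (perp A g p x) (jacobi A D p x) (\<phi> p x)" and v: "v \<in> E p x"
  shows "R_form p x (\<phi> p x) v = (L p x + 1) * g p (\<phi> p x) v"
proof -
  have vT: "v \<in> M.T p" and v_xi: "\<forall>\<alpha>\<in>M.I. g p v (\<xi> \<alpha> p) = 0" using v by (auto simp: E_def)
  have pT: "\<phi> p x \<in> M.T p" and xi: "\<xi> 1 p \<in> M.T p" by auto
  have e: "M.etat p x = 0" "M.etat p v = 0" "M.etat p (\<phi> p x) = 0" "M.etat p (\<xi> 1 p) = -1"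
    using etat_0[of p x] etat_0[of p v] x_xi v_xi M.etat_phi[OF xT] M.etat_xi[OF one_I, of p] eps_time by auto
  have "M.Rm p (\<phi> p x) x (\<xi> 1 p) v = 0"
    unfolding M.Rm_xi[OF pT xT one_I vT] by (simp add: e)
  moreover have "M.Rm p (\<phi> p x) (\<xi> 1 p) (\<xi> 1 p) v = g p (\<phi> p x) v"
    unfolding M.Rm_xi[OF pT xi one_I vT] using g_phi_phi_0[OF vT pT v_xi] by (simp add: e eps_time)
  moreover have "M.Rm p (\<phi> p x) (\<xi> 1 p) x v = 0"
  proof -
    \<comment> \<open>The known formula has the characteristic vector in the third slot; pair
      symmetry and skewness bring it there.\<close>
    have "M.Rm p (\<phi> p x) (\<xi> 1 p) x v = - M.Rm p x v (\<xi> 1 p) (\<phi> p x)"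
      using M.Rm_pair[OF pT xi xT vT] M.Rm_skew34[OF xT vT pT xi] by simp
    also have "M.Rm p x v (\<xi> 1 p) (\<phi> p x) = 0" unfolding M.Rm_xi[OF xT vT one_I pT] by (simp add: e)
    finally show ?thesis by simp
  qed
  moreover have "M.Rm p (\<phi> p x) x x v = L p x * g p (\<phi> p x) v"
    unfolding L_def by (rule L_eigen[OF eig x vT])
  moreover have "R_form p x (\<phi> p x) v =
      (M.Rm p (\<phi> p x) (\<xi> 1 p) (\<xi> 1 p) v + M.Rm p (\<phi> p x) (\<xi> 1 p) x v)
      + (M.Rm p (\<phi> p x) x (\<xi> 1 p) v + M.Rm p (\<phi> p x) x x v)"
    unfolding R_form_def
    using M.Rm_add2[OF pT xi uT vT xT] M.Rm_add3[OF pT xi xi vT xT] M.Rm_add3[OF pT xT xi vT xT]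
    by simp
  ultimately show ?thesis by (simp add: algebra_simps)
qed

lemma dim_eigenspace_R_form:
  assumes eig: "eigenvector_on (perp A g p x) (jacobi A D p x) (\<phi> p x)"
  shows "dim (eigenspace (E p x) (g p) (R_form p x) c) = dim (N p x c) + (if c = L p x + 1 then 1 else 0)"
    and "dim (eigenspace (E p x) (g p) (R_form' p x) c) =
      dim (N p x c) + (if c = L p x + 1 + 3 * real (card J) then 1 else 0)"
proof -
  interpret FE: form_space "E p x" "g p" by (rule form_space_E[OF xT])
  note v0 = phi_Sph[OF x]
  show "dim (eigenspace (E p x) (g p) (R_form p x) c) = dim (N p x c) + (if c = L p x + 1 then 1 else 0)"
    unfolding N_def by (rule FE.eigenspace_split[OF symmetric_R_form v0 R_form_phi[OF eig]])
  have "R_form' p x (\<phi> p x) v = (L p x + 1 + 3 * real (card J)) * g p (\<phi> p x) v" if v: "v \<in> E p x" for v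
    using R_form_phi[OF eig v] v0(2) M.g_sym[of v p "\<phi> p x"] E_T v
    by (auto simp: R_form'_def algebra_simps)
  note split = FE.eigenspace_split[OF symmetric_R_form' v0 this]
  have "{y \<in> E p x. g p y (\<phi> p x) = 0 \<and> (\<forall>v\<in>E p x. R_form' p x y v = c * g p y v)} = N p x c"
    unfolding N_def R_form'_def by auto
  then show "dim (eigenspace (E p x) (g p) (R_form' p x) c) =
      dim (N p x c) + (if c = L p x + 1 + 3 * real (card J) then 1 else 0)"
    using split[of c] by simp
qed

lemma finite_spectrum:
  "finite {c. dim (eigenspace (E p x) (g p) (R_form p x) c) > 0}"
  "finite {c. dim (eigenspace (E p x) (g p) (R_form' p x) c) > 0}"
proof -
  interpret FE: form_space "E p x" "g p" by (rule form_space_E[OF xT])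
  have "g p y y > 0" if "y \<in> E p x" "y \<noteq> 0" for y
    by (rule M.lorentzian_spacelike[OF lorentz M.xi_T[OF one_I] _ _ that(2)])
      (use that xi1_xi1 in \<open>auto simp: E_def\<close>)
  then show "finite {c. dim (eigenspace (E p x) (g p) (R_form p x) c) > 0}"
    "finite {c. dim (eigenspace (E p x) (g p) (R_form' p x) c) > 0}"
    using FE.finite_eigenvalues symmetric_R_form symmetric_R_form' by blast+
qed

end

end

section \<open>Constancy of the eigenvalue of \<phi> x and the equivalence\<close>

context lorentzian_S_submersion
begin

text \<open>By multilinearity of the curvature the value is a polynomial in cos t and sin t.\<close>

lemma L_great_circle:
  assumes x: "x \<in> M.T p" and y: "y \<in> M.T p"
  shows "continuous_on UNIV (\<lambda>t. L p (cos t *\<^sub>R x + sin t *\<^sub>R y))"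
proof -
  have pT: "\<phi> p x \<in> M.T p" "\<phi> p y \<in> M.T p" using x y by auto
  have "\<phi> p (cos t *\<^sub>R x + sin t *\<^sub>R y) = cos t *\<^sub>R \<phi> p x + sin t *\<^sub>R \<phi> p y" for t
    using M.phi_add[OF tangent_scale[OF x] tangent_scale[OF y]] x y by simp
  then have "L p (cos t *\<^sub>R x + sin t *\<^sub>R y) =
      M.Rm p (cos t *\<^sub>R \<phi> p x + sin t *\<^sub>R \<phi> p y) (cos t *\<^sub>R x + sin t *\<^sub>R y)
        (cos t *\<^sub>R x + sin t *\<^sub>R y) (cos t *\<^sub>R \<phi> p x + sin t *\<^sub>R \<phi> p y)" for t
    unfolding L_def by simp
  then show ?thesis
    using x y pT
    by (simp add: M.Rm_multilinear tangent_add tangent_scale del: plus_fun_apply) (intro continuous_intros)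
qed

lemma L_const_on_sphere:
  assumes fin: "finite C" and C: "\<And>x. x \<in> Sph p \<Longrightarrow> L p x \<in> C" and x: "x \<in> Sph p" and y: "y \<in> Sph p"
  shows "L p x = L p y"
proof -
  have xT: "x \<in> M.T p" and yT: "y \<in> M.T p" and xx: "g p x x = 1" and yy: "g p y y = 1"
    and x_xi: "\<And>\<alpha>. \<alpha> \<in> M.I \<Longrightarrow> g p x (\<xi> \<alpha> p) = 0" and y_xi: "\<And>\<alpha>. \<alpha> \<in> M.I \<Longrightarrow> g p y (\<xi> \<alpha> p) = 0"
    using x y unfolding Sph_def by blast+
  have yx: "g p y x = g p x y" by (rule M.g_sym[OF yT xT])
  define a where "a = g p x y"
  define z where "z = y - a *\<^sub>R x"
  have axT: "a *\<^sub>R x \<in> M.T p" by (rule tangent_scale[OF xT])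
  have zT: "z \<in> M.T p" unfolding z_def by (rule tangent_diff[OF yT axT])
  have gz: "g p w z = g p w y - a * g p w x" if "w \<in> M.T p" for w
    unfolding z_def using M.g_diff_right[OF that yT axT] M.g_scale_right[OF that xT] by simp
  have xz: "g p x z = 0" using gz[OF xT] xx by (simp add: a_def)
  have zx: "g p z x = 0" using M.g_sym[OF zT xT] xz by simp
  have zz: "g p z z = 1 - a\<^sup>2"
  proof -
    have "g p z z = g p z y" using gz[OF zT] zx by simp
    also have "\<dots> = g p y z" by (rule M.g_sym[OF zT yT])
    also have "\<dots> = 1 - a\<^sup>2" using gz[OF yT] yy yx by (simp add: a_def power2_eq_square)
    finally show ?thesis .
  qed
  have z_xi: "g p z (\<xi> \<alpha> p) = 0" if "\<alpha> \<in> M.I" for \<alpha>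
    unfolding z_def using M.g_diff_left[OF M.xi_T[OF that] yT axT] M.g_scale_left[OF M.xi_T[OF that] xT]
      x_xi[OF that] y_xi[OF that] by simp
  show ?thesis
  proof (cases "z = 0")
    \<comment> \<open>Here \<open>y\<close> is \<open>x\<close> or \<open>- x\<close>, and
      \<open>L\<close> is homogeneous of degree 4, so the values agree.\<close>
    case True
    then have y: "y = a *\<^sub>R x" by (simp add: z_def)
    have "a\<^sup>2 = 1" using zz M.g_0_left[of 0 p] True tangent_0 by simp
    then have a4: "a * (a * (a * a)) = 1" by (simp add: power2_eq_square mult.assoc[symmetric])
    have pT: "\<phi> p x \<in> M.T p" using xT by simp
    have "L p y = a * (a * (a * (a * L p x)))"
      unfolding L_def y M.phi_scale[OF xT]
      using xT pT axT tangent_scale[OF pT] by (simp add: M.Rm_multilinear)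
    then show ?thesis using a4 by (simp add: mult.assoc[symmetric])
  next
    case False
    have pos: "g p z z > 0"
      by (rule M.lorentzian_spacelike[OF lorentz M.xi_T[OF one_I] _ zT False z_xi[OF one_I]])
        (simp add: xi1_xi1)
    define r where "r = sqrt (g p z z)"
    have r: "r > 0" "r\<^sup>2 = g p z z" using pos by (auto simp: r_def)
    define w where "w = inverse r *\<^sub>R z"
    have wT: "w \<in> M.T p" unfolding w_def by (rule tangent_scale[OF zT])
    have ww: "g p w w = 1" unfolding w_def using zT r pos
      by (simp add: tangent_scale power2_eq_square[symmetric] r(2)[symmetric] field_simps)
    have xw: "g p x w = 0" unfolding w_def using xT zT xz by simp
    have wx: "g p w x = 0" using M.g_sym[OF wT xT] xw by simp
    have w_xi: "g p w (\<xi> \<alpha> p) = 0" if "\<alpha> \<in> M.I" for \<alpha>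
      unfolding w_def using M.g_scale_left[OF M.xi_T[OF that] zT] z_xi[OF that] by simp
    have yw: "y = a *\<^sub>R x + r *\<^sub>R w" unfolding w_def z_def using r by simp
    have "a\<^sup>2 + r\<^sup>2 = 1" using r zz by simp
    \<comment> \<open>\<open>x\<close> and \<open>w\<close> are orthonormal, and \<open>y\<close>
      lies at the angle \<open>s\<close> on the great circle through them.\<close>
    then obtain s where s: "a = cos s" "r = sin s" using sincos_total_2pi by metis
    define h where "h = (\<lambda>t. L p (cos t *\<^sub>R x + sin t *\<^sub>R w))"
    have S: "cos t *\<^sub>R x + sin t *\<^sub>R w \<in> Sph p" for t
    proof -
      have T: "cos t *\<^sub>R x \<in> M.T p" "sin t *\<^sub>R w \<in> M.T p" using xT wT by (auto intro: tangent_scale)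
      have "g p (cos t *\<^sub>R x + sin t *\<^sub>R w) v = cos t * g p x v + sin t * g p w v" if "v \<in> M.T p" for v
        using M.g_add_left[OF that T] M.g_scale_left[OF that xT] M.g_scale_left[OF that wT] by simp
      note gl = this
      have gr: "g p v (cos t *\<^sub>R x + sin t *\<^sub>R w) = cos t * g p v x + sin t * g p v w" if "v \<in> M.T p" for v
        using M.g_add_right[OF that T] M.g_scale_right[OF that xT] M.g_scale_right[OF that wT] by simp
      have T': "cos t *\<^sub>R x + sin t *\<^sub>R w \<in> M.T p" by (rule tangent_add[OF T])
      have "g p (cos t *\<^sub>R x + sin t *\<^sub>R w) (cos t *\<^sub>R x + sin t *\<^sub>R w) = (cos t)\<^sup>2 + (sin t)\<^sup>2"
        unfolding gl[OF T'] gr[OF xT] gr[OF wT] by (simp add: xx ww xw wx power2_eq_square)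
      then have "g p (cos t *\<^sub>R x + sin t *\<^sub>R w) (cos t *\<^sub>R x + sin t *\<^sub>R w) = 1"
        by (simp only: sin_cos_squared_add2)
      moreover have "g p (cos t *\<^sub>R x + sin t *\<^sub>R w) (\<xi> \<alpha> p) = 0" if "\<alpha> \<in> M.I" for \<alpha>
        using gl[OF M.xi_T[OF that]] x_xi[OF that] w_xi[OF that] by simp
      ultimately show ?thesis unfolding Sph_def using T' by blast
    qed
    have "continuous_on UNIV h" unfolding h_def by (rule L_great_circle[OF xT wT])
    then have "connected (range h)" by (rule connected_continuous_image) simp
    moreover have "range h \<subseteq> C" unfolding h_def using C[OF S] by blast
    then have "finite (range h)" using fin finite_subset by blast
    ultimately obtain k where "range h = {k}" using connected_finite_iff_sing[of "range h"] by blast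
    then have "h 0 = h s" by (metis rangeI singletonD)
    then show ?thesis unfolding h_def yw s by simp
  qed
qed

lemma phi_null_congruence_eq: "phi_null_congruence A g \<phi> p (\<xi> 1 p) = (\<lambda>x. \<xi> 1 p + x) ` Sph p"
proof (intro set_eqI iffI)
  fix u assume "u \<in> phi_null_congruence A g \<phi> p (\<xi> 1 p)"
  then have "u - \<xi> 1 p \<in> Sph p" by (simp add: phi_null_congruence_def phi_sphere_eq)
  moreover have "u = \<xi> 1 p + (u - \<xi> 1 p)" by simp
  ultimately show "u \<in> (\<lambda>x. \<xi> 1 p + x) ` Sph p" by blast
next
  fix u assume "u \<in> (\<lambda>x. \<xi> 1 p + x) ` Sph p"
  then obtain x where x: "u = \<xi> 1 p + x" "x \<in> Sph p" by blast
  have xT: "x \<in> M.T p" and xx: "g p x x = 1" and x_xi: "g p x (\<xi> 1 p) = 0"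
    using x(2) one_I unfolding Sph_def by blast+
  note T = M.xi_T[OF one_I, of p] xT
  have uT: "u \<in> M.T p" unfolding x(1) by (rule tangent_add[OF T])
  have gu: "g p v u = g p v (\<xi> 1 p) + g p v x" if "v \<in> M.T p" for v
    unfolding x(1) by (rule M.g_add_right[OF that T])
  have zx: "g p (\<xi> 1 p) x = 0" using M.g_sym[OF T] x_xi by simp
  have uz: "g p u (\<xi> 1 p) = -1" using M.g_sym[OF uT T(1)] gu[OF T(1)] xi1_xi1 zx by simp
  have "g p u x = 1" using M.g_sym[OF uT xT] gu[OF xT] xx x_xi by simp
  then have "g p u u = 0" using gu[OF uT] uz by simp
  moreover have "u - \<xi> 1 p \<in> Sph p" using x by simp
  ultimately show "u \<in> phi_null_congruence A g \<phi> p (\<xi> 1 p)"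
    using uT uz by (simp add: phi_null_congruence_def phi_sphere_eq null_congruence_def)
qed

text \<open>A horizontal vector orthogonal to \<xi>_1 is orthogonal to all characteristic vectors,
  hence in the image of \<phi>. This is why the full null congruence of the base corresponds to the
  \<phi>-null congruence of the total space.\<close>

lemma null_congruence_base:
  "null_congruence A' g' (\<tau> p) (d\<tau> (\<xi> 1 p)) = (\<lambda>x. d\<tau> (\<xi> 1 p) + d\<tau> x) ` Sph p"
proof (intro set_eqI iffI)
  fix w assume w: "w \<in> null_congruence A' g' (\<tau> p) (d\<tau> (\<xi> 1 p))"
  then have "w \<in> d\<tau> ` H p" using d\<tau>_bij[of p] by (auto simp: null_congruence_def bij_betw_def)
  then obtain y where y: "y \<in> H p" "w = d\<tau> y" by blast
  have yy: "g p y y = 0" and yz: "g p y (\<xi> 1 p) = -1"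
    using w d\<tau>_isometry[OF y(1) y(1)] d\<tau>_isometry[OF y(1) xi1_H] y by (auto simp: null_congruence_def)
  define x where "x = y - \<xi> 1 p"
  have xH: "x \<in> H p" unfolding x_def by (rule H_diff[OF y(1) xi1_H])
  have yx: "y = \<xi> 1 p + x" by (simp add: x_def)
  note T = H_T[OF y(1)] M.xi_T[OF one_I, of p]
  have gx: "g p x v = g p y v - g p (\<xi> 1 p) v" if "v \<in> M.T p" for v
    unfolding x_def by (rule M.g_diff_left[OF that T])
  have xz: "g p x (\<xi> 1 p) = 0" using gx[OF T(2)] yz xi1_xi1 by simp
  have "g p x x = g p x y - g p x (\<xi> 1 p)" using M.g_diff_right[OF H_T[OF xH] T] by (simp only: x_def)
  also have "\<dots> = g p y y - g p (\<xi> 1 p) y" using gx[OF T(1)] xz by simp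
  also have "\<dots> = 1" using yy yz M.g_sym[OF T] by simp
  finally have "x \<in> Sph p" using xz xH unfolding Sph_def H_def I_eq by blast
  then show "w \<in> (\<lambda>x. d\<tau> (\<xi> 1 p) + d\<tau> x) ` Sph p"
    unfolding y(2) yx d\<tau>_add by blast
next
  fix w assume "w \<in> (\<lambda>x. d\<tau> (\<xi> 1 p) + d\<tau> x) ` Sph p"
  then obtain x where x: "w = d\<tau> (\<xi> 1 p + x)" "x \<in> Sph p" unfolding d\<tau>_add by blast
  let ?u = "\<xi> 1 p + x"
  have u: "?u \<in> phi_null_congruence A g \<phi> p (\<xi> 1 p)" using x by (simp add: phi_null_congruence_eq)
  have "x \<in> H p" using x(2) unfolding Sph_def H_def by blast
  then have uH: "?u \<in> H p" by (rule H_add[OF xi1_H])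
  show "w \<in> null_congruence A' g' (\<tau> p) (d\<tau> (\<xi> 1 p))"
    using u d\<tau>_isometry[OF uH uH] d\<tau>_isometry[OF uH xi1_H] d\<tau>_T[OF H_T[OF uH]]
    unfolding x(1) by (simp add: phi_null_congruence_def null_congruence_def del: d\<tau>_add plus_fun_apply)
qed

theorem phi_null_osserman_iff:
  assumes eig: "\<And>x. x \<in> phi_sphere A g \<phi> p (\<xi> 1 p) \<Longrightarrow>
      eigenvector_on (perp A g p x) (jacobi A D p x) (\<phi> p x)"
  shows "phi_null_osserman A g D \<phi> p (\<xi> 1 p) \<longleftrightarrow> null_osserman A' g' D' (\<tau> p) (d\<tau> (\<xi> 1 p))"
proof -
  define m where "m = (\<lambda>x c. dim (eigenspace (E p x) (g p) (R_form p x) c))"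
  define m' where "m' = (\<lambda>x c. dim (eigenspace (E p x) (g p) (R_form' p x) c))"
  let ?\<mu> = "3 * real (card J)"
  have m: "m x c = dim (N p x c) + (if c = L p x + 1 then 1 else 0)"
    and m': "m' x c = dim (N p x c) + (if c = L p x + 1 + ?\<mu> then 1 else 0)" if "x \<in> Sph p" for x c
    using dim_eigenspace_R_form[OF that eig] that unfolding phi_sphere_eq m_def m'_def by blast+
  have fin: "finite {c. m x c > 0}" "finite {c. m' x c > 0}" if "x \<in> Sph p" for x
    unfolding m_def m'_def by (rule finite_spectrum[OF that])+
  have 1: "phi_null_osserman A g D \<phi> p (\<xi> 1 p) \<longleftrightarrow> (\<forall>x\<in>Sph p. \<forall>y\<in>Sph p. \<forall>c. m x c = m y c)"
    unfolding phi_null_osserman_def phi_null_congruence_eq m_def by (simp add: mult_M)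
  have 2: "null_osserman A' g' D' (\<tau> p) (d\<tau> (\<xi> 1 p)) \<longleftrightarrow> (\<forall>x\<in>Sph p. \<forall>y\<in>Sph p. \<forall>c. m' x c = m' y c)"
    unfolding null_osserman_def null_congruence_base m'_def by (simp add: mult_B)
  show ?thesis unfolding 1 2
  proof
    assume const: "\<forall>x\<in>Sph p. \<forall>y\<in>Sph p. \<forall>c. m x c = m y c"
    have L: "L p x = L p y" if x: "x \<in> Sph p" and y: "y \<in> Sph p" for x y
    proof (rule L_const_on_sphere[OF _ _ x y])
      show "finite ((\<lambda>c. c - 1) ` {c. m x c > 0})" using fin(1)[OF x] by simp
      fix w assume w: "w \<in> Sph p"
      \<comment> \<open>\<open>L p w + 1\<close> is an eigenvalue for \<open>w\<close>, hence by
        assumption for \<open>x\<close>; so all values of \<open>L\<close> lie in one finite set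
        that is fixed by \<open>x\<close>.\<close>
      have "m x (L p w + 1) = m w (L p w + 1)" using const x w by blast
      then have "m x (L p w + 1) > 0" using m[OF w, of "L p w + 1"] by simp
      then show "L p w \<in> (\<lambda>c. c - 1) ` {c. m x c > 0}" by (intro image_eqI[of _ _ "L p w + 1"]) auto
    qed
    show "\<forall>x\<in>Sph p. \<forall>y\<in>Sph p. \<forall>c. m' x c = m' y c"
    proof (intro ballI allI)
      fix x y c assume xy: "x \<in> Sph p" "y \<in> Sph p"
      have "m x c = m y c" using const xy by blast
      \<comment> \<open>Equal multiplicities and equal \<open>L\<close> give equal dimensions of
        \<open>N\<close>, to which the shifted indicator is added.\<close>
      then show "m' x c = m' y c" using m[OF xy(1)] m[OF xy(2)] m'[OF xy(1)] m'[OF xy(2)] L[OF xy] by simp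
    qed
  next
    assume const: "\<forall>x\<in>Sph p. \<forall>y\<in>Sph p. \<forall>c. m' x c = m' y c"
    have L: "L p x = L p y" if x: "x \<in> Sph p" and y: "y \<in> Sph p" for x y
    proof (rule L_const_on_sphere[OF _ _ x y])
      show "finite ((\<lambda>c. c - 1 - ?\<mu>) ` {c. m' x c > 0})" using fin(2)[OF x] by simp
      fix w assume w: "w \<in> Sph p"
      have "m' x (L p w + 1 + ?\<mu>) = m' w (L p w + 1 + ?\<mu>)" using const x w by blast
      then have "m' x (L p w + 1 + ?\<mu>) > 0" using m'[OF w, of "L p w + 1 + ?\<mu>"] by simp
      then show "L p w \<in> (\<lambda>c. c - 1 - ?\<mu>) ` {c. m' x c > 0}"
        by (intro image_eqI[of _ _ "L p w + 1 + ?\<mu>"]) auto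
    qed
    show "\<forall>x\<in>Sph p. \<forall>y\<in>Sph p. \<forall>c. m x c = m y c"
    proof (intro ballI allI)
      fix x y c assume xy: "x \<in> Sph p" "y \<in> Sph p"
      have "m' x c = m' y c" using const xy by blast
      then show "m x c = m y c" using m[OF xy(1)] m[OF xy(2)] m'[OF xy(1)] m'[OF xy(2)] L[OF xy] by simp
    qed
  qed
qed

end

text \<open>The tangent space is the sum of image and kernel of \<phi>, which meet trivially by
  \<phi>^3 = - \<phi>. The image has dimension 2n by the rank condition and the kernel dimension s,
  since duality with the forms \<eta> makes its spanning vectors independent.\<close>

lemma gff_tangent_dim:
  assumes gff: "gff_structure (A :: ('a::{t2_space, second_countable_topology}, 'e::euclidean_space) chart set) n s \<phi> \<xi> \<eta>"
    and fin: "finite B" "span B = tangent_space A p"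
  shows "dim (tangent_space A p) = DIM('e)"
proof -
  let ?T = "tangent_space A p" and ?I = "{1..s}"
  let ?V = "span ((\<lambda>\<alpha>. \<xi> \<alpha> p) ` ?I)"
  have dimE: "DIM('e) = 2 * n + s" and dimF: "dim (\<phi> p ` ?T) = 2 * n"
    and f3: "\<And>v. v \<in> ?T \<Longrightarrow> \<phi> p (\<phi> p (\<phi> p v)) + \<phi> p v = 0"
    and ker: "?V = {v \<in> ?T. \<phi> p v = 0}"
    and f2: "\<And>v. v \<in> ?T \<Longrightarrow> \<phi> p (\<phi> p v) = - v + (\<Sum>\<alpha>\<in>?I. \<eta> \<alpha> p v *\<^sub>R \<xi> \<alpha> p)"
    and exi: "\<And>\<alpha> \<beta>. \<alpha> \<in> ?I \<Longrightarrow> \<beta> \<in> ?I \<Longrightarrow> \<eta> \<alpha> p (\<xi> \<beta> p) = (if \<alpha> = \<beta> then 1 else 0)"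
    and flin: "linear_to ?T ?T (\<phi> p)" and elin: "\<And>\<alpha>. \<alpha> \<in> ?I \<Longrightarrow> linear_to ?T UNIV (\<eta> \<alpha> p)"
    using gff unfolding gff_structure_def tensor11_def one_form_def by blast+
  have fT: "\<phi> p v \<in> ?T" if "v \<in> ?T" for v using flin that by (simp add: linear_to_def)
  have fadd: "\<phi> p (v + w) = \<phi> p v + \<phi> p w" if "v \<in> ?T" "w \<in> ?T" for v w
    using flin that unfolding linear_to_def by blast
  have fscale: "\<phi> p (c *\<^sub>R v) = c *\<^sub>R \<phi> p v" if "v \<in> ?T" for v c
    using flin that unfolding linear_to_def by blast
  have xT: "\<xi> \<alpha> p \<in> ?T" if "\<alpha> \<in> ?I" for \<alpha>
  proof -
    have "\<xi> \<alpha> p \<in> ?V" by (intro span_base imageI that)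
    then show ?thesis unfolding ker by (simp only: mem_Collect_eq)
  qed
  have eta_sum: "\<eta> \<alpha> p (\<Sum>\<beta>\<in>K. c \<beta> *\<^sub>R \<xi> \<beta> p) = (\<Sum>\<beta>\<in>K. c \<beta> * \<eta> \<alpha> p (\<xi> \<beta> p))"
    if "\<alpha> \<in> ?I" "K \<subseteq> ?I" for \<alpha> K c
    using finite_subset[OF that(2) finite_atLeastAtMost] that(2)
  proof (induction K)
    case empty
    have "\<eta> \<alpha> p (0 *\<^sub>R 0) = 0 * \<eta> \<alpha> p 0"
      using elin[OF that(1)] tangent_0 unfolding linear_to_def by (metis real_scaleR_def)
    then show ?case by (simp only: sum.empty scaleR_zero_left mult_zero_left)
  next
    case (insert b K)
    have bT: "\<xi> b p \<in> ?T" using insert.prems xT by blast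
    have KT: "(\<Sum>\<beta>\<in>K. c \<beta> *\<^sub>R \<xi> \<beta> p) \<in> ?T"
      by (rule tangent_space_sum) (use insert.prems xT in blast)
    have "\<eta> \<alpha> p (c b *\<^sub>R \<xi> b p + (\<Sum>\<beta>\<in>K. c \<beta> *\<^sub>R \<xi> \<beta> p)) =
        \<eta> \<alpha> p (c b *\<^sub>R \<xi> b p) + \<eta> \<alpha> p (\<Sum>\<beta>\<in>K. c \<beta> *\<^sub>R \<xi> \<beta> p)"
      using elin[OF that(1)] tangent_scale[OF bT] KT unfolding linear_to_def by blast
    moreover have "\<eta> \<alpha> p (c b *\<^sub>R \<xi> b p) = c b * \<eta> \<alpha> p (\<xi> b p)"
      using elin[OF that(1)] bT unfolding linear_to_def by (metis real_scaleR_def)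
    ultimately show ?case
      unfolding sum.insert[OF insert.hyps] using insert.IH insert.prems by (simp only: insert_subset simp_thms)
  qed
  have coeff: "\<eta> \<alpha> p (\<Sum>\<beta>\<in>?I. c \<beta> *\<^sub>R \<xi> \<beta> p) = c \<alpha>" if \<alpha>: "\<alpha> \<in> ?I" for \<alpha> c
  proof -
    have "(\<Sum>\<beta>\<in>?I. c \<beta> * \<eta> \<alpha> p (\<xi> \<beta> p)) = (\<Sum>\<beta>\<in>?I. if \<beta> = \<alpha> then c \<beta> else 0)"
      by (rule sum.cong) (use \<alpha> exi in auto)
    then show ?thesis unfolding eta_sum[OF \<alpha> subset_refl] using \<alpha> by simp
  qed
  have inj: "inj_on (\<lambda>\<alpha>. \<xi> \<alpha> p) ?I"
    by (rule inj_onI) (metis exi zero_neq_one)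
  have ind: "independent ((\<lambda>\<alpha>. \<xi> \<alpha> p) ` ?I)"
    unfolding dependent_finite[OF finite_imageI[OF finite_atLeastAtMost]]
  proof clarify
    fix f \<alpha> assume s: "(\<Sum>v\<in>(\<lambda>\<alpha>. \<xi> \<alpha> p) ` ?I. f v *\<^sub>R v) = 0" and a: "\<alpha> \<in> ?I" "f (\<xi> \<alpha> p) \<noteq> 0"
    have "(\<Sum>\<beta>\<in>?I. f (\<xi> \<beta> p) *\<^sub>R \<xi> \<beta> p) = (\<Sum>\<beta>\<in>?I. 0 *\<^sub>R \<xi> \<beta> p)"
      using s by (simp only: sum.reindex[OF inj] comp_def scaleR_zero_left sum.neutral_const)
    then have "f (\<xi> \<alpha> p) = 0"
      using coeff[OF a(1), of "\<lambda>\<beta>. f (\<xi> \<beta> p)"] coeff[OF a(1), of "\<lambda>\<beta>. 0"] by (simp only:)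
    then show False using a by simp
  qed
  have dimV: "dim ?V = s"
    using dim_eq_card[OF _ ind, of ?V] card_image[OF inj] by (simp add: span_span)
  have sF: "subspace (\<phi> p ` ?T)"
  proof (rule subspaceI)
    have "\<phi> p (0 *\<^sub>R 0) = 0" using fscale[OF tangent_0, of 0] by (simp only: scaleR_zero_left)
    then show "0 \<in> \<phi> p ` ?T" using tangent_0[of A p] by (metis imageI scaleR_zero_left)
    show "v + w \<in> \<phi> p ` ?T" if vw: "v \<in> \<phi> p ` ?T" "w \<in> \<phi> p ` ?T" for v w
    proof -
      obtain a b where ab: "a \<in> ?T" "v = \<phi> p a" "b \<in> ?T" "w = \<phi> p b" using vw by blast
      show ?thesis unfolding ab fadd[OF ab(1,3), symmetric] by (intro imageI tangent_add ab)
    qed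
    show "c *\<^sub>R v \<in> \<phi> p ` ?T" if v: "v \<in> \<phi> p ` ?T" for c v
    proof -
      obtain a where a: "a \<in> ?T" "v = \<phi> p a" using v by blast
      show ?thesis unfolding a fscale[OF a(1), symmetric] by (intro imageI tangent_scale a)
    qed
  qed
  have "?T = {v + w | v w. v \<in> \<phi> p ` ?T \<and> w \<in> ?V}"
  proof (intro set_eqI iffI)
    fix v assume v: "v \<in> ?T"
    have "v = \<phi> p ((-1) *\<^sub>R \<phi> p v) + (\<Sum>\<alpha>\<in>?I. \<eta> \<alpha> p v *\<^sub>R \<xi> \<alpha> p)"
      unfolding fscale[OF fT[OF v]] f2[OF v] by simp
    moreover have "\<phi> p ((-1) *\<^sub>R \<phi> p v) \<in> \<phi> p ` ?T" by (intro imageI tangent_scale fT v)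
    moreover have "(\<Sum>\<alpha>\<in>?I. \<eta> \<alpha> p v *\<^sub>R \<xi> \<alpha> p) \<in> ?V" by (intro span_sum span_scale span_base imageI)
    ultimately show "v \<in> {v + w | v w. v \<in> \<phi> p ` ?T \<and> w \<in> ?V}" by blast
  next
    fix v assume "v \<in> {v + w | v w. v \<in> \<phi> p ` ?T \<and> w \<in> ?V}"
    then obtain a w where "v = \<phi> p a + w" "a \<in> ?T" "w \<in> ?T" using ker by blast
    then show "v \<in> ?T" by (metis fT tangent_add)
  qed
  moreover have "dim {v + w | v w. v \<in> \<phi> p ` ?T \<and> w \<in> ?V} = dim (\<phi> p ` ?T) + dim ?V"
  proof (rule dim_direct_sum[OF fin(1) _ _ sF subspace_span])
    show "\<phi> p ` ?T \<subseteq> span B" unfolding fin(2) using fT by blast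
    show "?V \<subseteq> span B" unfolding fin(2) using ker by blast
    show "\<phi> p ` ?T \<inter> ?V \<subseteq> {0}"
    proof
      fix v assume v: "v \<in> \<phi> p ` ?T \<inter> ?V"
      then obtain a where a: "a \<in> ?T" "v = \<phi> p a" by blast
      have "\<phi> p v = 0" using v ker by blast
      moreover have "\<phi> p 0 = 0" using fscale[OF tangent_0, of 0] by (simp only: scaleR_zero_left)
      ultimately have "v = 0" using f3[OF a(1)] unfolding a(2)[symmetric] by simp
      then show "v \<in> {0}" by simp
    qed
  qed
  ultimately show ?thesis using dimV dimF dimE by simp
qed

text \<open>The orthonormal bases in the definition of a Lorentzian metric provide the finite
  spanning sets from which the dimension count starts.\<close>

lemma lorentzian_S_manifold_imp_smooth_mfd:
  assumes "lorentzian_S_manifold A n s \<phi> \<xi> \<eta> g"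
  shows "smooth_mfd A"
proof -
  have gff: "gff_structure A n s \<phi> \<xi> \<eta>" and L: "lorentzian_metric A g"
    using assms by (auto simp: lorentzian_S_manifold_def indefinite_S_manifold_def)
  have fin: "\<exists>B. finite B \<and> span B = tangent_space A p" for p
    using lorentzian_metric_basis[OF L, of p] by (elim exE conjE) (intro exI conjI)
  show ?thesis
  proof
    show "is_atlas A" using gff by (simp add: gff_structure_def smooth_manifold_def)
    show "\<exists>B. finite B \<and> span B = tangent_space A p" for p by (rule fin)
    show "dim (tangent_space A p) = DIM('b)" for p using fin[of p] gff_tangent_dim[OF gff] by blast
  qed
qed

theorem proposition4p7:
  fixes A :: "('a::{t2_space, second_countable_topology}, 'e::euclidean_space) chart set"
    and A' :: "('b::{t2_space, second_countable_topology}, 'f::euclidean_space) chart set"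
    and n s :: nat
    and \<phi> :: "'a \<Rightarrow> 'a tvec \<Rightarrow> 'a tvec" and \<xi> :: "nat \<Rightarrow> 'a vfield"
    and \<eta> :: "nat \<Rightarrow> 'a \<Rightarrow> 'a tvec \<Rightarrow> real" and g :: "'a metric"
    and D :: "'a vfield \<Rightarrow> 'a vfield \<Rightarrow> 'a vfield"
    and \<phi>' :: "'b \<Rightarrow> 'b tvec \<Rightarrow> 'b tvec" and \<xi>' :: "'b vfield"
    and \<eta>' :: "'b \<Rightarrow> 'b tvec \<Rightarrow> real" and g' :: "'b metric"
    and D' :: "'b vfield \<Rightarrow> 'b vfield \<Rightarrow> 'b vfield"
    and \<tau> :: "'a \<Rightarrow> 'b" and act :: "'a \<Rightarrow> complex ^ 'k \<Rightarrow> 'a"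
    and p :: 'a
  assumes "s \<ge> 2"
    and "lorentzian_S_manifold A n s \<phi> \<xi> \<eta> g"
    and "levi_civita A g D"
    and "lorentz_sasakian_manifold A' n \<phi>' \<xi>' \<eta>' g'"
    and "levi_civita A' g' D'"
    and "CARD('k) = s - 1" and "principal_torus_bundle A A' \<tau> act"
    and "semi_riemannian_submersion A g A' g' \<tau>"
    and "totally_geodesic_fibres A D A' \<tau>"
    and "\<And>q. vertical_space A A' \<tau> q = span ((\<lambda>\<alpha>. \<xi> \<alpha> q) ` {2..s})"
    and "\<And>q x. x \<in> tangent_space A q \<Longrightarrow>
           differential A' \<tau> (\<phi> q x) = \<phi>' (\<tau> q) (differential A' \<tau> x)"
    and "\<And>q. differential A' \<tau> (\<xi> 1 q) = \<xi>' (\<tau> q)"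
    and "\<And>x. x \<in> phi_sphere A g \<phi> p (\<xi> 1 p) \<Longrightarrow>
           eigenvector_on (perp A g p x) (jacobi A D p x) (\<phi> p x)"
  shows "phi_null_osserman A g D \<phi> p (\<xi> 1 p) \<longleftrightarrow> null_osserman A' g' D' (\<tau> p) (\<xi>' (\<tau> p))"
proof -
  note s2 = assms(1) and S = assms(2) and LC = assms(3) and S' = assms(4) and LC' = assms(5)
    and sub = assms(8) and vert = assms(10) and d\<xi> = assms(12) and eig = assms(13)
  define \<epsilon> where "\<epsilon> = (\<lambda>\<alpha>::nat. if \<alpha> = 1 then -1 else (1::real))"
  interpret M0: smooth_mfd A by (rule lorentzian_S_manifold_imp_smooth_mfd[OF S])
  \<comment> \<open>The base is itself a Lorentzian S-manifold with a single characteristic field,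
    so the same dimension count applies to it.\<close>
  interpret B0: smooth_mfd A'
    by (rule lorentzian_S_manifold_imp_smooth_mfd) (rule S'[unfolded lorentz_sasakian_manifold_def])
  have ind: "indefinite_S_manifold A n s \<phi> \<xi> \<eta> g" and lor: "lorentzian_metric A g"
    and xi1: "\<And>q. g q (\<xi> 1 q) (\<xi> 1 q) = -1"
    and xi2: "\<And>q \<alpha>. \<alpha> \<in> {2..s} \<Longrightarrow> g q (\<xi> \<alpha> q) (\<xi> \<alpha> q) = 1"
    using S unfolding lorentzian_S_manifold_def by blast+
  have met: "semi_riemannian_metric A g" and met': "semi_riemannian_metric A' g'"
    using S S' unfolding lorentz_sasakian_manifold_def lorentzian_S_manifold_def lorentzian_metric_def by blast+
  interpret lorentzian_S_submersion A g D n s \<phi> \<xi> \<eta> \<epsilon> A' g' D' \<tau>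
  proof unfold_locales
    show "semi_riemannian_metric A g" "semi_riemannian_metric A' g'" by (fact met met')+
    show "levi_civita A g D" "levi_civita A' g' D'" by (fact LC LC')+
    show "indefinite_S_manifold A n s \<phi> \<xi> \<eta> g" "lorentzian_metric A g" by (fact ind lor)+
    show "1 \<le> s" using s2 by simp
    show "g q (\<xi> \<alpha> q) (\<xi> \<alpha> q) = \<epsilon> \<alpha>" if "\<alpha> \<in> {1..s}" for \<alpha> q
      using that xi1[of q] xi2[of \<alpha> q] by (cases "\<alpha> = 1") (auto simp: \<epsilon>_def)
    show "semi_riemannian_submersion A g A' g' \<tau>" by (fact sub)
    show "vertical_space A A' \<tau> q = span ((\<lambda>\<alpha>. \<xi> \<alpha> q) ` {2..s})" for q by (rule vert)
    show "\<epsilon> \<alpha> = 1" if "\<alpha> \<in> {2..s}" for \<alpha> using that by (simp add: \<epsilon>_def)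
    show "\<epsilon> 1 = -1" by (simp add: \<epsilon>_def)
  qed
  show ?thesis using phi_null_osserman_iff[OF eig] unfolding d\<xi> .
qed

end
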